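(* Let $n\ge1$ and let $A_n$ be an $n\times n$ real symmetric random matrix with probability density $p_n(A)\propto\prod_{i=1}^n w(\lambda_i)$, where $\lambda_1\le\cdots\le\lambda_n$ are the eigenvalues of $A$. Let $\varphi_i$, $\sigma_k$, $\gamma_i$ be the monic skew-orthogonal polynomial system and constants associated with $w$ as defined in the context. Then $$\mathbb{E}[\det(xI_n-A_n)]=\widehat\varphi_n(x),$$ where $$\widehat\varphi_n(x)=\begin{cases}\varphi_n(x)&(n\text{ even}),\\[1mm] \displaystyle\varphi_n(x)+\frac{\gamma_n}{\gamma_{n-2}}\varphi_{n-2}(x)+\cdots+\frac{\gamma_n}{\gamma_3}\varphi_3(x)+\frac{\gamma_n}{\gamma_1}\varphi_1(x)&(n\text{ odd}).\end{cases}$$ Conversely, the skew-orthogonal polynomials are expressed as $$\varphi_n(x)=\begin{cases}\widehat\varphi_n(x)&(n\text{ even}),\\[1mm] \displaystyle\widehat\varphi_n(x)-\frac{\gamma_n}{\gamma_{n-2}}\widehat\varphi_{n-2}(x)&(n\text{ odd}),\end{cases}$$ where for $n=1$ the second term is absent.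
   Context: $w:\mathbb{R}\to[0,\infty)$ is a weight function with finite moments of every order and $\int_{\mathbb{R}} w(x)\,dx>0$. The density is with respect to Lebesgue measure on the space of real symmetric $n\times n$ matrices identified with $\mathbb{R}^{n(n+1)/2}$. Skew-orthogonal polynomials: $\varphi_i$, $i\ge0$, is the (unique) system of monic polynomials with $\deg\varphi_i=i$ such that (1) $\bigl(\int_{x<y}-\int_{x>y}\bigr)\varphi_i(x)\varphi_j(y)w(x)w(y)\,dx\,dy$ equals $\sigma_k$ if $(i,j)=(2k,2k+1)$, $-\sigma_k$ if $(i,j)=(2k+1,2k)$, and $0$ otherwise, with $\sigma_k>0$, $k\ge 0$; (2) $\int_{\mathbb{R}}\varphi_i(x)w(x)\,dx=\gamma_i>0$ for $i$ even, and $=0$ for $i$ odd. For odd indices define $\gamma_{2k+1}=\sigma_k/\gamma_{2k}$, $k\ge0$. For $n$ odd, the sum defining $\widehat\varphi_n$ runs over all odd indices up to $n$. *)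

theory Defs
  imports
    "HOL-Probability.Probability"
    "Jordan_Normal_Form.Char_Poly"
begin

hide_const (open) Determinants.det Finite_Cartesian_Product.mat

definition upper_indices :: "nat \<Rightarrow> (nat \<times> nat) set" where
  "upper_indices n = {(i, j). i \<le> j \<and> j < n}"

definition sym_mat_of :: "nat \<Rightarrow> (nat \<times> nat \<Rightarrow> real) \<Rightarrow> real mat" where
  "sym_mat_of n a = mat n n (\<lambda>(i, j). a (min i j, max i j))"

text \<open>
  The upper triangular entries, diagonal included, identify the real symmetric
  \<open>n \<times> n\<close> matrices with a Euclidean space of dimension \<open>n (n + 1) / 2\<close>.
  The measure below is Lebesgue measure transported along this bijection.
\<close>

definition sym_mat_lborel :: "nat \<Rightarrow> real mat measure" where
  "sym_mat_lborel n = embed_measure (PiM (upper_indices n) (\<lambda>_. lborel)) (sym_mat_of n)"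

lemma inj_on_sym_mat_of:
  "inj_on (sym_mat_of n) (space (PiM (upper_indices n) (\<lambda>_. lborel)))"
proof (rule inj_onI)
  fix a b :: "nat \<times> nat \<Rightarrow> real"
  assume a: "a \<in> space (PiM (upper_indices n) (\<lambda>_. lborel))"
    and b: "b \<in> space (PiM (upper_indices n) (\<lambda>_. lborel))"
    and eq: "sym_mat_of n a = sym_mat_of n b"
  show "a = b"
  proof (rule extensionalityI[of _ "upper_indices n"])
    show "a \<in> extensional (upper_indices n)" "b \<in> extensional (upper_indices n)"
      using a b by (auto simp: space_PiM PiE_def)
    fix p assume "p \<in> upper_indices n"
    then obtain i j where p: "p = (i, j)" and ij: "i \<le> j" "j < n"
      by (auto simp: upper_indices_def)
    have "sym_mat_of n a $$ (i, j) = sym_mat_of n b $$ (i, j)"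
      using eq by simp
    then show "a p = b p"
      using p ij by (simp add: sym_mat_of_def min_def max_def)
  qed
qed

lemma space_sym_mat_lborel:
  "space (sym_mat_lborel n) = {A \<in> carrier_mat n n. transpose_mat A = A}"
proof
  show "space (sym_mat_lborel n) \<subseteq> {A \<in> carrier_mat n n. transpose_mat A = A}"
    by (auto simp: sym_mat_lborel_def space_embed_measure sym_mat_of_def min.commute max.commute
        intro!: eq_matI)
  show "{A \<in> carrier_mat n n. transpose_mat A = A} \<subseteq> space (sym_mat_lborel n)"
  proof
    fix A :: "real mat" assume "A \<in> {A \<in> carrier_mat n n. transpose_mat A = A}"
    then have A: "A \<in> carrier_mat n n" and sym: "transpose_mat A = A" by auto
    have sym': "A $$ (j, i) = A $$ (i, j)" if "i < n" "j < n" for i j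
      using that A sym by (metis carrier_matD index_transpose_mat(1))
    let ?a = "restrict (\<lambda>p. A $$ p) (upper_indices n)"
    have "A = sym_mat_of n ?a"
      using A sym' by (intro eq_matI)
        (auto simp: sym_mat_of_def upper_indices_def min_def max_def)
    moreover have "?a \<in> space (PiM (upper_indices n) (\<lambda>_. lborel))"
      by (auto simp: space_PiM)
    ultimately show "A \<in> space (sym_mat_lborel n)"
      by (auto simp: sym_mat_lborel_def space_embed_measure)
  qed
qed

text \<open>
  The eigenvalues in increasing order, repeated according to multiplicity. For a real symmetric
  \<open>n \<times> n\<close> matrix all roots of the characteristic polynomial are real, so the list has length \<open>n\<close>.
\<close>

definition ordered_eigenvalues :: "real mat \<Rightarrow> real list" where
  "ordered_eigenvalues A = sorted_list_of_multiset (proots (char_poly A))"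

definition skew_form :: "(real \<Rightarrow> real) \<Rightarrow> real poly \<Rightarrow> real poly \<Rightarrow> real" where
  "skew_form w p q =
     (LINT (x, y) : {(x, y). x < y} | lborel \<Otimes>\<^sub>M lborel. poly p x * poly q y * w x * w y) -
     (LINT (x, y) : {(x, y). x > y} | lborel \<Otimes>\<^sub>M lborel. poly p x * poly q y * w x * w y)"

definition skew_orthogonal_system ::
    "(real \<Rightarrow> real) \<Rightarrow> (nat \<Rightarrow> real poly) \<Rightarrow> (nat \<Rightarrow> real) \<Rightarrow> (nat \<Rightarrow> real) \<Rightarrow> bool" where
  "skew_orthogonal_system w \<phi> \<sigma> \<gamma> \<longleftrightarrow>
     (\<forall>i. degree (\<phi> i) = i \<and> lead_coeff (\<phi> i) = 1) \<and>
     (\<forall>k. \<sigma> k > 0) \<and>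
     (\<forall>k. skew_form w (\<phi> (2 * k)) (\<phi> (2 * k + 1)) = \<sigma> k) \<and>
     (\<forall>k. skew_form w (\<phi> (2 * k + 1)) (\<phi> (2 * k)) = - \<sigma> k) \<and>
     (\<forall>i j. (\<nexists>k. (i, j) = (2 * k, 2 * k + 1) \<or> (i, j) = (2 * k + 1, 2 * k)) \<longrightarrow>
        skew_form w (\<phi> i) (\<phi> j) = 0) \<and>
     (\<forall>i. even i \<longrightarrow> (LINT x|lborel. poly (\<phi> i) x * w x) = \<gamma> i \<and> \<gamma> i > 0) \<and>
     (\<forall>i. odd i \<longrightarrow> (LINT x|lborel. poly (\<phi> i) x * w x) = 0) \<and>
     (\<forall>k. \<gamma> (2 * k + 1) = \<sigma> k / \<gamma> (2 * k))"

definition phi_hat :: "(nat \<Rightarrow> real poly) \<Rightarrow> (nat \<Rightarrow> real) \<Rightarrow> nat \<Rightarrow> real poly" where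
  "phi_hat \<phi> \<gamma> n =
     (if even n then \<phi> n
      else \<phi> n + (\<Sum>k | odd k \<and> k < n. Polynomial.smult (\<gamma> n / \<gamma> k) (\<phi> k)))"

end

theory Submission
  imports Defs
begin

text \<open>
  Under Lebesgue measure on symmetric matrices the characteristic polynomial is uniformly distributed, up
  to a constant factor, over the coefficients of the monic polynomials with distinct real roots. This goes by
  induction on the size: after diagonalising the leading block, with characteristic polynomial \<open>Q\<close>, the
  bordered matrix has characteristic polynomial \<open>P = (x - a) Q - (\<Sum>i. v i ^ 2 * Q / (x - d i))\<close>, so that the
  pair \<open>(P, Q)\<close> has density \<open>1 / sqrt \<bar>Res P Q\<bar>\<close> on interlacing pairs. Integrating out \<open>Q\<close>, which is a convex
  combination of the polynomials \<open>P / (x - l j)\<close>, leaves a Dirichlet integral that does not depend on \<open>P\<close>.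

  In root coordinates this is the density \<open>\<Prod>i<j. (l j - l i)\<close> on ordered tuples. The Vandermonde product times
  \<open>\<Prod>i. (x - l i)\<close> is a determinant in \<open>\<phi> 0, \<dots>, \<phi> n\<close>. As it is antisymmetric, the ordering of the roots may be
  replaced by \<open>\<Prod>k. sgn (l (2 k + 1) - l (2 k))\<close>, and then skew-orthogonality leaves only the permutations that
  preserve the pairs \<open>{2 k, 2 k + 1}\<close>.
\<close>

subsection \<open>Lebesgue measure on coordinates and polynomial coefficients\<close>

text \<open>No Jacobian of the spectral decomposition is taken. Polynomial coefficients are the
  intermediate coordinates because, for fixed nodes, the changes of basis are linear; the only
  nonlinear substitutions are one-dimensional, squaring a border entry and moving along level sets
  to the largest root. Diagonalising the leading block needs a simple spectrum, which holds almost
  surely because the law found at the previous size lives on polynomials with distinct real roots.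
  No constant is evaluated. The factor \<open>C\<close> of the law lies in the extended reals and is
  fixed only by total mass 1; the antisymmetrisation constant and the permutation sums drop out when
  coefficients of x^n are compared. It only matters that the permutation sums are positive: the sign
  of a pair-preserving permutation cancels the signs of its skew products. For odd n the unpaired
  variable contributes a moment; leaving the pair {2k, 2k+1} to it and to x loses a factor
  \<sigma>_k and gains \<gamma>_(2k), which is the coefficient 1/\<gamma>_(2k+1).\<close>

abbreviation leb :: "'i set \<Rightarrow> ('i \<Rightarrow> real) measure" where
  "leb I \<equiv> PiM I (\<lambda>_. lborel)"

interpretation leb: product_sigma_finite "\<lambda>_. lborel :: real measure"
  by (simp add: product_sigma_finite_def lborel.sigma_finite_measure_axioms)

lemma sigma_finite_leb: "finite I \<Longrightarrow> sigma_finite_measure (leb I)"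
  by (rule leb.sigma_finite)

lemma borel_measurable_nn_integral_leb [measurable (raw)]:
  assumes "finite I" "(\<lambda>(x, y). f x y) \<in> borel_measurable (N \<Otimes>\<^sub>M leb I)"
  shows "(\<lambda>x. \<integral>\<^sup>+y. f x y \<partial>leb I) \<in> borel_measurable N"
  using sigma_finite_measure.borel_measurable_nn_integral[OF sigma_finite_leb] assms by blast

lemma leb_swap:
  assumes "finite I" "finite J"
    and "(\<lambda>(x, y). f x y) \<in> borel_measurable (leb I \<Otimes>\<^sub>M leb J)"
  shows "(\<integral>\<^sup>+x. \<integral>\<^sup>+y. f x y \<partial>leb J \<partial>leb I) = (\<integral>\<^sup>+y. \<integral>\<^sup>+x. f x y \<partial>leb I \<partial>leb J)"
proof -
  interpret I: sigma_finite_measure "leb I" by (rule sigma_finite_leb) fact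
  interpret J: sigma_finite_measure "leb J" by (rule sigma_finite_leb) fact
  interpret pair_sigma_finite "leb I" "leb J" ..
  show ?thesis using Fubini'[OF assms(3)] by simp
qed

lemma leb_swap_lborel:
  assumes "finite I" "(\<lambda>(x, y). f x y) \<in> borel_measurable (leb I \<Otimes>\<^sub>M lborel)"
  shows "(\<integral>\<^sup>+x. \<integral>\<^sup>+y. f x y \<partial>lborel \<partial>leb I) = (\<integral>\<^sup>+y. \<integral>\<^sup>+x. f x y \<partial>leb I \<partial>lborel)"
proof -
  interpret I: sigma_finite_measure "leb I" by (rule sigma_finite_leb) fact
  interpret pair_sigma_finite "leb I" lborel ..
  show ?thesis using Fubini'[OF assms(2)] by simp
qed

lemma measurable_leb_coordinate: "(\<lambda>x. x i) \<in> borel_measurable (leb I)"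
proof (cases "i \<in> I")
  \<comment> \<open>Outside \<open>I\<close> every point of the product space takes the value
    \<open>undefined\<close>, so the coordinate is a constant.\<close>
  case False
  have "(\<lambda>x. undefined) \<in> borel_measurable (leb I)" by simp
  then show ?thesis
    by (rule measurable_cong[THEN iffD1, rotated]) (use False in \<open>auto simp: space_PiM PiE_def extensional_def\<close>)
next
  case True
  then show ?thesis using measurable_component_singleton[of i I "\<lambda>_. lborel :: real measure"] by simp
qed

lemma measurable_leb_fun_upd [measurable (raw)]:
  assumes "f \<in> measurable N (leb I)" "g \<in> borel_measurable N"
  shows "(\<lambda>x. (f x)(a := g x)) \<in> measurable N (leb (insert a I))"
  using assms by (intro measurable_fun_upd[where J = I]) auto

lemma measurable_leb_fun_upd_lessThan [measurable (raw)]: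
  assumes "f \<in> measurable N (leb {..<n})" "g \<in> borel_measurable N"
  shows "(\<lambda>x. (f x)(n := g x)) \<in> measurable N (leb {..<Suc n})"
  using measurable_leb_fun_upd[OF assms, of n] by (simp add: lessThan_Suc)

lemma measurable_lebI [measurable (raw)]:
  assumes "\<And>i. i \<in> I \<Longrightarrow> (\<lambda>x. f x i) \<in> borel_measurable N"
  shows "(\<lambda>x. \<lambda>i\<in>I. f x i) \<in> measurable N (leb I)"
  using assms by (intro measurable_restrict) auto

lemma nn_integral_leb_insert:
  assumes "finite I" "a \<notin> I" "f \<in> borel_measurable (leb (insert a I))"
  shows "(\<integral>\<^sup>+x. f x \<partial>leb (insert a I)) = (\<integral>\<^sup>+x. \<integral>\<^sup>+y. f (x(a := y)) \<partial>lborel \<partial>leb I)"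
    and "(\<integral>\<^sup>+x. f x \<partial>leb (insert a I)) = (\<integral>\<^sup>+y. \<integral>\<^sup>+x. f (x(a := y)) \<partial>leb I \<partial>lborel)"
  by (rule leb.product_nn_integral_insert[OF assms], rule leb.product_nn_integral_insert_rev[OF assms])

lemma nn_integral_leb_Suc:
  assumes "f \<in> borel_measurable (leb {..<Suc n})"
  shows "(\<integral>\<^sup>+x. f x \<partial>leb {..<Suc n}) = (\<integral>\<^sup>+x. \<integral>\<^sup>+y. f (x(n := y)) \<partial>lborel \<partial>leb {..<n})"
    and "(\<integral>\<^sup>+x. f x \<partial>leb {..<Suc n}) = (\<integral>\<^sup>+y. \<integral>\<^sup>+x. f (x(n := y)) \<partial>leb {..<n} \<partial>lborel)"
  using nn_integral_leb_insert[of "{..<n}" n f] assms by (auto simp: lessThan_Suc)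

text \<open>A substitution in each variable separately, with its density \<open>r i\<close>,
  multiplies up over the index set. It serves affine maps as well as the squaring of border
  entries.\<close>

lemma nn_integral_leb_coordinatewise:
  fixes h :: "'i \<Rightarrow> real \<Rightarrow> real"
  assumes "finite I" and h [measurable]: "\<And>i. h i \<in> borel_measurable borel"
    and r [measurable]: "\<And>i. r i \<in> borel_measurable borel"
    and sub: "\<And>i f. i \<in> I \<Longrightarrow> f \<in> borel_measurable borel \<Longrightarrow>
      (\<integral>\<^sup>+y. f (h i y) \<partial>lborel) = (\<integral>\<^sup>+y. r i y * f y \<partial>lborel)"
    and "G \<in> borel_measurable (leb I)"
  shows "(\<integral>\<^sup>+x. G (\<lambda>i\<in>I. h i (x i)) \<partial>leb I) = (\<integral>\<^sup>+x. (\<Prod>i\<in>I. r i (x i)) * G x \<partial>leb I)"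
  using assms(1,4,5)
proof (induction I arbitrary: G rule: finite_induct)
  case empty
  show ?case by (simp add: PiM_empty nn_integral_count_space_finite restrict_def)
next
  case (insert a I)
  note [measurable] = insert.prems(2)
  have eq: "(\<lambda>i\<in>insert a I. h i ((x(a := y)) i)) = (\<lambda>i\<in>I. h i (x i))(a := h a y)" for x y
    using insert.hyps by (auto simp: fun_eq_iff)
  have m: "(\<lambda>y. G ((\<lambda>i\<in>I. h i (x i))(a := y))) \<in> borel_measurable borel" for x
    by measurable
  have "(\<integral>\<^sup>+x. G (\<lambda>i\<in>insert a I. h i (x i)) \<partial>leb (insert a I)) =
      (\<integral>\<^sup>+x. \<integral>\<^sup>+y. G ((\<lambda>i\<in>I. h i (x i))(a := h a y)) \<partial>lborel \<partial>leb I)"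
    by (subst nn_integral_leb_insert(1)[OF insert.hyps]) (measurable, simp only: eq)
  also have "\<dots> = (\<integral>\<^sup>+x. \<integral>\<^sup>+y. r a y * G ((\<lambda>i\<in>I. h i (x i))(a := y)) \<partial>lborel \<partial>leb I)"
    by (intro nn_integral_cong insert.prems(1) m) auto
  \<comment> \<open>The new variable is moved outside, so that the induction hypothesis applies to
    the remaining ones with \<open>y\<close> fixed.\<close>
  also have "\<dots> = (\<integral>\<^sup>+y. \<integral>\<^sup>+x. r a y * G ((\<lambda>i\<in>I. h i (x i))(a := y)) \<partial>leb I \<partial>lborel)"
    by (intro leb_swap_lborel insert.hyps) measurable
  also have "\<dots> = (\<integral>\<^sup>+y. r a y * (\<integral>\<^sup>+x. G ((\<lambda>i\<in>I. h i (x i))(a := y)) \<partial>leb I) \<partial>lborel)"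
    by (intro nn_integral_cong nn_integral_cmult) measurable
  also have "\<dots> = (\<integral>\<^sup>+y. r a y * (\<integral>\<^sup>+x. (\<Prod>i\<in>I. r i (x i)) * G (x(a := y)) \<partial>leb I) \<partial>lborel)"
  proof (rule nn_integral_cong)
    fix y :: real
    have "(\<integral>\<^sup>+x. G ((\<lambda>i\<in>I. h i (x i))(a := y)) \<partial>leb I) = (\<integral>\<^sup>+x. (\<Prod>i\<in>I. r i (x i)) * G (x(a := y)) \<partial>leb I)"
      by (rule insert.IH) (rule insert.prems(1), simp, assumption, measurable)
    then show "r a y * (\<integral>\<^sup>+x. G ((\<lambda>i\<in>I. h i (x i))(a := y)) \<partial>leb I) =
        r a y * (\<integral>\<^sup>+x. (\<Prod>i\<in>I. r i (x i)) * G (x(a := y)) \<partial>leb I)" by simp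
  qed
  also have "\<dots> = (\<integral>\<^sup>+y. \<integral>\<^sup>+x. r a y * ((\<Prod>i\<in>I. r i (x i)) * G (x(a := y))) \<partial>leb I \<partial>lborel)"
    by (intro nn_integral_cong nn_integral_cmult[symmetric]) measurable
  also have "\<dots> = (\<integral>\<^sup>+x. (\<Prod>i\<in>insert a I. r i (x i)) * G x \<partial>leb (insert a I))"
  proof (subst nn_integral_leb_insert(2)[OF insert.hyps])
    have "(\<Prod>i\<in>I. r i (if i = a then y else x i)) = (\<Prod>i\<in>I. r i (x i))" for x y
      using insert.hyps by (intro prod.cong) auto
    then have "(\<Prod>i\<in>insert a I. r i ((x(a := y)) i)) = r a y * (\<Prod>i\<in>I. r i (x i))" for x y
      using insert.hyps by (subst prod.insert) simp_all
    then show "(\<integral>\<^sup>+y. \<integral>\<^sup>+x. r a y * ((\<Prod>i\<in>I. r i (x i)) * G (x(a := y))) \<partial>leb I \<partial>lborel) =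
      (\<integral>\<^sup>+y. \<integral>\<^sup>+x. (\<Prod>i\<in>insert a I. r i ((x(a := y)) i)) * G (x(a := y)) \<partial>leb I \<partial>lborel)"
      by (simp only: mult.assoc)
  qed measurable
  finally show ?case .
qed

lemma nn_integral_lborel_affine:
  fixes f :: "real \<Rightarrow> ennreal"
  assumes "f \<in> borel_measurable borel" "c \<noteq> 0"
  shows "(\<integral>\<^sup>+y. f (t + c * y) \<partial>lborel) = (\<integral>\<^sup>+y. ennreal (1 / \<bar>c\<bar>) * f y \<partial>lborel)"
proof -
  have "(\<integral>\<^sup>+y. ennreal (1 / \<bar>c\<bar>) * f y \<partial>lborel) = ennreal (1 / \<bar>c\<bar>) * (\<integral>\<^sup>+y. f y \<partial>lborel)"
    using assms by (intro nn_integral_cmult) auto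
  also have "\<dots> = ennreal (1 / \<bar>c\<bar>) * (ennreal \<bar>c\<bar> * (\<integral>\<^sup>+y. f (t + c * y) \<partial>lborel))"
    by (subst nn_integral_real_affine[OF assms, of t]) simp
  also have "\<dots> = (\<integral>\<^sup>+y. f (t + c * y) \<partial>lborel)"
    using assms(2) by (simp add: mult.assoc[symmetric] ennreal_mult[symmetric])
  finally show ?thesis ..
qed

lemma nn_integral_lborel_translate:
  fixes f :: "real \<Rightarrow> ennreal"
  assumes "f \<in> borel_measurable borel"
  shows "(\<integral>\<^sup>+y. f (t + y) \<partial>lborel) = (\<integral>\<^sup>+y. f y \<partial>lborel)"
  using nn_integral_lborel_affine[OF assms, of 1 t] by simp

text \<open>The determinant multiplies the left side instead of dividing the right, so that
  Vandermonde factors can be collected without inverses in \<open>ennreal\<close>.\<close>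

lemma nn_integral_leb_affine:
  assumes "finite I" "\<And>i. i \<in> I \<Longrightarrow> c i \<noteq> 0" "G \<in> borel_measurable (leb I)"
  shows "ennreal \<bar>\<Prod>i\<in>I. c i\<bar> * (\<integral>\<^sup>+x. G (\<lambda>i\<in>I. t i + c i * x i) \<partial>leb I) = (\<integral>\<^sup>+x. G x \<partial>leb I)"
proof -
  have "(\<integral>\<^sup>+x. G (\<lambda>i\<in>I. t i + c i * x i) \<partial>leb I) =
      (\<integral>\<^sup>+x. (\<Prod>i\<in>I. ennreal (1 / \<bar>c i\<bar>)) * G x \<partial>leb I)"
    using assms by (intro nn_integral_leb_coordinatewise) (auto intro: nn_integral_lborel_affine)
  also have "\<dots> = ennreal (1 / \<bar>\<Prod>i\<in>I. c i\<bar>) * (\<integral>\<^sup>+x. G x \<partial>leb I)"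
    using assms(3) by (subst nn_integral_cmult) (auto simp: prod_ennreal abs_prod prod_dividef)
  finally show ?thesis
    using assms(1,2) by (simp add: mult.assoc[symmetric] ennreal_mult[symmetric])
qed

lemma nn_integral_leb_translate:
  assumes "finite I" "G \<in> borel_measurable (leb I)"
  shows "(\<integral>\<^sup>+x. G (\<lambda>i\<in>I. t i + x i) \<partial>leb I) = (\<integral>\<^sup>+x. G x \<partial>leb I)"
  using nn_integral_leb_affine[of I "\<lambda>_. 1" G t] assms by simp

text \<open>One measurable space for all degrees, generated by the coefficients: the test functions
  \<open>G\<close> below are functions of a polynomial and do not refer to a basis, to roots or to a
  degree.\<close>

definition polyM :: "real poly measure" where
  "polyM = vimage_algebra UNIV coeff (PiM UNIV (\<lambda>_. borel))"

lemma space_polyM [simp]: "space polyM = UNIV"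
  by (simp add: polyM_def)

lemma measurable_coeff [measurable]: "(\<lambda>p. coeff p i) \<in> borel_measurable polyM"
proof -
  have "coeff \<in> measurable polyM (PiM UNIV (\<lambda>_. borel))"
    unfolding polyM_def by (rule measurable_vimage_algebra1) (auto simp: space_PiM)
  then show ?thesis
    by (rule measurable_compose) (rule measurable_component_singleton, simp)
qed

lemma measurable_polyM:
  assumes "\<And>i. (\<lambda>x. coeff (f x) i) \<in> borel_measurable N"
  shows "f \<in> measurable N polyM"
  unfolding polyM_def
  by (rule measurable_vimage_algebra2) (use assms in \<open>auto intro!: measurable_PiM_single'\<close>)

lemma measurable_polyM_const [measurable (raw)]: "(\<lambda>_. p) \<in> measurable N polyM"
  by simp

lemma measurable_poly_add [measurable (raw)]:
  assumes [measurable]: "f \<in> measurable N polyM" "g \<in> measurable N polyM"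
  shows "(\<lambda>x. f x + g x) \<in> measurable N polyM"
  by (rule measurable_polyM) (simp add: measurable_compose[OF assms(1) measurable_coeff] measurable_compose[OF assms(2) measurable_coeff])

lemma measurable_poly_diff [measurable (raw)]:
  assumes [measurable]: "f \<in> measurable N polyM" "g \<in> measurable N polyM"
  shows "(\<lambda>x. f x - g x) \<in> measurable N polyM"
  by (rule measurable_polyM) (simp add: measurable_compose[OF assms(1) measurable_coeff] measurable_compose[OF assms(2) measurable_coeff])

lemma measurable_poly_mult [measurable (raw)]:
  assumes [measurable]: "f \<in> measurable N polyM" "g \<in> measurable N polyM"
  shows "(\<lambda>x. f x * g x) \<in> measurable N polyM"
  by (rule measurable_polyM) (simp add: coeff_mult measurable_compose[OF assms(1) measurable_coeff] measurable_compose[OF assms(2) measurable_coeff])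

lemma measurable_smult [measurable (raw)]:
  assumes "c \<in> borel_measurable N" "f \<in> measurable N polyM"
  shows "(\<lambda>x. Polynomial.smult (c x) (f x)) \<in> measurable N polyM"
  by (rule measurable_polyM) (simp, intro borel_measurable_times assms(1) measurable_compose[OF assms(2) measurable_coeff])

lemma measurable_pCons [measurable (raw)]:
  assumes "c \<in> borel_measurable N" "f \<in> measurable N polyM"
  shows "(\<lambda>x. pCons (c x) (f x)) \<in> measurable N polyM"
proof (rule measurable_polyM)
  fix i show "(\<lambda>x. coeff (pCons (c x) (f x)) i) \<in> borel_measurable N"
    using assms(1) measurable_compose[OF assms(2) measurable_coeff] by (cases i) auto
qed

lemma measurable_monom [measurable (raw)]:
  assumes "c \<in> borel_measurable N"
  shows "(\<lambda>x. monom (c x) i) \<in> measurable N polyM"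
proof (rule measurable_polyM)
  fix j show "(\<lambda>x. coeff (monom (c x) i) j) \<in> borel_measurable N"
    using assms by (cases "i = j") auto
qed

lemma measurable_poly_sum [measurable (raw)]:
  assumes "\<And>i. i \<in> S \<Longrightarrow> (\<lambda>x. f x i) \<in> measurable N polyM"
  shows "(\<lambda>x. \<Sum>i\<in>S. f x i) \<in> measurable N polyM"
  using assms by (induction S rule: infinite_finite_induct) auto

lemma measurable_poly_prod [measurable (raw)]:
  assumes "\<And>i. i \<in> S \<Longrightarrow> (\<lambda>x. f x i) \<in> measurable N polyM"
  shows "(\<lambda>x. \<Prod>i\<in>S. f x i) \<in> measurable N polyM"
  using assms by (induction S rule: infinite_finite_induct) auto

lemma measurable_poly_eval [measurable (raw)]:
  assumes [measurable]: "f \<in> measurable N polyM" "g \<in> borel_measurable N"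
  shows "(\<lambda>x. poly (f x) (g x)) \<in> borel_measurable N"
proof -
  \<comment> \<open>The series runs over all indices; a sum up to the degree would have a range that
    varies with the polynomial.\<close>
  have *: "poly p y = (\<Sum>i. coeff p i * y ^ i)" for p and y :: real
    unfolding poly_altdef
    by (rule suminf_finite[symmetric]) (auto simp: coeff_eq_0)
  show ?thesis
    unfolding * by measurable
qed

lemma measurable_pderiv [measurable (raw)]:
  assumes [measurable]: "f \<in> measurable N polyM"
  shows "(\<lambda>x. pderiv (f x)) \<in> measurable N polyM"
  by (rule measurable_polyM) (simp add: coeff_pderiv)

section \<open>Monic polynomials and triangular changes of basis\<close>

definition monic_poly :: "nat \<Rightarrow> (nat \<Rightarrow> real) \<Rightarrow> real poly" where
  "monic_poly n c = monom 1 n + (\<Sum>i<n. monom (c i) i)"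

lemma measurable_monic_poly [measurable]: "monic_poly n \<in> measurable (leb {..<n}) polyM"
  unfolding monic_poly_def by measurable

lemmas poly_measurable_intros = borel_measurable_const measurable_polyM_const measurable_poly_add
  measurable_poly_diff measurable_poly_mult measurable_smult measurable_monom measurable_poly_sum
  borel_measurable_sum borel_measurable_times measurable_leb_coordinate

lemma monic_decomp:
  fixes E :: "real poly"
  assumes "degree E = n" "lead_coeff E = 1"
  shows "E = monom 1 n + (\<Sum>i<n. monom (coeff E i) i)"
proof -
  have "E = (\<Sum>i\<le>n. monom (coeff E i) i)" using poly_as_sum_of_monoms[of E] assms by simp
  also have "\<dots> = monom 1 n + (\<Sum>i<n. monom (coeff E i) i)"
    using assms by (simp add: lessThan_Suc_atMost[symmetric] add.commute)
  finally show ?thesis .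
qed

text \<open>A graded monic basis differs from the monomials by a unitriangular matrix, so Lebesgue
  measure on the coefficients is the same. The induction fixes the coefficient \<open>y\<close> of
  the top element; the lower terms of \<open>y\<close> times that element then only translate the
  remaining coefficients. \<open>F\<close> collects what has been fixed.\<close>

lemma nn_integral_graded_basis:
  fixes E :: "nat \<Rightarrow> real poly"
  assumes "\<And>i. i < n \<Longrightarrow> degree (E i) = i \<and> lead_coeff (E i) = 1"
    and G [measurable]: "G \<in> borel_measurable polyM"
  shows "(\<integral>\<^sup>+c. G (F + (\<Sum>i<n. Polynomial.smult (c i) (E i))) \<partial>leb {..<n}) =
    (\<integral>\<^sup>+c. G (F + (\<Sum>i<n. monom (c i) i)) \<partial>leb {..<n})"
  using assms(1)
proof (induction n arbitrary: F)
  case 0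
  show ?case by simp
next
  case (Suc n)
  have [simp]: "(\<Sum>i<n. Polynomial.smult ((c(n := y)) i) (E i)) = (\<Sum>i<n. Polynomial.smult (c i) (E i))"
    "(\<Sum>i<n. monom ((c(n := y)) i) i) = (\<Sum>i<n. monom (c i) i)" for c and y :: real
    by (auto intro!: sum.cong)
  have "(\<integral>\<^sup>+c. G (F + (\<Sum>i<Suc n. Polynomial.smult (c i) (E i))) \<partial>leb {..<Suc n}) =
     (\<integral>\<^sup>+y. \<integral>\<^sup>+c. G ((F + Polynomial.smult y (E n)) + (\<Sum>i<n. Polynomial.smult (c i) (E i))) \<partial>leb {..<n} \<partial>lborel)"
    by (subst nn_integral_leb_Suc(2)) (measurable, simp add: algebra_simps)
  also have "\<dots> = (\<integral>\<^sup>+y. \<integral>\<^sup>+c. G ((F + Polynomial.smult y (E n)) + (\<Sum>i<n. monom (c i) i)) \<partial>leb {..<n} \<partial>lborel)"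
    using Suc.prems by (intro nn_integral_cong Suc.IH) (rule Suc.prems, simp)
  also have "\<dots> = (\<integral>\<^sup>+y. \<integral>\<^sup>+c. G ((F + monom y n) + (\<Sum>i<n. monom (c i) i)) \<partial>leb {..<n} \<partial>lborel)"
  proof (rule nn_integral_cong)
    fix y :: real
    have E: "E n = monom 1 n + (\<Sum>i<n. monom (coeff (E n) i) i)"
      using Suc.prems[of n] by (intro monic_decomp) auto
    have "Polynomial.smult y (E n) = monom y n + (\<Sum>i<n. monom (y * coeff (E n) i) i)"
      by (subst E) (simp add: smult_add_right smult_sum2 smult_monom)
    then have eq: "F + Polynomial.smult y (E n) + (\<Sum>i<n. monom (c i) i) =
       F + monom y n + (\<Sum>i<n. monom ((\<lambda>i\<in>{..<n}. y * coeff (E n) i + c i) i) i)" for c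
      by (simp add: sum.distrib add_monom[symmetric])
    show "(\<integral>\<^sup>+c. G (F + Polynomial.smult y (E n) + (\<Sum>i<n. monom (c i) i)) \<partial>leb {..<n}) =
       (\<integral>\<^sup>+c. G (F + monom y n + (\<Sum>i<n. monom (c i) i)) \<partial>leb {..<n})"
      unfolding eq by (rule nn_integral_leb_translate) (auto, measurable)
  qed
  also have "\<dots> = (\<integral>\<^sup>+c. G (F + (\<Sum>i<Suc n. monom (c i) i)) \<partial>leb {..<Suc n})"
    by (subst nn_integral_leb_Suc(2)) (measurable, simp add: algebra_simps)
  finally show ?case .
qed

text \<open>Replacing the leading monomial by \<open>E n\<close> as well is one more translation of
  the lower coefficients.\<close>

lemma nn_integral_monic_basis:
  fixes E :: "nat \<Rightarrow> real poly"
  assumes "\<And>i. i \<le> n \<Longrightarrow> degree (E i) = i \<and> lead_coeff (E i) = 1"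
    and G [measurable]: "G \<in> borel_measurable polyM"
  shows "(\<integral>\<^sup>+c. G (E n + (\<Sum>i<n. Polynomial.smult (c i) (E i))) \<partial>leb {..<n}) =
    (\<integral>\<^sup>+c. G (monic_poly n c) \<partial>leb {..<n})"
proof -
  have E: "E n = monom 1 n + (\<Sum>i<n. monom (coeff (E n) i) i)"
    using assms(1)[of n] by (intro monic_decomp) auto
  have eq: "E n + (\<Sum>i<n. monom (c i) i) = monic_poly n (\<lambda>i\<in>{..<n}. coeff (E n) i + c i)" for c
    by (subst E) (simp add: monic_poly_def sum.distrib add_monom[symmetric] add.assoc)
  have "(\<integral>\<^sup>+c. G (E n + (\<Sum>i<n. Polynomial.smult (c i) (E i))) \<partial>leb {..<n}) =
     (\<integral>\<^sup>+c. G (E n + (\<Sum>i<n. monom (c i) i)) \<partial>leb {..<n})"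
    by (rule nn_integral_graded_basis[OF assms(1)[OF less_imp_le] G])
  also have "\<dots> = (\<integral>\<^sup>+c. G (monic_poly n c) \<partial>leb {..<n})"
    unfolding eq by (rule nn_integral_leb_translate) (auto, measurable)
  finally show ?thesis .
qed

section \<open>Vandermonde products and the Lagrange basis\<close>

definition vdm :: "nat \<Rightarrow> (nat \<Rightarrow> real) \<Rightarrow> real" where
  "vdm n l = (\<Prod>j<n. \<Prod>i<j. l j - l i)"

lemma vdm_0 [simp]: "vdm 0 l = 1" and vdm_Suc: "vdm (Suc n) l = vdm n l * (\<Prod>i<n. l n - l i)"
  by (simp_all add: vdm_def)

text \<open>The index set is arbitrary so that deleting one factor is
  \<open>root_poly (I - {i}) l\<close>, the unnormalised Lagrange polynomial at node
  \<open>i\<close>.\<close>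

definition root_poly :: "'i set \<Rightarrow> ('i \<Rightarrow> real) \<Rightarrow> real poly" where
  "root_poly I l = (\<Prod>i\<in>I. [:- l i, 1:])"

lemma degree_root_poly [simp]: "finite I \<Longrightarrow> degree (root_poly I l) = card I"
  unfolding root_poly_def by (subst degree_prod_eq_sum_degree) auto

lemma lead_coeff_root_poly [simp]: "lead_coeff (root_poly I l) = 1"
  unfolding root_poly_def by (simp add: lead_coeff_prod)

lemma coeff_root_poly_lessThan [simp]: "coeff (root_poly {..<n} l) n = 1"
  using lead_coeff_root_poly[of "{..<n}" l] by simp

lemma root_poly_remove:
  assumes "finite I" "i \<in> I"
  shows "root_poly I l = [:- l i, 1:] * root_poly (I - {i}) l"
  unfolding root_poly_def using assms by (rule prod.remove)

lemma poly_root_poly: "poly (root_poly I l) x = (\<Prod>i\<in>I. x - l i)"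
  by (simp add: root_poly_def poly_prod)

lemma measurable_root_poly [measurable (raw)]:
  assumes "\<And>i. i \<in> I \<Longrightarrow> (\<lambda>x. f x i) \<in> borel_measurable N"
  shows "(\<lambda>x. root_poly I (f x)) \<in> measurable N polyM"
  unfolding root_poly_def using assms by (intro measurable_poly_prod) auto

text \<open>Writing x - l_m = (x - l_i) + (l_i - l_m) in the i-th Lagrange polynomial splits off the
  Newton polynomial of the first \<open>m\<close> nodes and leaves a Lagrange sum with one node
  fewer. This is one elimination step of the Vandermonde determinant.\<close>

lemma lagrange_newton:
  fixes l :: "nat \<Rightarrow> real"
  shows "(\<Sum>i<Suc m. Polynomial.smult (u i) (root_poly ({..<Suc m} - {i}) l)) =
    Polynomial.smult (\<Sum>i<Suc m. u i) (root_poly {..<m} l) +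
    (\<Sum>i<m. Polynomial.smult (u i * (l i - l m)) (root_poly ({..<m} - {i}) l))"
proof -
  have "Polynomial.smult (u i) (root_poly ({..<Suc m} - {i}) l) =
     Polynomial.smult (u i) (root_poly {..<m} l) + Polynomial.smult (u i * (l i - l m)) (root_poly ({..<m} - {i}) l)"
    if i: "i < m" for i
  proof -
    have set_eq: "{..<Suc m} - {i} - {m} = {..<m} - {i}" by auto
    have 1: "root_poly ({..<Suc m} - {i}) l = [:- l m, 1:] * root_poly ({..<m} - {i}) l"
      using i by (subst root_poly_remove[of _ m]) (auto simp: set_eq)
    have 2: "root_poly {..<m} l = [:- l i, 1:] * root_poly ({..<m} - {i}) l"
      using i by (intro root_poly_remove) auto
    show ?thesis
      unfolding 1 2 by (simp add: algebra_simps smult_add_right smult_diff_right smult_add_left smult_diff_left)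
  qed
  moreover have "{..<Suc m} - {m} = {..<m}" by auto
  ultimately show ?thesis
    by (simp add: sum.distrib smult_add_left smult_sum[symmetric] add.assoc[symmetric] add.commute)
qed

text \<open>The change from the unnormalised Lagrange basis to monomials has determinant
  \<open>vdm m l\<close> up to sign: each elimination step rescales the i-th coordinate by l_i -
  l_m, and these are the factors by which the Vandermonde product grows.\<close>

lemma nn_integral_lagrange:
  assumes "inj_on l {..<m}" and G [measurable]: "G \<in> borel_measurable polyM"
  shows "ennreal \<bar>vdm m l\<bar> * (\<integral>\<^sup>+u. G (F + (\<Sum>i<m. Polynomial.smult (u i) (root_poly ({..<m} - {i}) l))) \<partial>leb {..<m}) =
    (\<integral>\<^sup>+c. G (F + (\<Sum>i<m. monom (c i) i)) \<partial>leb {..<m})"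
  using assms(1)
proof (induction m arbitrary: F)
  case 0
  show ?case by simp
next
  case (Suc m)
  define E where "E = root_poly {..<m} l"
  define R where "R = (\<lambda>i. root_poly ({..<m} - {i}) l)"
  have upd: "(\<Sum>i<m. (u(m := t)) i) = (\<Sum>i<m. u i)"
    "(\<Sum>i<m. Polynomial.smult ((u(m := t)) i * (l i - l m)) (R i)) = (\<Sum>i<m. Polynomial.smult (u i * (l i - l m)) (R i))"
    "(\<Sum>i<m. monom ((u(m := t)) i) i) = (\<Sum>i<m. monom (u i) i)"
    "(\<Sum>i<m. Polynomial.smult ((u(m := t)) i) (if i < m then monom 1 i else E)) = (\<Sum>i<m. monom (u i) i)" for u and t :: real
    by (auto intro!: sum.cong simp: smult_monom)
  have ne: "l i - l m \<noteq> 0" if "i < m" for i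
    using Suc.prems that by (auto simp: inj_on_def)
  have "(\<integral>\<^sup>+u. G (F + (\<Sum>i<Suc m. Polynomial.smult (u i) (root_poly ({..<Suc m} - {i}) l))) \<partial>leb {..<Suc m}) =
     (\<integral>\<^sup>+u. G (F + (Polynomial.smult (\<Sum>i<Suc m. u i) E + (\<Sum>i<m. Polynomial.smult (u i * (l i - l m)) (R i)))) \<partial>leb {..<Suc m})"
    by (simp only: lagrange_newton E_def R_def)
  also have "\<dots> = (\<integral>\<^sup>+u. \<integral>\<^sup>+t. G (F + (Polynomial.smult ((\<Sum>i<m. u i) + t) E + (\<Sum>i<m. Polynomial.smult (u i * (l i - l m)) (R i)))) \<partial>lborel \<partial>leb {..<m})"
    by (subst nn_integral_leb_Suc(1)) (intro measurable_compose[OF _ G] poly_measurable_intros, simp add: upd)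
  \<comment> \<open>The sum of the first \<open>m\<close> coordinates is absorbed by a translation
    of the last one, which decouples \<open>t\<close> from \<open>u\<close>.\<close>
  also have "\<dots> = (\<integral>\<^sup>+u. \<integral>\<^sup>+t. G (F + (Polynomial.smult t E + (\<Sum>i<m. Polynomial.smult (u i * (l i - l m)) (R i)))) \<partial>lborel \<partial>leb {..<m})"
    by (intro nn_integral_cong nn_integral_lborel_translate[of "\<lambda>t. G (F + (Polynomial.smult t E + _))"]) measurable
  also have "\<dots> = (\<integral>\<^sup>+t. \<integral>\<^sup>+u. G (F + (Polynomial.smult t E + (\<Sum>i<m. Polynomial.smult (u i * (l i - l m)) (R i)))) \<partial>leb {..<m} \<partial>lborel)"
    by (intro leb_swap_lborel) (auto, measurable)
  finally have 1: "(\<integral>\<^sup>+u. G (F + (\<Sum>i<Suc m. Polynomial.smult (u i) (root_poly ({..<Suc m} - {i}) l))) \<partial>leb {..<Suc m}) = \<dots>" .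
  have 2: "ennreal \<bar>vdm (Suc m) l\<bar> * (\<integral>\<^sup>+u. G (F + (Polynomial.smult t E + (\<Sum>i<m. Polynomial.smult (u i * (l i - l m)) (R i)))) \<partial>leb {..<m}) =
     (\<integral>\<^sup>+c. G (F + Polynomial.smult t E + (\<Sum>i<m. monom (c i) i)) \<partial>leb {..<m})" for t
  proof -
    have v: "ennreal \<bar>vdm (Suc m) l\<bar> = ennreal \<bar>vdm m l\<bar> * ennreal \<bar>\<Prod>i<m. l i - l m\<bar>"
      by (simp add: vdm_Suc abs_mult abs_prod abs_minus_commute ennreal_mult prod_nonneg)
    have "ennreal \<bar>\<Prod>i<m. l i - l m\<bar> * (\<integral>\<^sup>+u. G (F + (Polynomial.smult t E + (\<Sum>i<m. Polynomial.smult (u i * (l i - l m)) (R i)))) \<partial>leb {..<m}) =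
       ennreal \<bar>\<Prod>i<m. l i - l m\<bar> * (\<integral>\<^sup>+u. (\<lambda>u. G (F + Polynomial.smult t E + (\<Sum>i<m. Polynomial.smult (u i) (R i)))) (\<lambda>i\<in>{..<m}. 0 + (l i - l m) * u i) \<partial>leb {..<m})"
      by (simp add: mult.commute add.assoc)
    also have "\<dots> = (\<integral>\<^sup>+u. G (F + Polynomial.smult t E + (\<Sum>i<m. Polynomial.smult (u i) (R i))) \<partial>leb {..<m})"
      by (rule nn_integral_leb_affine) (use ne in \<open>auto, measurable\<close>)
    finally show ?thesis
      using Suc.IH[of "F + Polynomial.smult t E"] Suc.prems unfolding v mult.assoc R_def
      by (simp add: lessThan_Suc inj_on_insert)
  qed
  have "ennreal \<bar>vdm (Suc m) l\<bar> * (\<integral>\<^sup>+u. G (F + (\<Sum>i<Suc m. Polynomial.smult (u i) (root_poly ({..<Suc m} - {i}) l))) \<partial>leb {..<Suc m}) =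
     (\<integral>\<^sup>+t. ennreal \<bar>vdm (Suc m) l\<bar> * (\<integral>\<^sup>+u. G (F + (Polynomial.smult t E + (\<Sum>i<m. Polynomial.smult (u i * (l i - l m)) (R i)))) \<partial>leb {..<m}) \<partial>lborel)"
    unfolding 1 by (rule nn_integral_cmult[symmetric]) (measurable)
  also have "\<dots> = (\<integral>\<^sup>+t. \<integral>\<^sup>+c. G (F + Polynomial.smult t E + (\<Sum>i<m. monom (c i) i)) \<partial>leb {..<m} \<partial>lborel)"
    unfolding 2 ..
  \<comment> \<open>The Newton polynomial \<open>E\<close> has degree \<open>m\<close>; with the
    monomials below it forms a graded monic basis.\<close>
  also have "\<dots> = (\<integral>\<^sup>+c. G (F + (\<Sum>i<Suc m. Polynomial.smult (c i) (if i < m then monom 1 i else E))) \<partial>leb {..<Suc m})"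
    by (subst nn_integral_leb_Suc(2)) (measurable, simp only: sum.lessThan_Suc upd, simp add: algebra_simps)
  also have "\<dots> = (\<integral>\<^sup>+c. G (F + (\<Sum>i<Suc m. monom (c i) i)) \<partial>leb {..<Suc m})"
    by (rule nn_integral_graded_basis[OF _ G]) (auto simp: degree_monom_eq E_def less_Suc_eq)
  finally show ?case .
qed

subsection \<open>Real-rooted polynomials and interlacing\<close>

definition monic_polys :: "nat \<Rightarrow> real poly set" where
  "monic_polys n = {p. degree p = n \<and> lead_coeff p = 1}"

definition real_simple :: "nat \<Rightarrow> real poly set" where
  "real_simple n = {p. \<exists>l. strict_mono_on {..<n} l \<and> p = root_poly {..<n} l}"

text \<open>On \<open>real_simple n\<close> the values at indices below \<open>n\<close> are
  determined, whatever function the choice returns (\<open>ordered_roots_root_poly\<close>).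
  Elsewhere the known value 0 is what measurability of the root functions relies on.\<close>

definition ordered_roots :: "nat \<Rightarrow> real poly \<Rightarrow> nat \<Rightarrow> real" where
  "ordered_roots n p = (if p \<in> real_simple n
     then SOME l. strict_mono_on {..<n} l \<and> p = root_poly {..<n} l else (\<lambda>_. 0))"

lemma ordered_roots:
  assumes "p \<in> real_simple n"
  shows "strict_mono_on {..<n} (ordered_roots n p)" "root_poly {..<n} (ordered_roots n p) = p"
proof -
  have "\<exists>l. strict_mono_on {..<n} l \<and> p = root_poly {..<n} l"
    using assms by (simp add: real_simple_def)
  from someI_ex[OF this] show "strict_mono_on {..<n} (ordered_roots n p)" "root_poly {..<n} (ordered_roots n p) = p"
    using assms by (auto simp: ordered_roots_def)
qed

lemma strict_mono_on_inj_on_nat: "strict_mono_on S (l :: nat \<Rightarrow> real) \<Longrightarrow> inj_on l S"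
  by (rule strict_mono_on_imp_inj_on)

lemma root_poly_monic: "root_poly {..<n} l \<in> monic_polys n"
  by (simp add: monic_polys_def)

lemma real_simple_monic: "p \<in> real_simple n \<Longrightarrow> p \<in> monic_polys n"
  using root_poly_monic by (auto simp: real_simple_def)

lemma poly_root_poly_eq_0: "finite I \<Longrightarrow> poly (root_poly I l) x = 0 \<longleftrightarrow> x \<in> l ` I"
  by (auto simp: poly_root_poly)

lemma real_simpleI_card:
  assumes "p \<in> monic_polys n" "finite S" "card S = n" "\<And>x. x \<in> S \<Longrightarrow> poly p x = 0"
  shows "p \<in> real_simple n"
proof -
  define l where "l = (\<lambda>i. sorted_list_of_set S ! i)"
  have len: "length (sorted_list_of_set S) = n" using assms by simp
  have l: "strict_mono_on {..<n} l"
    unfolding l_def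
    by (rule strict_mono_onI) (use len sorted_wrt_nth_less[OF strict_sorted_list_of_set[of S]] in auto)
  have img: "l ` {..<n} = S"
  proof -
    have "S = set (sorted_list_of_set S)" using assms(2) by simp
    also have "\<dots> = l ` {..<n}" by (auto simp: set_conv_nth[of "sorted_list_of_set S"] len assms(3) l_def)
    finally show ?thesis ..
  qed
  have "p = root_poly {..<n} l"
  proof (rule poly_eqI_degree_lead_coeff)
    show "n \<le> card S" using assms by simp
    show "coeff p n = coeff (root_poly {..<n} l) n" "degree p \<le> n" "degree (root_poly {..<n} l) \<le> n"
      using assms(1) root_poly_monic[of n l] by (auto simp: monic_polys_def)
    show "poly p z = poly (root_poly {..<n} l) z" if "z \<in> S" for z
    proof -
      have "poly (root_poly {..<n} l) z = 0" using that img by (subst poly_root_poly_eq_0) auto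
      then show ?thesis using assms(4)[OF that] by simp
    qed
  qed
  with l show ?thesis by (auto simp: real_simple_def)
qed

lemma real_simpleI_inj:
  assumes "inj_on l {..<n}"
  shows "root_poly {..<n} l \<in> real_simple n"
  by (rule real_simpleI_card[OF root_poly_monic, of "l ` {..<n}"])
    (use assms in \<open>auto simp: card_image poly_root_poly_eq_0\<close>)

text \<open>
  Root counting through rational sign changes, which makes the ordered roots measurable functions of
  the coefficients.
\<close>

primrec sign_changes :: "nat \<Rightarrow> real \<Rightarrow> real poly \<Rightarrow> bool" where
  "sign_changes 0 t p = True"
| "sign_changes (Suc k) t p = (\<exists>a b :: rat. real_of_rat a < real_of_rat b \<and> real_of_rat b < t \<and>
     sign_changes k (real_of_rat a) p \<and> poly p (real_of_rat a) * poly p (real_of_rat b) < 0)"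

lemma measurable_sign_changes [measurable]: "Measurable.pred polyM (sign_changes k t)"
proof (induction k arbitrary: t)
  case (Suc k)
  note [measurable] = Suc.IH
  have "Measurable.pred polyM (\<lambda>p. \<exists>a b :: rat. real_of_rat a < real_of_rat b \<and> real_of_rat b < t \<and>
     sign_changes k (real_of_rat a) p \<and> poly p (real_of_rat a) * poly p (real_of_rat b) < 0)"
    by measurable
  moreover have "sign_changes (Suc k) t = (\<lambda>p. \<exists>a b :: rat. real_of_rat a < real_of_rat b \<and> real_of_rat b < t \<and>
     sign_changes k (real_of_rat a) p \<and> poly p (real_of_rat a) * poly p (real_of_rat b) < 0)"
    by (rule ext) simp
  ultimately show ?case by simp
next
  case 0
  have "sign_changes 0 t = (\<lambda>_. True)" by (rule ext) simp
  then show ?case by simp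
qed

lemma sign_changes_imp_roots:
  "sign_changes k t p \<Longrightarrow> \<exists>S. finite S \<and> card S = k \<and> (\<forall>x\<in>S. poly p x = 0 \<and> x < t)"
proof (induction k arbitrary: t)
  case 0
  show ?case by (intro exI[of _ "{}"]) auto
next
  case (Suc k)
  then obtain a b where ab: "real_of_rat a < real_of_rat b" "real_of_rat b < t" "sign_changes k (real_of_rat a) p"
     "poly p (real_of_rat a) * poly p (real_of_rat b) < 0" by auto
  obtain S where S: "finite S" "card S = k" "\<forall>x\<in>S. poly p x = 0 \<and> x < real_of_rat a"
    using Suc.IH[OF ab(3)] by blast
  obtain x where x: "x > real_of_rat a" "x < real_of_rat b" "poly p x = 0"
    using poly_IVT[OF ab(1,4)] by blast
  have "x \<notin> S" using S x by force
  then show ?case using S x ab by (intro exI[of _ "insert x S"]) auto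
qed

lemma roots_imp_sign_changes:
  assumes "strict_mono_on {..<n} l" "k \<le> n" "\<And>i. i < k \<Longrightarrow> l i < t"
  shows "sign_changes k t (root_poly {..<n} l)"
  using assms(2,3)
proof (induction k arbitrary: t)
  case (Suc k)
  \<comment> \<open>The rational bracket of l_k must stay between the neighbouring roots and below
    \<open>t\<close>; at the ends l_k - 1 and \<open>t\<close> take the place of a missing
    neighbour.\<close>
  define lo where "lo = (if k = 0 then l k - 1 else l (k - 1))"
  define hi where "hi = (if Suc k < n then min t (l (Suc k)) else t)"
  have mono: "l i < l j" if "i < j" "j < n" for i j
    using assms(1) that by (auto simp: strict_mono_on_def)
  have mono': "l i \<le> l j" if "i \<le> j" "j < n" for i j
    using mono[of i j] that by (cases "i = j") auto
  have "lo < l k" "l k < hi"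
    using Suc.prems mono by (auto simp: lo_def hi_def)
  obtain a where a: "lo < real_of_rat a" "real_of_rat a < l k" using of_rat_dense[OF \<open>lo < l k\<close>] by blast
  obtain b where b: "l k < real_of_rat b" "real_of_rat b < hi" using of_rat_dense[OF \<open>l k < hi\<close>] by blast
  have lt: "l i < real_of_rat a" if "i < k" for i
    using a mono'[of i "k - 1"] that Suc.prems by (force simp: lo_def)
  have gt: "real_of_rat b < l i" if "k < i" "i < n" for i
    using b mono'[of "Suc k" i] that by (auto simp: hi_def)
  \<comment> \<open>Every root other than l_k has both rationals on the same side, so only the k-th
    factor can change sign.\<close>
  have "0 < (\<Prod>i\<in>{..<n} - {k}. (real_of_rat a - l i) * (real_of_rat b - l i))"
  proof (rule prod_pos)
    fix i assume "i \<in> {..<n} - {k}"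
    then consider "i < k" | "k < i" "i < n" by force
    then show "0 < (real_of_rat a - l i) * (real_of_rat b - l i)"
    proof cases
      case 1 then show ?thesis using lt[of i] a b by (intro mult_pos_pos) auto
    next
      case 2 then show ?thesis using gt[of i] a b by (intro mult_neg_neg) auto
    qed
  qed
  moreover have "(real_of_rat a - l k) * (real_of_rat b - l k) < 0" using a b by (intro mult_neg_pos) auto
  moreover have "poly (root_poly {..<n} l) (real_of_rat a) * poly (root_poly {..<n} l) (real_of_rat b) =
     ((real_of_rat a - l k) * (real_of_rat b - l k)) * (\<Prod>i\<in>{..<n} - {k}. (real_of_rat a - l i) * (real_of_rat b - l i))"
    using Suc.prems by (subst prod.remove[symmetric]) (auto simp: poly_root_poly prod.distrib)
  ultimately have "poly (root_poly {..<n} l) (real_of_rat a) * poly (root_poly {..<n} l) (real_of_rat b) < 0"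
    by (simp add: mult_neg_pos)
  moreover have "sign_changes k (real_of_rat a) (root_poly {..<n} l)"
    using Suc.prems lt by (intro Suc.IH) auto
  moreover have "real_of_rat b < t" using b by (auto simp: hi_def split: if_splits)
  ultimately show ?case unfolding sign_changes.simps using a b by (intro exI[of _ a] exI[of _ b] conjI) auto
qed simp

text \<open>Indices start at 0, so l_i < t means that at least i + 1 roots lie below
  \<open>t\<close>. Conversely, if t <= l_i, only the first i roots can lie below
  \<open>t\<close>.\<close>

lemma sign_changes_iff:
  assumes "strict_mono_on {..<n} l" "i < n"
  shows "sign_changes (Suc i) t (root_poly {..<n} l) \<longleftrightarrow> l i < t"
proof
  have mono: "l i \<le> l j" if "i \<le> j" "j < n" for i j
    using assms(1) that by (cases "i = j") (auto simp: strict_mono_on_def less_imp_le)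
  assume "l i < t"
  then show "sign_changes (Suc i) t (root_poly {..<n} l)"
    using assms mono by (intro roots_imp_sign_changes) (auto simp: less_Suc_eq_le intro: le_less_trans)
next
  have mono: "l i \<le> l j" if "i \<le> j" "j < n" for i j
    using assms(1) that by (cases "i = j") (auto simp: strict_mono_on_def less_imp_le)
  assume "sign_changes (Suc i) t (root_poly {..<n} l)"
  from sign_changes_imp_roots[OF this] obtain S where S: "finite S" "card S = Suc i"
    "\<forall>x\<in>S. poly (root_poly {..<n} l) x = 0 \<and> x < t" by blast
  show "l i < t"
  proof (rule ccontr)
    assume "\<not> l i < t"
    have "S \<subseteq> l ` {..<i}"
    proof
      fix x assume "x \<in> S"
      then obtain j where "j < n" "x = l j" "x < t" using S by (auto simp: poly_root_poly_eq_0)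
      then have "j < i" using mono[of i j] \<open>\<not> l i < t\<close> by (metis le_less_trans not_le)
      then show "x \<in> l ` {..<i}" using \<open>x = l j\<close> by blast
    qed
    then have "card S \<le> i" by (metis card_image_le card_lessThan card_mono finite_imageI finite_lessThan le_trans)
    then show False using S by simp
  qed
qed

text \<open>Root counting characterises both numbers by the same set of strict upper bounds
  \<open>t\<close>.\<close>

lemma ordered_roots_root_poly:
  assumes "strict_mono_on {..<n} l" "i < n"
  shows "ordered_roots n (root_poly {..<n} l) i = l i"
proof -
  have p: "root_poly {..<n} l \<in> real_simple n" using assms by (auto simp: real_simple_def)
  have "ordered_roots n (root_poly {..<n} l) i < t \<longleftrightarrow> l i < t" for t
    using sign_changes_iff[OF ordered_roots(1)[OF p] assms(2), of t] sign_changes_iff[OF assms, of t] ordered_roots(2)[OF p] by simp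
  then show ?thesis by (metis less_irrefl linorder_neqE)
qed

lemma measurable_monic_polys [measurable]: "Measurable.pred polyM (\<lambda>p. p \<in> monic_polys n)"
proof -
  have *: "p \<in> monic_polys n \<longleftrightarrow> coeff p n = 1 \<and> (\<forall>i. i > n \<longrightarrow> coeff p i = 0)" for p
  proof
    assume c: "coeff p n = 1 \<and> (\<forall>i. i > n \<longrightarrow> coeff p i = 0)"
    then have "degree p = n" by (intro antisym degree_le le_degree) auto
    then show "p \<in> monic_polys n" using c by (simp add: monic_polys_def)
  qed (auto simp: monic_polys_def coeff_eq_0)
  show ?thesis unfolding * by measurable
qed

text \<open>Replaces the existence of a tuple of real roots, an uncountable condition, by a
  countable one that is visibly measurable.\<close>

lemma real_simple_iff:
  "p \<in> real_simple n \<longleftrightarrow> p \<in> monic_polys n \<and> (\<exists>t :: nat. sign_changes n (real t) p)"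
proof
  assume p: "p \<in> real_simple n"
  then obtain l where l: "strict_mono_on {..<n} l" "p = root_poly {..<n} l" by (auto simp: real_simple_def)
  obtain t :: nat where t: "real t > Max (insert 0 (l ` {..<n}))" using reals_Archimedean2 by blast
  have "sign_changes n (real t) p"
    unfolding l(2) using t by (intro roots_imp_sign_changes l) auto
  then show "p \<in> monic_polys n \<and> (\<exists>t :: nat. sign_changes n (real t) p)" using real_simple_monic[OF p] by blast
next
  assume "p \<in> monic_polys n \<and> (\<exists>t :: nat. sign_changes n (real t) p)"
  then show "p \<in> real_simple n" using sign_changes_imp_roots real_simpleI_card by blast
qed

lemma measurable_real_simple_pred [measurable]: "Measurable.pred polyM (\<lambda>p. p \<in> real_simple n)"
  unfolding real_simple_iff by measurable

lemma measurable_real_simple [measurable]: "real_simple n \<in> sets polyM"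
  using measurable_real_simple_pred[of n] by (simp add: pred_def)

lemma measurable_ordered_roots:
  assumes "i < n"
  shows "(\<lambda>p. ordered_roots n p i) \<in> borel_measurable polyM"
proof (rule borel_measurable_iff_less[THEN iffD2], rule allI)
  fix t
  have "ordered_roots n p i < t \<longleftrightarrow> (p \<in> real_simple n \<and> sign_changes (Suc i) t p) \<or> (p \<notin> real_simple n \<and> 0 < t)" for p
    using sign_changes_iff[OF ordered_roots(1) assms, of p t] ordered_roots(2)[of p n]
    by (auto simp: ordered_roots_def[of n p])
  then have "{w \<in> space polyM. ordered_roots n w i < t} =
      {w \<in> space polyM. (w \<in> real_simple n \<and> sign_changes (Suc i) t w) \<or> (w \<notin> real_simple n \<and> 0 < t)}"
    by blast
  also have "\<dots> \<in> sets polyM" by measurable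
  finally show "{w \<in> space polyM. ordered_roots n w i < t} \<in> sets polyM" .
qed

section \<open>Real-rootedness through the complex plane and partial fractions\<close>

interpretation of_real_poly: map_poly_inj_idom_hom "of_real :: real \<Rightarrow> complex" ..

text \<open>Over the complex numbers a squarefree polynomial of degree n has n distinct roots; when
  all of them are real, they are n distinct roots of \<open>p\<close>.\<close>

lemma real_simpleI_complex:
  fixes p :: "real poly"
  assumes p: "p \<in> monic_polys n"
    and real: "\<And>z :: complex. poly (map_poly of_real p) z = 0 \<Longrightarrow> z \<in> \<real>"
    and simple: "\<And>x. poly p x = 0 \<Longrightarrow> poly (pderiv p) x \<noteq> 0"
  shows "p \<in> real_simple n"
proof -
  define q :: "complex poly" where "q = map_poly of_real p"
  have "p \<noteq> 0" using p by (auto simp: monic_polys_def)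
  then have q0: "q \<noteq> 0" by (simp add: q_def)
  have of_real: "poly (map_poly of_real r) (of_real x) = (of_real (poly r x) :: complex)" for r :: "real poly" and x
    by simp
  have "rsquarefree q"
    unfolding rsquarefree_roots
  proof (intro allI notI)
    fix z assume z: "poly q z = 0 \<and> poly (pderiv q) z = 0"
    then obtain x where x: "z = of_real x" using real[of z] by (auto simp: q_def elim: Reals_cases)
    have "pderiv q = map_poly of_real (pderiv p)" by (simp add: q_def of_real_hom.map_poly_pderiv)
    then have "poly p x = 0" "poly (pderiv p) x = 0" using z x by (auto simp: q_def)
    then show False using simple by blast
  qed
  then have "card {z. poly q z = 0} = n"
    using rsquarefree_card_degree[OF q0] p by (simp add: q_def monic_polys_def)
  moreover have "{z. poly q z = 0} = of_real ` {x. poly p x = 0}"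
  proof (intro equalityI subsetI)
    fix z assume z: "z \<in> {z. poly q z = 0}"
    then obtain x where "z = of_real x" using real[of z] by (auto simp: q_def elim: Reals_cases)
    then show "z \<in> of_real ` {x. poly p x = 0}" using z by (auto simp: q_def)
  qed (auto simp: q_def)
  ultimately have "card {x. poly p x = 0} = n"
    by (simp add: card_image inj_on_def)
  then show ?thesis
    by (intro real_simpleI_card[OF p, of "{x. poly p x = 0}"]) (use \<open>p \<noteq> 0\<close> poly_roots_finite in auto)
qed

lemma poly_root_poly_remove_ne:
  assumes "inj_on d I" "i \<in> I"
  shows "poly (root_poly (I - {i}) d) (d i) \<noteq> 0"
  using assms by (cases "finite I") (auto simp: poly_root_poly inj_on_def)

lemma poly_root_poly_remove_eq:
  assumes "finite I" "i \<in> I" "j \<in> I" "i \<noteq> j"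
  shows "poly (root_poly (I - {i}) d) (d j) = 0"
  using assms by (auto simp: poly_root_poly)

lemma pderiv_root_poly:
  assumes "finite I" "i \<in> I"
  shows "poly (pderiv (root_poly I d)) (d i) = poly (root_poly (I - {i}) d) (d i)"
  unfolding root_poly_remove[OF assms] pderiv_mult by (simp add: pderiv_pCons)

lemma lagrange_interpolation:
  fixes R :: "real poly" and d :: "nat \<Rightarrow> real"
  assumes inj: "inj_on d {..<m}" and "degree R < m"
  shows "R = (\<Sum>i<m. Polynomial.smult (poly R (d i) / poly (root_poly ({..<m} - {i}) d) (d i)) (root_poly ({..<m} - {i}) d))"
    (is "R = ?S")
proof (rule poly_eqI_degree[of "d ` {..<m}"])
  have c: "card (d ` {..<m}) = m" using inj by (simp add: card_image)
  show "degree R < card (d ` {..<m})" using assms c by simp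
  have "degree ?S \<le> m - 1"
    by (intro degree_sum_le) (auto intro!: order.trans[OF degree_smult_le])
  then show "degree ?S < card (d ` {..<m})" using assms c by simp
  fix x assume "x \<in> d ` {..<m}"
  then obtain j where j: "j < m" "x = d j" by auto
  have "poly ?S x = (\<Sum>i<m. if i = j then poly R x else 0)"
    unfolding poly_sum
    by (intro sum.cong) (use j inj poly_root_poly_remove_ne[OF inj] poly_root_poly_remove_eq[of "{..<m}"] in auto)
  also have "\<dots> = poly R x" using j by simp
  finally show "poly R x = poly ?S x" ..
qed

text \<open>
  The quotient \<open>N / D = a x + b + (\<Sum>i. s i / (x - d i))\<close> maps the upper half plane into itself, so its
  zeros are real, and it is increasing between its poles.
\<close>

lemma herglotz_roots:
  fixes d s :: "nat \<Rightarrow> real" and k :: nat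
  defines "D \<equiv> root_poly {..<k} d"
  assumes inj: "inj_on d {..<k}" and "N \<noteq> 0"
    and N: "N = [:b, a:] * D + (\<Sum>i<k. Polynomial.smult (s i) (root_poly ({..<k} - {i}) d))"
    and a: "a \<ge> 0" and s: "\<And>i. i < k \<Longrightarrow> s i < 0" and pos: "a > 0 \<or> k > 0"
  shows "\<And>z :: complex. poly (map_poly of_real N) z = 0 \<Longrightarrow> z \<in> \<real>"
    and "\<And>x. poly N x = 0 \<Longrightarrow> poly (pderiv N) x * poly D x > 0"
proof -
  have split: "D = [:- d i, 1:] * root_poly ({..<k} - {i}) d" if "i < k" for i
    unfolding D_def by (rule root_poly_remove) (use that in auto)
  show "z \<in> \<real>" if z: "poly (map_poly of_real N) z = 0" for z :: complex
  proof (cases "\<exists>i<k. z = of_real (d i)")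
    case False
    define c where "c = (\<lambda>p :: real poly. poly (map_poly of_real p) z :: complex)"
    have hom: "c (p + q) = c p + c q" "c (p * q) = c p * c q" "c (Polynomial.smult t p) = of_real t * c p" for p q t
      by (simp_all add: c_def of_real_poly.hom_add of_real_poly.hom_mult hom_distribs)
    have csum: "c (\<Sum>i<k. f i) = (\<Sum>i<k. c (f i))" for f
      by (induction k) (simp_all add: hom, simp add: c_def)
    have lin: "c [:t, u:] = of_real t + of_real u * z" for t u by (simp add: c_def of_real_hom.map_poly_pCons_hom mult.commute)
    have cD: "c D = (z - of_real (d i)) * c (root_poly ({..<k} - {i}) d)" if "i < k" for i
      by (subst split[OF that]) (simp only: hom lin, simp)
    have "c D = (\<Prod>i<k. z - of_real (d i))"
    proof -
      have cprod: "c (\<Prod>i<k. f i) = (\<Prod>i<k. c (f i))" for f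
        by (induction k) (simp_all add: hom, simp add: c_def)
      show ?thesis unfolding D_def root_poly_def cprod lin by simp
    qed
    then have D0: "c D \<noteq> 0" using False by auto
    have "0 = c N" using z by (simp add: c_def)
    also have "\<dots> = (of_real b + of_real a * z) * c D + (\<Sum>i<k. of_real (s i) * c (root_poly ({..<k} - {i}) d))"
      unfolding N hom csum lin ..
    also have "(\<Sum>i<k. of_real (s i) * c (root_poly ({..<k} - {i}) d)) = (\<Sum>i<k. of_real (s i) / (z - of_real (d i))) * c D"
      unfolding sum_distrib_right using False by (intro sum.cong refl) (simp add: cD)
    finally have "0 = (of_real b + of_real a * z + (\<Sum>i<k. of_real (s i) / (z - of_real (d i)))) * c D"
      by (simp add: algebra_simps)
    then have "0 = Im (of_real b + of_real a * z + (\<Sum>i<k. of_real (s i) / (z - of_real (d i))))" using D0 by simp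
    also have "\<dots> = a * Im z + (\<Sum>i<k. Im (of_real (s i) / (z - of_real (d i))))" by simp
    \<comment> \<open>For real d the imaginary part of s / (z - d) is - s Im z / |z - d|^2, so with
      s < 0 every summand has the sign of Im z and nothing can cancel.\<close>
    also have "\<dots> = Im z * (a + (\<Sum>i<k. - s i / (cmod (z - of_real (d i)))\<^sup>2))"
      by (simp add: Im_divide cmod_def sum_distrib_left algebra_simps)
    finally have "Im z = 0 \<or> a + (\<Sum>i<k. - s i / (cmod (z - of_real (d i)))\<^sup>2) = 0" by simp
    moreover have "a + (\<Sum>i<k. - s i / (cmod (z - of_real (d i)))\<^sup>2) > 0"
    proof (cases "k > 0")
      case True
      have "(\<Sum>i<k. - s i / (cmod (z - of_real (d i)))\<^sup>2) > 0"
        by (rule sum_pos) (use True False s in \<open>auto intro!: divide_neg_pos\<close>)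
      then show ?thesis using a by simp
    qed (use pos in auto)
    ultimately show ?thesis by (simp add: complex_is_Real_iff)
  qed auto
  show "poly (pderiv N) x * poly D x > 0" if x: "poly N x = 0" for x
  proof -
    \<comment> \<open>At a pole only the i-th partial fraction survives in \<open>N\<close>, and its
      value there is nonzero.\<close>
    have ne: "x \<noteq> d i" if "i < k" for i
    proof
      assume "x = d i"
      have "poly N (d i) = poly D (d i) * (b + d i * a) + (\<Sum>j<k. s j * poly (root_poly ({..<k} - {j}) d) (d i))"
        by (simp add: N poly_sum algebra_simps)
      also have "(\<Sum>j<k. s j * poly (root_poly ({..<k} - {j}) d) (d i)) = (\<Sum>j<k. if j = i then s i * poly (root_poly ({..<k} - {i}) d) (d i) else 0)"
        by (intro sum.cong) (use that poly_root_poly_remove_eq[of "{..<k}"] in auto)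
      also have "poly D (d i) = 0" using that by (simp add: D_def poly_root_poly_eq_0)
      finally have "poly N (d i) = s i * poly (root_poly ({..<k} - {i}) d) (d i)" using that by simp
      then show False using x \<open>x = d i\<close> s[OF that] poly_root_poly_remove_ne[OF inj, of i] that by simp
    qed
    have D0: "poly D x \<noteq> 0" using ne by (auto simp: D_def poly_root_poly_eq_0)
    define f where "f = (\<lambda>t. b + a * t + (\<Sum>i<k. s i / (t - d i)))"
    have Nf: "poly N t = f t * poly D t" if "\<forall>i<k. t \<noteq> d i" for t
    proof -
      have "poly N t = (b + t * a) * poly D t + (\<Sum>i<k. s i * poly (root_poly ({..<k} - {i}) d) t)"
        by (simp add: N poly_sum algebra_simps)
      also have "(\<Sum>i<k. s i * poly (root_poly ({..<k} - {i}) d) t) = (\<Sum>i<k. s i / (t - d i)) * poly D t"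
        unfolding sum_distrib_right
      proof (intro sum.cong refl)
        fix i assume "i \<in> {..<k}"
        then show "s i * poly (root_poly ({..<k} - {i}) d) t = s i / (t - d i) * poly D t"
          using that by (subst split[of i]) (auto simp: field_simps)
      qed
      finally show ?thesis by (simp add: f_def algebra_simps)
    qed
    have fx: "f x = 0" using Nf[of x] ne x D0 by auto
    have "(f has_field_derivative (a + (\<Sum>i<k. - s i / (x - d i)\<^sup>2))) (at x)"
      unfolding f_def by (auto intro!: derivative_eq_intros simp: ne power2_eq_square sum_negf) (use ne in blast)?
    \<comment> \<open>In the product rule the term with the derivative of \<open>D\<close> drops out
      because f x = 0.\<close>
    then have "((\<lambda>t. f t * poly D t) has_field_derivative (a + (\<Sum>i<k. - s i / (x - d i)\<^sup>2)) * poly D x) (at x)"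
      using fx by (auto intro!: derivative_eq_intros)
    moreover have "open (- d ` {..<k})" by (intro open_Compl finite_imp_closed) simp
    ultimately have "(poly N has_field_derivative (a + (\<Sum>i<k. - s i / (x - d i)\<^sup>2)) * poly D x) (at x)"
      by (rule has_field_derivative_transform_within_open[of _ _ _ "- d ` {..<k}"]) (use ne in auto, rule Nf[symmetric], auto)
    then have "poly (pderiv N) x = (a + (\<Sum>i<k. - s i / (x - d i)\<^sup>2)) * poly D x"
      using DERIV_unique[OF poly_DERIV] by blast
    moreover have "a + (\<Sum>i<k. - s i / (x - d i)\<^sup>2) > 0"
    proof (cases "k > 0")
      case True
      have "(\<Sum>i<k. - s i / (x - d i)\<^sup>2) > 0"
        by (rule sum_pos) (use True ne s in \<open>auto intro!: divide_neg_pos\<close>)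
      then show ?thesis using a by simp
    qed (use pos in auto)
    ultimately show ?thesis using D0 by (simp add: mult.assoc) (metis mult_pos_pos not_real_square_gt_zero)
  qed
qed

lemma mult_neg_iff_divide_neg: "(x :: real) * y < 0 \<longleftrightarrow> x / y < 0"
  by (simp add: divide_less_0_iff mult_less_0_iff)

lemma mult_pos_iff_divide_pos: "(x :: real) * y > 0 \<longleftrightarrow> x / y > 0"
  by (simp add: zero_less_divide_iff zero_less_mult_iff)

text \<open>Both conditions state that the zeros interlace, seen from either polynomial. Forward, P
  / Q is x + b plus partial fractions with residues P / Q' < 0 at the zeros of \<open>Q\<close>;
  backward, - Q / P is a sum of partial fractions with residues - Q / P' < 0 at the zeros of
  \<open>P\<close>. \<open>herglotz_roots\<close> then gives real zeros of the numerator and the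
  sign of its derivative there.\<close>

lemma interlace_iff:
  assumes P: "P \<in> monic_polys (Suc m)" and Q: "Q \<in> monic_polys m"
  shows "Q \<in> real_simple m \<and> (\<forall>x. poly Q x = 0 \<longrightarrow> poly P x * poly (pderiv Q) x < 0) \<longleftrightarrow>
    P \<in> real_simple (Suc m) \<and> (\<forall>x. poly P x = 0 \<longrightarrow> poly Q x * poly (pderiv P) x > 0)"
proof
  assume *: "Q \<in> real_simple m \<and> (\<forall>x. poly Q x = 0 \<longrightarrow> poly P x * poly (pderiv Q) x < 0)"
  define d where "d = ordered_roots m Q"
  have d: "inj_on d {..<m}" "Q = root_poly {..<m} d"
    using ordered_roots * by (auto simp: d_def strict_mono_on_inj_on_nat)
  \<comment> \<open>This \<open>b\<close> cancels the coefficient of x^m, so that P - (x + b) Q has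
    only coefficients below degree m and is recovered from its values at the m zeros of
    \<open>Q\<close>.\<close>
  define b where "b = coeff (P - pCons 0 Q) m"
  define R where "R = P - [:b, 1:] * Q"
  have cR: "coeff R i = 0" if i: "i \<ge> m" for i
  proof -
    consider "i = m" | "i = Suc m" | "i > Suc m" using i by linarith
    then show ?thesis
    proof cases
      case 1 then show ?thesis using P Q by (auto simp: R_def b_def monic_polys_def)
    next
      case 2 then show ?thesis using P Q by (auto simp: R_def b_def monic_polys_def coeff_eq_0)
    next
      case 3
      then have "coeff P i = 0" "coeff Q i = 0" "coeff Q (i - 1) = 0" using P Q by (auto simp: monic_polys_def coeff_eq_0)
      then show ?thesis using 3 by (auto simp: R_def coeff_pCons split: nat.split)
    qed
  qed
  have s: "poly R (d i) = poly P (d i)" if "i < m" for i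
  proof -
    have "poly Q (d i) = 0" using d(2) that by (simp add: poly_root_poly_eq_0)
    then show ?thesis by (simp add: R_def)
  qed
  define s where "s = (\<lambda>i. poly R (d i) / poly (root_poly ({..<m} - {i}) d) (d i))"
  have R: "R = (\<Sum>i<m. Polynomial.smult (s i) (root_poly ({..<m} - {i}) d))"
  proof (cases "m = 0")
    case True
    then show ?thesis using cR by (auto intro!: poly_eqI)
  next
    case False
    then have "degree R < m" using cR by (metis degree_0 gr0I le_degree leading_coeff_0_iff not_le)
    then show ?thesis unfolding s_def by (rule lagrange_interpolation[OF d(1)])
  qed
  have sneg: "s i < 0" if "i < m" for i
  proof -
    have "poly Q (d i) = 0" using d(2) that by (simp add: poly_root_poly_eq_0)
    then have "poly P (d i) * poly (pderiv Q) (d i) < 0" using * by blast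
    then show ?thesis using that pderiv_root_poly[of "{..<m}" i d] d(2) s[OF that]
      by (simp add: s_def mult_neg_iff_divide_neg)
  qed
  have P0: "P \<noteq> 0" using P by (auto simp: monic_polys_def)
  have Peq: "P = [:b, 1:] * root_poly {..<m} d + (\<Sum>i<m. Polynomial.smult (s i) (root_poly ({..<m} - {i}) d))"
    using R d(2) by (simp add: R_def algebra_simps)
  note H = herglotz_roots[OF d(1) P0 Peq, simplified, OF sneg]
  show "P \<in> real_simple (Suc m) \<and> (\<forall>x. poly P x = 0 \<longrightarrow> poly Q x * poly (pderiv P) x > 0)"
  proof
    show "P \<in> real_simple (Suc m)"
      by (rule real_simpleI_complex[OF P]) (use H in \<open>auto, force\<close>)
    show "\<forall>x. poly P x = 0 \<longrightarrow> poly Q x * poly (pderiv P) x > 0"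
      using H(2) d(2) by (simp add: mult.commute)
  qed
next
  assume *: "P \<in> real_simple (Suc m) \<and> (\<forall>x. poly P x = 0 \<longrightarrow> poly Q x * poly (pderiv P) x > 0)"
  define d where "d = ordered_roots (Suc m) P"
  have d: "inj_on d {..<Suc m}" "P = root_poly {..<Suc m} d"
    using ordered_roots * by (auto simp: d_def strict_mono_on_inj_on_nat)
  define s where "s = (\<lambda>i. poly (- Q) (d i) / poly (root_poly ({..<Suc m} - {i}) d) (d i))"
  have "degree (- Q) < Suc m" using Q by (simp add: monic_polys_def)
  from lagrange_interpolation[OF d(1) this]
  have Qeq: "- Q = [:0, 0:] * root_poly {..<Suc m} d + (\<Sum>i<Suc m. Polynomial.smult (s i) (root_poly ({..<Suc m} - {i}) d))"
    by (simp only: s_def) simp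
  have sneg: "s i < 0" if "i < Suc m" for i
  proof -
    have "poly P (d i) = 0" using d(2) that by (simp add: poly_root_poly_eq_0)
    then have "poly Q (d i) * poly (pderiv P) (d i) > 0" using * by blast
    then show ?thesis using that pderiv_root_poly[of "{..<Suc m}" i d] d(2)
      by (simp add: s_def mult_pos_iff_divide_pos)
  qed
  have Q0: "- Q \<noteq> 0" using Q by (auto simp: monic_polys_def)
  have H1: "z \<in> \<real>" if "poly (map_poly of_real (- Q)) z = 0" for z :: complex
    by (rule herglotz_roots(1)[OF d(1) Q0 Qeq _ sneg _ that]) auto
  have H2: "poly (pderiv (- Q)) x * poly P x > 0" if "poly Q x = 0" for x
    unfolding d(2) by (rule herglotz_roots(2)[OF d(1) Q0 Qeq _ sneg]) (use that in auto)
  show "Q \<in> real_simple m \<and> (\<forall>x. poly Q x = 0 \<longrightarrow> poly P x * poly (pderiv Q) x < 0)"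
  proof
    show "Q \<in> real_simple m"
      by (rule real_simpleI_complex[OF Q]) (use H1 H2 in \<open>auto simp: pderiv_minus of_real_poly.hom_uminus hom_distribs, force\<close>)
    show "\<forall>x. poly Q x = 0 \<longrightarrow> poly P x * poly (pderiv Q) x < 0"
      using H2 by (simp add: pderiv_minus mult.commute)
  qed
qed

subsection \<open>Substitutions\<close>

text \<open>Substitution along a nondecreasing \<open>g\<close> on an interval that is given only by
  a compact exhaustion and may be open or unbounded. The rule for compact intervals is applied to
  indicators of Borel sets, the limit is monotone, and equality of the resulting measures covers
  every nonnegative measurable \<open>f\<close>.\<close>

lemma nn_integral_substitution_Union:
  fixes g g' :: "real \<Rightarrow> real" and f :: "real \<Rightarrow> ennreal" and a b :: "nat \<Rightarrow> real"
  assumes g [measurable]: "g \<in> borel_measurable borel" and [measurable]: "g' \<in> borel_measurable borel"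
    and f [measurable]: "f \<in> borel_measurable borel"
    and deriv: "\<And>x. x \<in> U \<Longrightarrow> (g has_real_derivative g' x) (at x)"
    and cont: "continuous_on U g'" and nonneg: "\<And>x. x \<in> U \<Longrightarrow> g' x \<ge> 0"
    and U: "U = (\<Union>k. {a k..b k})" and V: "V = (\<Union>k. {g (a k)..g (b k)})"
    and ab: "decseq a" "incseq b" "\<And>k. a k \<le> b k"
  shows "(\<integral>\<^sup>+x. f (g x) * ennreal (g' x) * indicator U x \<partial>lborel) = (\<integral>\<^sup>+y. f y * indicator V y \<partial>lborel)"
proof -
  have sub: "{a k..b k} \<subseteq> U" for k using U by auto
  have [measurable]: "U \<in> sets borel" "V \<in> sets borel" unfolding U V by auto
  \<comment> \<open>Two points of \<open>U\<close> lie in a common interval of the exhaustion, hence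
    so does the segment between them.\<close>
  have mono: "g x \<le> g y" if xy: "x \<in> U" "y \<in> U" "x \<le> y" for x y
  proof -
    obtain k where k: "x \<in> {a k..b k}" using xy(1) unfolding U by blast
    obtain l where l: "y \<in> {a l..b l}" using xy(2) unfolding U by blast
    note kl = k l
    have "{x..y} \<subseteq> {a (max k l)..b (max k l)}"
      using kl decseqD[OF ab(1), of k "max k l"] decseqD[OF ab(1), of l "max k l"]
        incseqD[OF ab(2), of k "max k l"] incseqD[OF ab(2), of l "max k l"] by auto
    then have "{x..y} \<subseteq> U" using sub by blast
    then show ?thesis
      using deriv nonneg xy(3) by (intro DERIV_nonneg_imp_nondecreasing[of x y g]) (auto, metis atLeastAtMost_iff subsetD)
  qed
  have inU: "a k \<in> U" "b k \<in> U" for k using sub[of k] ab(3)[of k] by auto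
  have incU: "incseq (\<lambda>k. {a k..b k})"
    using ab(1,2) by (auto simp: incseq_def decseq_def intro: order_trans)
  have "g (a l) \<le> g (a k)" "g (b k) \<le> g (b l)" if "k \<le> l" for k l
    using inU mono that decseqD[OF ab(1) that] incseqD[OF ab(2) that] by auto
  then have incV: "incseq (\<lambda>k. {g (a k)..g (b k)})"
    by (auto simp: incseq_def intro: order_trans)
  have "distr (density lborel (\<lambda>x. ennreal (g' x) * indicator U x)) borel g = density lborel (indicator V)"
  proof (rule measure_eqI)
    fix B assume "B \<in> sets (distr (density lborel (\<lambda>x. ennreal (g' x) * indicator U x)) borel g)"
    then have B [measurable]: "B \<in> sets borel" by simp
    have [measurable]: "g -` B \<in> sets borel" using measurable_sets_borel[OF g B] .
    have "emeasure (distr (density lborel (\<lambda>x. ennreal (g' x) * indicator U x)) borel g) B =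
        (\<integral>\<^sup>+x. ennreal (g' x) * indicator U x * indicator (g -` B) x \<partial>lborel)"
      by (subst emeasure_distr) (auto simp: emeasure_density intro!: nn_integral_cong split: split_indicator)
    also have "\<dots> = (\<integral>\<^sup>+x. (SUP k. ennreal (indicat_real B (g x) * g' x * indicator {a k..b k} x)) \<partial>lborel)"
    proof (intro nn_integral_cong)
      fix x
      show "ennreal (g' x) * indicator U x * indicator (g -` B) x = (SUP k. ennreal (indicat_real B (g x) * g' x * indicator {a k..b k} x))"
      proof (cases "x \<in> U")
        case True
        then obtain k where "x \<in> {a k..b k}" using U by auto
        then have "(SUP k. ennreal (indicat_real B (g x) * g' x * indicator {a k..b k} x)) = ennreal (indicat_real B (g x) * g' x)"
          using nonneg[OF True] by (intro antisym SUP_least SUP_upper2[of k]) (auto split: split_indicator)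
        then show ?thesis using True by (auto split: split_indicator)
      next
        case False
        then have "indicat_real {a k..b k} x = 0" for k using U by auto
        then show ?thesis using False by simp
      qed
    qed
    also have "\<dots> = (SUP k. \<integral>\<^sup>+x. ennreal (indicat_real B (g x) * g' x * indicator {a k..b k} x) \<partial>lborel)"
    proof (rule nn_integral_monotone_convergence_SUP)
      show "incseq (\<lambda>k x. ennreal (indicat_real B (g x) * g' x * indicator {a k..b k} x))"
      proof (rule monoI, rule le_funI)
        fix k l :: nat and x assume "k \<le> l"
        then have "{a k..b k} \<subseteq> {a l..b l}" using incseqD[OF incU] by auto
        then show "ennreal (indicat_real B (g x) * g' x * indicator {a k..b k} x) \<le> ennreal (indicat_real B (g x) * g' x * indicator {a l..b l} x)"
          using nonneg[of x] sub[of l] by (intro ennreal_leI) (auto split: split_indicator)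
      qed
    qed measurable
    also have "\<dots> = (SUP k. \<integral>\<^sup>+y. ennreal (indicat_real B y * indicator {g (a k)..g (b k)} y) \<partial>lborel)"
    proof (intro SUP_cong refl nn_integral_substitution[symmetric] ab(3))
      fix k
      show "continuous_on {a k..b k} g'" using cont sub by (rule continuous_on_subset)
      show "(g has_real_derivative g' x) (at x)" "0 \<le> g' x" if "x \<in> {a k..b k}" for x
        using that sub deriv nonneg by blast+
      show "set_borel_measurable borel {g (a k)..g (b k)} (indicat_real B)"
        unfolding set_borel_measurable_def by measurable
    qed
    also have "\<dots> = (SUP k. emeasure lborel (B \<inter> {g (a k)..g (b k)}))"
    proof (intro SUP_cong refl)
      fix k
      have "(\<integral>\<^sup>+y. ennreal (indicat_real B y * indicator {g (a k)..g (b k)} y) \<partial>lborel) = (\<integral>\<^sup>+y. indicator (B \<inter> {g (a k)..g (b k)}) y \<partial>lborel)"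
        by (intro nn_integral_cong) (auto split: split_indicator)
      then show "(\<integral>\<^sup>+y. ennreal (indicat_real B y * indicator {g (a k)..g (b k)} y) \<partial>lborel) = emeasure lborel (B \<inter> {g (a k)..g (b k)})"
        by simp
    qed
    also have "\<dots> = emeasure lborel (\<Union>k. B \<inter> {g (a k)..g (b k)})"
    proof (rule SUP_emeasure_incseq)
      show "incseq (\<lambda>k. B \<inter> {g (a k)..g (b k)})"
        by (rule monoI) (use monoD[OF incV] in blast)
    qed auto
    also have "(\<Union>k. B \<inter> {g (a k)..g (b k)}) = B \<inter> V" using V by auto
    also have "emeasure lborel (B \<inter> V) = emeasure (density lborel (indicator V)) B"
      by (subst emeasure_density) (auto simp: indicator_inter_arith[symmetric] Int_commute)
    finally show "emeasure (distr (density lborel (\<lambda>x. ennreal (g' x) * indicator U x)) borel g) B = emeasure (density lborel (indicator V)) B" .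
  qed simp
  then have "(\<integral>\<^sup>+y. f y \<partial>distr (density lborel (\<lambda>x. ennreal (g' x) * indicator U x)) borel g) = (\<integral>\<^sup>+y. f y \<partial>density lborel (indicator V))"
    by simp
  then show ?thesis
    by (simp add: nn_integral_distr nn_integral_density mult_ac)
qed

text \<open>The density of the image of Lebesgue measure under y -> - y^2: each half-line
  contributes 1 / (2 sqrt (- u)).\<close>

definition neg_sqrt_density :: "real \<Rightarrow> ennreal" where
  "neg_sqrt_density u = (if u < 0 then ennreal (1 / sqrt (- u)) else 0)"

lemma measurable_neg_sqrt_density [measurable]: "neg_sqrt_density \<in> borel_measurable borel"
  unfolding neg_sqrt_density_def by measurable

lemma nn_integral_neg_square:
  fixes f :: "real \<Rightarrow> ennreal"
  assumes f [measurable]: "f \<in> borel_measurable borel"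
  shows "(\<integral>\<^sup>+y. f (- (y\<^sup>2)) \<partial>lborel) = (\<integral>\<^sup>+u. neg_sqrt_density u * f u \<partial>lborel)"
proof -
  have half: "(\<integral>\<^sup>+y. f (- (y\<^sup>2)) * indicator {..<0} y \<partial>lborel) = (\<integral>\<^sup>+u. f u * ennreal (1 / (2 * sqrt (- u))) * indicator {..<0} u \<partial>lborel)"
  proof -
    \<comment> \<open>On the negative half-line the map is increasing; the compact intervals stay
      away from 0, where the density is singular.\<close>
    have U: "{..<0::real} = (\<Union>k. {- real (Suc k) .. - inverse (real (Suc k))})"
    proof (intro equalityI subsetI)
      fix x :: real assume x: "x \<in> {..<0}"
      obtain k where k: "real k > max (- x) (inverse (- x))" using reals_Archimedean2 by blast
      have "inverse (- x) < real (Suc k)" using k by simp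
      then have "inverse (real (Suc k)) < - x" using x by (metis inverse_inverse_eq inverse_less_imp_less less_imp_inverse_less lessThan_iff neg_0_less_iff_less positive_imp_inverse_positive)
      then show "x \<in> (\<Union>k. {- real (Suc k) .. - inverse (real (Suc k))})" using k by (auto intro!: exI[of _ k])
    next
      fix x :: real assume "x \<in> (\<Union>k. {- real (Suc k) .. - inverse (real (Suc k))})"
      then obtain k where "x \<le> - inverse (real (Suc k))" by auto
      moreover have "inverse (real (Suc k)) > 0" by simp
      ultimately have "x < 0" by linarith
      then show "x \<in> {..<0}" by simp
    qed
    have V: "{..<0::real} = (\<Union>k. {- ((- real (Suc k))\<^sup>2) .. - ((- inverse (real (Suc k)))\<^sup>2)})"
    proof (intro equalityI subsetI)
      fix x :: real assume x: "x \<in> {..<0}"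
      then have "- sqrt (- x) \<in> {..<0}" by simp
      then obtain k where k: "- real (Suc k) \<le> - sqrt (- x)" "- sqrt (- x) \<le> - inverse (real (Suc k))" unfolding U by auto
      have "(sqrt (- x))\<^sup>2 \<le> (real (Suc k))\<^sup>2" "(inverse (real (Suc k)))\<^sup>2 \<le> (sqrt (- x))\<^sup>2"
        by (rule power_mono; use k x in simp)+
      then have "x \<in> {- ((- real (Suc k))\<^sup>2) .. - ((- inverse (real (Suc k)))\<^sup>2)}"
        using x by (simp del: of_nat_Suc)
      then show "x \<in> (\<Union>k. {- ((- real (Suc k))\<^sup>2) .. - ((- inverse (real (Suc k)))\<^sup>2)})" by blast
    next
      fix x :: real assume "x \<in> (\<Union>k. {- ((- real (Suc k))\<^sup>2) .. - ((- inverse (real (Suc k)))\<^sup>2)})"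
      then obtain k where "x \<le> - ((- inverse (real (Suc k)))\<^sup>2)" by auto
      moreover have "(- inverse (real (Suc k)))\<^sup>2 > 0" by simp
      ultimately have "x < 0" by linarith
      then show "x \<in> {..<0}" by simp
    qed
    have "(\<integral>\<^sup>+y. (f (- (y\<^sup>2)) * ennreal (1 / (2 * sqrt (- (- (y\<^sup>2)))))) * ennreal (- 2 * y) * indicator {..<0} y \<partial>lborel) = (\<integral>\<^sup>+u. (f u * ennreal (1 / (2 * sqrt (- u)))) * indicator {..<0} u \<partial>lborel)"
    proof (rule nn_integral_substitution_Union[where g = "\<lambda>y. - (y\<^sup>2)" and g' = "\<lambda>y. - 2 * y" and
          f = "\<lambda>u. f u * ennreal (1 / (2 * sqrt (- u)))", OF _ _ _ _ _ _ U V])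
      show "decseq (\<lambda>k. - real (Suc k))" by (auto simp: decseq_def)
      show "incseq (\<lambda>k. - inverse (real (Suc k)))" by (auto simp: incseq_def intro!: le_imp_inverse_le)
      show "- real (Suc k) \<le> - inverse (real (Suc k))" for k
        by (simp add: field_simps) 
    qed (auto intro!: derivative_eq_intros continuous_intros)
    moreover have "(f (- (y\<^sup>2)) * ennreal (1 / (2 * sqrt (- (- (y\<^sup>2)))))) * ennreal (- 2 * y) * indicator {..<0} y = f (- (y\<^sup>2)) * indicator {..<0} y" for y
    proof (cases "y < 0")
      case True
      have "ennreal (1 / (2 * sqrt (- (- (y\<^sup>2))))) * ennreal (- 2 * y) = 1"
        using True by (subst ennreal_mult[symmetric]) auto
      then show ?thesis using True by (simp only: mult.assoc, simp add: mult.assoc[symmetric])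
    qed simp
    ultimately show ?thesis by simp
  qed
  have reflected: "(\<integral>\<^sup>+y. f (- (y\<^sup>2)) * indicator {0<..} y \<partial>lborel) = (\<integral>\<^sup>+y. f (- (y\<^sup>2)) * indicator {..<0} y \<partial>lborel)"
    using nn_integral_lborel_affine[of "\<lambda>y. f (- (y\<^sup>2)) * indicator {..<0} y" "- 1" 0]
    by (simp add: indicator_def)
  have "(\<integral>\<^sup>+y. f (- (y\<^sup>2)) \<partial>lborel) = (\<integral>\<^sup>+y. f (- (y\<^sup>2)) * indicator {..<0} y + f (- (y\<^sup>2)) * indicator {0<..} y \<partial>lborel)"
    by (intro nn_integral_cong_AE) (use AE_lborel_singleton[of 0] in \<open>eventually_elim, auto split: split_indicator\<close>)
  also have "\<dots> = 2 * (\<integral>\<^sup>+u. f u * ennreal (1 / (2 * sqrt (- u))) * indicator {..<0} u \<partial>lborel)"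
    by (subst nn_integral_add) (measurable, simp only: reflected half mult_2)
  also have "\<dots> = (\<integral>\<^sup>+u. neg_sqrt_density u * f u \<partial>lborel)"
  proof (subst nn_integral_cmult[symmetric], measurable, intro nn_integral_cong)
    fix u :: real
    have "2 * ennreal (1 / (2 * sqrt (- u))) = ennreal (1 / sqrt (- u))" if "u < 0"
    proof -
      have "2 * ennreal (1 / (2 * sqrt (- u))) = ennreal (2 * (1 / (2 * sqrt (- u))))" using that by (subst ennreal_mult) auto
      then show ?thesis by simp
    qed
    then show "2 * (f u * ennreal (1 / (2 * sqrt (- u))) * indicator {..<0} u) = neg_sqrt_density u * f u"
      by (auto simp: neg_sqrt_density_def mult_ac split: split_indicator)
  qed
  finally show ?thesis .
qed

text \<open>
  The image of Lebesgue measure is again translation invariant; integrating a function against a rotation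
  invariant Gaussian weight in two ways identifies the constant of proportionality as 1.
\<close>

lemma nn_integral_leb_orthogonal:
  fixes R :: "nat \<Rightarrow> nat \<Rightarrow> real"
  assumes rows: "\<And>i j. i < m \<Longrightarrow> j < m \<Longrightarrow> (\<Sum>k<m. R i k * R j k) = (if i = j then 1 else 0)"
    and cols: "\<And>i j. i < m \<Longrightarrow> j < m \<Longrightarrow> (\<Sum>k<m. R k i * R k j) = (if i = j then 1 else 0)"
    and G [measurable]: "G \<in> borel_measurable (leb {..<m})"
  shows "(\<integral>\<^sup>+x. G (\<lambda>i\<in>{..<m}. \<Sum>j<m. R i j * x j) \<partial>leb {..<m}) = (\<integral>\<^sup>+x. G x \<partial>leb {..<m})"
proof -
  define T where "T = (\<lambda>x. \<lambda>i\<in>{..<m}. \<Sum>j<m. R i j * x j)"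
  define S where "S = (\<lambda>x. \<lambda>i\<in>{..<m}. \<Sum>j<m. R j i * x j)"
  define p where "p = (\<lambda>t x :: nat \<Rightarrow> real. \<lambda>i\<in>{..<m}. t i + x i)"
  define q where "q = (\<lambda>x :: nat \<Rightarrow> real. \<lambda>i\<in>{..<m}. - x i)"
  define g where "g = (\<lambda>x :: nat \<Rightarrow> real. \<Prod>i<m. ennreal (exp (- ((x i)\<^sup>2))))"
  have [measurable]: "T \<in> measurable (leb {..<m}) (leb {..<m})" "S \<in> measurable (leb {..<m}) (leb {..<m})"
    "q \<in> measurable (leb {..<m}) (leb {..<m})" "g \<in> borel_measurable (leb {..<m})"
    unfolding T_def S_def q_def g_def by measurable
  have [measurable (raw)]: "(\<lambda>z. p (f z) (h z)) \<in> measurable N (leb {..<m})"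
    if [measurable]: "f \<in> measurable N (leb {..<m})" "h \<in> measurable N (leb {..<m})" for f h and N :: "((nat \<Rightarrow> real) \<times> (nat \<Rightarrow> real)) measure"
    unfolding p_def by (intro measurable_lebI borel_measurable_add measurable_compose[OF that(1) measurable_leb_coordinate]
        measurable_compose[OF that(2) measurable_leb_coordinate])
  have [measurable (raw)]: "(\<lambda>z. p (f z) (h z)) \<in> measurable N (leb {..<m})"
    if [measurable]: "f \<in> measurable N (leb {..<m})" "h \<in> measurable N (leb {..<m})" for f h and N :: "(nat \<Rightarrow> real) measure"
    unfolding p_def by (intro measurable_lebI borel_measurable_add measurable_compose[OF that(1) measurable_leb_coordinate]
        measurable_compose[OF that(2) measurable_leb_coordinate])
  have translate: "(\<integral>\<^sup>+x. f (p t x) \<partial>leb {..<m}) = (\<integral>\<^sup>+x. f x \<partial>leb {..<m})"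
    if "f \<in> borel_measurable (leb {..<m})" for f t
    unfolding p_def using that by (intro nn_integral_leb_translate) auto
  have reflect: "(\<integral>\<^sup>+x. f (q x) \<partial>leb {..<m}) = (\<integral>\<^sup>+x. f x \<partial>leb {..<m})"
    if "f \<in> borel_measurable (leb {..<m})" for f
    using nn_integral_leb_affine[of "{..<m}" "\<lambda>_. - 1" f "\<lambda>_. 0"] that by (simp add: q_def abs_prod)
  have TS: "T (S y) = y" if "y \<in> space (leb {..<m})" for y
  proof
    fix i
    show "T (S y) i = y i"
    proof (cases "i < m")
      case True
      have "T (S y) i = (\<Sum>j<m. \<Sum>k<m. R i j * R k j * y k)"
        using True by (simp add: T_def S_def sum_distrib_left mult.assoc)
      also have "\<dots> = (\<Sum>k<m. (\<Sum>j<m. R i j * R k j) * y k)"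
        by (subst sum.swap) (simp add: sum_distrib_right)
      also have "\<dots> = y i" using True by (simp add: rows if_distrib[of "\<lambda>c. c * _"] cong: if_cong)
      finally show ?thesis .
    next
      case False
      then show ?thesis using that by (simp add: T_def space_PiM PiE_def extensional_def)
    qed
  qed
  have norm: "g (T x) = g x" for x
  proof -
    have "(\<Sum>i<m. (T x i)\<^sup>2) = (\<Sum>i<m. \<Sum>j<m. \<Sum>k<m. R i j * R i k * (x j * x k))"
      by (simp add: T_def power2_eq_square sum_product mult_ac)
    also have "\<dots> = (\<Sum>j<m. \<Sum>k<m. (\<Sum>i<m. R i j * R i k) * (x j * x k))"
      by (subst sum.swap, rule sum.cong[OF refl], subst sum.swap) (simp add: sum_distrib_right)
    also have "\<dots> = (\<Sum>j<m. (x j)\<^sup>2)"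
      by (simp add: cols if_distrib[of "\<lambda>c. c * _"] power2_eq_square cong: if_cong)
    finally have "(\<Sum>i<m. (T x i)\<^sup>2) = (\<Sum>j<m. (x j)\<^sup>2)" .
    moreover have "g y = ennreal (exp (- (\<Sum>i<m. (y i)\<^sup>2)))" for y
      by (simp add: g_def prod_ennreal exp_sum[symmetric] sum_negf)
    ultimately show ?thesis by simp
  qed
  have lin1: "T (p (S y) x) = p y (T x)" if "y \<in> space (leb {..<m})" for x y
  proof -
    have "T (p (S y) x) = p (T (S y)) (T x)"
      by (auto simp: T_def p_def fun_eq_iff distrib_left sum.distrib)
    then show ?thesis using TS[OF that] by simp
  qed
  have "(\<integral>\<^sup>+x. G (T x) \<partial>leb {..<m}) * (\<integral>\<^sup>+y. g y \<partial>leb {..<m}) = (\<integral>\<^sup>+y. (\<integral>\<^sup>+x. G (T x) \<partial>leb {..<m}) * g y \<partial>leb {..<m})"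
    by (rule nn_integral_cmult[symmetric]) measurable
  \<comment> \<open>For each \<open>y\<close> the variable \<open>x\<close> is shifted by
    \<open>S y\<close>, which turns T x into y + T x.\<close>
  also have "\<dots> = (\<integral>\<^sup>+y. (\<integral>\<^sup>+x. G (p y (T x)) \<partial>leb {..<m}) * g y \<partial>leb {..<m})"
  proof (rule nn_integral_cong)
    fix y assume y: "y \<in> space (leb {..<m})"
    have "(\<integral>\<^sup>+x. G (T x) \<partial>leb {..<m}) = (\<integral>\<^sup>+x. G (T (p (S y) x)) \<partial>leb {..<m})"
      by (rule translate[symmetric]) measurable
    then show "(\<integral>\<^sup>+x. G (T x) \<partial>leb {..<m}) * g y = (\<integral>\<^sup>+x. G (p y (T x)) \<partial>leb {..<m}) * g y"
      using lin1[OF y] by simp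
  qed
  also have "\<dots> = (\<integral>\<^sup>+y. \<integral>\<^sup>+x. G (p y (T x)) * g y \<partial>leb {..<m} \<partial>leb {..<m})"
    by (intro nn_integral_cong nn_integral_multc[symmetric]) measurable
  also have "\<dots> = (\<integral>\<^sup>+x. \<integral>\<^sup>+y. G (p y (T x)) * g y \<partial>leb {..<m} \<partial>leb {..<m})"
    by (rule leb_swap) (auto, measurable)
  \<comment> \<open>Shifting \<open>y\<close> by - T x moves the translation from \<open>G\<close>
    to the Gaussian \<open>g\<close>.\<close>
  also have "\<dots> = (\<integral>\<^sup>+x. \<integral>\<^sup>+y. G y * g (p y (q (T x))) \<partial>leb {..<m} \<partial>leb {..<m})"
  proof (rule nn_integral_cong)
    fix x assume x: "x \<in> space (leb {..<m})"
    have 1: "p (p (q (T x)) y) (T x) = y" if "y \<in> space (leb {..<m})" for y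
      using that by (auto simp: p_def q_def fun_eq_iff space_PiM PiE_def extensional_def)
    have 2: "p (q (T x)) y = p y (q (T x))" for y by (auto simp: p_def fun_eq_iff)
    have [measurable]: "(\<lambda>y. p y (T x)) \<in> measurable (leb {..<m}) (leb {..<m})"
      unfolding p_def by measurable
    have "(\<integral>\<^sup>+y. G (p y (T x)) * g y \<partial>leb {..<m}) = (\<integral>\<^sup>+y. G (p (p (q (T x)) y) (T x)) * g (p (q (T x)) y) \<partial>leb {..<m})"
      by (rule translate[symmetric]) measurable
    also have "\<dots> = (\<integral>\<^sup>+y. G y * g (p y (q (T x))) \<partial>leb {..<m})"
      by (rule nn_integral_cong) (simp add: 1 2[symmetric])
    finally show "(\<integral>\<^sup>+y. G (p y (T x)) * g y \<partial>leb {..<m}) = \<dots>" .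
  qed
  also have "\<dots> = (\<integral>\<^sup>+y. \<integral>\<^sup>+x. G y * g (p y (q (T x))) \<partial>leb {..<m} \<partial>leb {..<m})"
    by (rule leb_swap) (auto, measurable)
  also have "\<dots> = (\<integral>\<^sup>+y. G y * (\<integral>\<^sup>+x. g x \<partial>leb {..<m}) \<partial>leb {..<m})"
  proof (rule nn_integral_cong)
    fix y assume y: "y \<in> space (leb {..<m})"
    have [measurable]: "(\<lambda>x. p (S y) x) \<in> measurable (leb {..<m}) (leb {..<m})"
      unfolding p_def by measurable
    \<comment> \<open>y - T x = T (S y - x), and \<open>g\<close> does not change under
      \<open>T\<close>.\<close>
    have "g (p y (q (T x))) = g (p (S y) (q x))" for x
    proof -
      have "p y (q (T x)) = p y (T (q x))"
        by (auto simp: T_def q_def p_def fun_eq_iff sum_negf)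
      then show ?thesis using lin1[OF y, of "q x"] norm[of "p (S y) (q x)"] by simp
    qed
    then have "(\<integral>\<^sup>+x. g (p y (q (T x))) \<partial>leb {..<m}) = (\<integral>\<^sup>+x. g (p (S y) (q x)) \<partial>leb {..<m})" by simp
    also have "\<dots> = (\<integral>\<^sup>+x. g (p (S y) x) \<partial>leb {..<m})"
      by (rule reflect[of "\<lambda>x. g (p (S y) x)"]) measurable
    also have "\<dots> = (\<integral>\<^sup>+x. g x \<partial>leb {..<m})"
      by (rule translate) measurable
    finally have "(\<integral>\<^sup>+x. g (p y (q (T x))) \<partial>leb {..<m}) = \<dots>" .
    moreover have "(\<integral>\<^sup>+x. G y * g (p y (q (T x))) \<partial>leb {..<m}) = G y * (\<integral>\<^sup>+x. g (p y (q (T x))) \<partial>leb {..<m})"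
      using y by (intro nn_integral_cmult) measurable
    ultimately show "(\<integral>\<^sup>+x. G y * g (p y (q (T x))) \<partial>leb {..<m}) = G y * (\<integral>\<^sup>+x. g x \<partial>leb {..<m})" by simp
  qed
  also have "\<dots> = (\<integral>\<^sup>+y. G y \<partial>leb {..<m}) * (\<integral>\<^sup>+x. g x \<partial>leb {..<m})"
    by (rule nn_integral_multc) measurable
  finally have eq: "(\<integral>\<^sup>+x. G (T x) \<partial>leb {..<m}) * (\<integral>\<^sup>+y. g y \<partial>leb {..<m}) = \<dots>" .
  have one: "(\<integral>\<^sup>+y. ennreal (exp (- (y\<^sup>2))) \<partial>lborel) = ennreal (sqrt pi)"
  proof -
    have "has_bochner_integral lborel (\<lambda>x. exp (- x\<^sup>2) :: real) (sqrt pi)"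
      using gaussian_moment_even_pos[of 0] has_bochner_integral_even_function[of "\<lambda>x. exp (- x\<^sup>2) :: real" "sqrt pi / 2"] by simp
    then show ?thesis by (subst nn_integral_eq_integral) (auto simp: has_bochner_integral_iff)
  qed
  have "(\<integral>\<^sup>+y. g y \<partial>leb {..<m}) = (\<Prod>i<m. \<integral>\<^sup>+y. ennreal (exp (- (y\<^sup>2))) \<partial>lborel)"
    unfolding g_def by (rule leb.product_nn_integral_prod) auto
  then have "(\<integral>\<^sup>+y. g y \<partial>leb {..<m}) = ennreal (sqrt pi ^ m)"
    by (simp add: one ennreal_power)
  \<comment> \<open>The Gaussian integral is finite and positive, so it cancels in
    \<open>ennreal\<close>.\<close>
  moreover have "a = b" if "a * ennreal r = b * ennreal r" "r > 0" for a b r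
  proof -
    have "a * ennreal r * ennreal (1 / r) = b * ennreal r * ennreal (1 / r)" using that by simp
    then show ?thesis using that(2) by (simp add: mult.assoc ennreal_mult[symmetric])
  qed
  ultimately show ?thesis
    using eq unfolding T_def by simp
qed

text \<open>The discriminant: each pair of indices contributes its difference twice. Its square root
  is what lets Jacobians cancel against inverse square roots below.\<close>

lemma abs_vdm_square:
  "(\<Prod>i<m. \<bar>poly (root_poly ({..<m} - {i}) l) (l i)\<bar>) = (vdm m l)\<^sup>2"
proof (induction m)
  case (Suc m)
  have 1: "{..<Suc m} - {i} = insert m ({..<m} - {i})" if "i < m" for i using that by auto
  have 2: "{..<Suc m} - {m} = {..<m}" by auto
  have "(\<Prod>i<m. \<bar>poly (root_poly ({..<Suc m} - {i}) l) (l i)\<bar>) = (\<Prod>i<m. \<bar>l m - l i\<bar> * \<bar>poly (root_poly ({..<m} - {i}) l) (l i)\<bar>)"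
    by (intro prod.cong refl) (simp add: 1 poly_root_poly abs_mult abs_minus_commute)
  then have "(\<Prod>i<Suc m. \<bar>poly (root_poly ({..<Suc m} - {i}) l) (l i)\<bar>) =
     (\<Prod>i<m. \<bar>l m - l i\<bar>) * (vdm m l)\<^sup>2 * \<bar>poly (root_poly {..<m} l) (l m)\<bar>"
    by (simp only: prod.lessThan_Suc prod.distrib Suc.IH 2)
  also have "\<bar>poly (root_poly {..<m} l) (l m)\<bar> = (\<Prod>i<m. \<bar>l m - l i\<bar>)"
    by (simp add: poly_root_poly abs_prod)
  also have "(\<Prod>i<m. \<bar>l m - l i\<bar>) * (vdm m l)\<^sup>2 * (\<Prod>i<m. \<bar>l m - l i\<bar>) = (vdm (Suc m) l)\<^sup>2"
    by (simp add: vdm_Suc power2_eq_square flip: abs_prod)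
  finally show ?case .
qed simp

subsection \<open>The interlacing kernel\<close>

text \<open>The product of |P| over the roots of \<open>Q\<close> is |Res P Q|, and the sign
  condition is interlacing as in \<open>interlace_iff\<close>. The roots of \<open>Q\<close> are
  used because \<open>Q\<close> is fixed while a border is added.\<close>

definition interlace_kernel :: "nat \<Rightarrow> real poly \<Rightarrow> real poly \<Rightarrow> ennreal" where
  "interlace_kernel m P Q =
     (if Q \<in> real_simple m \<and> (\<forall>i<m. poly P (ordered_roots m Q i) * poly (pderiv Q) (ordered_roots m Q i) < 0)
      then ennreal (\<Prod>i<m. 1 / sqrt \<bar>poly P (ordered_roots m Q i)\<bar>) else 0)"

lemma measurable_interlace_kernel [measurable (raw)]:
  assumes [measurable]: "f \<in> measurable N polyM" "g \<in> measurable N polyM"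
  shows "(\<lambda>x. interlace_kernel m (f x) (g x)) \<in> borel_measurable N"
proof -
  have r: "(\<lambda>x. ordered_roots m (g x) i) \<in> borel_measurable N" if "i < m" for i
    by (rule measurable_compose[OF assms(2) measurable_ordered_roots[OF that]])
  have [measurable]: "(\<lambda>x. poly (f x) (ordered_roots m (g x) i)) \<in> borel_measurable N"
    "(\<lambda>x. poly (pderiv (g x)) (ordered_roots m (g x) i)) \<in> borel_measurable N" if "i \<in> {..<m}" for i
    using that r[of i] by (auto intro!: measurable_poly_eval measurable_pderiv assms)
  have [measurable]: "Measurable.pred N (\<lambda>x. g x \<in> real_simple m)"
    by (rule measurable_compose[OF assms(2) measurable_real_simple_pred])
  have *: "(\<forall>i<m. Q i) \<longleftrightarrow> (\<forall>i\<in>{..<m}. Q i)" for Q by auto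
  show ?thesis unfolding interlace_kernel_def * by measurable
qed

lemma real_sqrt_prod: "sqrt (\<Prod>i\<in>I. f i) = (\<Prod>i\<in>I. sqrt (f i))"
  by (induction I rule: infinite_finite_induct) (simp_all add: real_sqrt_mult)

lemma poly_lagrange_sum:
  fixes d u :: "nat \<Rightarrow> real"
  assumes "j < m"
  shows "poly (\<Sum>i<m. Polynomial.smult (u i) (root_poly ({..<m} - {i}) d)) (d j) = u j * poly (root_poly ({..<m} - {j}) d) (d j)"
proof -
  have "poly (\<Sum>i<m. Polynomial.smult (u i) (root_poly ({..<m} - {i}) d)) (d j) =
    (\<Sum>i<m. if i = j then u j * poly (root_poly ({..<m} - {j}) d) (d j) else 0)"
    unfolding poly_sum
    by (intro sum.cong) (use assms poly_root_poly_remove_eq[of "{..<m}"] in auto)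
  then show ?thesis using assms by simp
qed

lemma vdm_nonzero: "inj_on l {..<m} \<Longrightarrow> vdm m l \<noteq> 0"
  by (induction m) (auto simp: vdm_Suc lessThan_Suc inj_on_insert)

text \<open>With u_i = - v_i^2 the argument of \<open>G\<close> is (x - t) Q plus a Lagrange
  combination with coefficients u_i, so P(d_i) is u_i times R_i(d_i), where R_i is the i-th Lagrange
  polynomial. The densities of the u_i become sqrt |R_i(d_i)| / sqrt |P(d_i)|. As the |R_i(d_i)|
  multiply to the square of \<open>vdm m d\<close>, the numerators are exactly the Jacobian of the
  Lagrange basis and cancel against it.\<close>

lemma nn_integral_bordered:
  assumes Q: "Q \<in> real_simple m" and G [measurable]: "G \<in> borel_measurable polyM"
  defines "d \<equiv> ordered_roots m Q"
  shows "(\<integral>\<^sup>+v. \<integral>\<^sup>+t. G ([:- t, 1:] * Q - (\<Sum>i<m. Polynomial.smult ((v i)\<^sup>2) (root_poly ({..<m} - {i}) d))) \<partial>lborel \<partial>leb {..<m}) =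
    (\<integral>\<^sup>+c. G (monic_poly (Suc m) c) * interlace_kernel m (monic_poly (Suc m) c) Q \<partial>leb {..<Suc m})"
proof -
  have d: "inj_on d {..<m}" "root_poly {..<m} d = Q"
    using ordered_roots[OF Q] by (auto simp: d_def strict_mono_on_inj_on_nat)
  have Qm: "degree Q = m" "coeff Q m = 1" "lead_coeff Q = 1"
    using real_simple_monic[OF Q] by (auto simp: monic_polys_def)
  define R where "R = (\<lambda>i. root_poly ({..<m} - {i}) d)"
  define F where "F = (\<lambda>t u. [:t, 1:] * Q + (\<Sum>i<m. Polynomial.smult (u i) (R i)))"
  \<comment> \<open>The density of the u_i rewritten as a function of P alone, so that it passes
    through the changes of basis as part of the test function.\<close>
  define w where "w = (\<lambda>P. \<Prod>i<m. neg_sqrt_density (poly P (d i) / poly (R i) (d i)))"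
  have [measurable]: "w \<in> borel_measurable polyM" unfolding w_def by measurable
  have Fm: "(\<lambda>z. F (f z) (g z)) \<in> measurable N polyM"
    if "f \<in> borel_measurable N" "g \<in> measurable N (leb {..<m})" for f g and N :: "'b measure"
    unfolding F_def
    by (intro measurable_poly_add measurable_poly_mult measurable_pCons measurable_polyM_const measurable_poly_sum
        measurable_smult that measurable_compose[OF that(2) measurable_leb_coordinate] borel_measurable_const)
  have R0: "poly (R i) (d i) \<noteq> 0" if "i < m" for i
    unfolding R_def using d(1) that by (intro poly_root_poly_remove_ne) auto
  have Fd: "poly (F t u) (d i) = u i * poly (R i) (d i)" if "i < m" for t u i
  proof -
    have "poly Q (d i) = 0" using d(2) that poly_root_poly_eq_0[of "{..<m}" d "d i"] by auto
    then show ?thesis unfolding F_def R_def using poly_lagrange_sum[OF that, of u d] by simp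
  qed
  have wF: "w (F t u) = (\<Prod>i<m. neg_sqrt_density (u i))" for t u
    unfolding w_def by (intro prod.cong refl) (simp add: Fd R0)
  have v0: "\<bar>vdm m d\<bar> > 0" using vdm_nonzero[OF d(1)] by simp
  have prodR: "(\<Prod>i<m. \<bar>poly (R i) (d i)\<bar>) = (vdm m d)\<^sup>2" unfolding R_def by (rule abs_vdm_square)
  have wk: "w P = ennreal \<bar>vdm m d\<bar> * interlace_kernel m P Q" for P
  proof -
    have pd: "poly (pderiv Q) (d i) = poly (R i) (d i)" if "i < m" for i
      using pderiv_root_poly[of "{..<m}" i d] that d(2) by (simp add: R_def)
    show ?thesis
    proof (cases "\<forall>i<m. poly P (d i) * poly (R i) (d i) < 0")
      case True
      then have neg: "poly P (d i) / poly (R i) (d i) < 0" if "i < m" for i using that by (simp add: mult_neg_iff_divide_neg)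
      have "w P = (\<Prod>i<m. ennreal (1 / sqrt (- (poly P (d i) / poly (R i) (d i)))))"
        unfolding w_def neg_sqrt_density_def using neg by (intro prod.cong) auto
      also have "\<dots> = (\<Prod>i<m. ennreal (sqrt \<bar>poly (R i) (d i)\<bar> * (1 / sqrt \<bar>poly P (d i)\<bar>)))"
      proof (intro prod.cong refl arg_cong[where f = ennreal])
        fix i assume "i \<in> {..<m}"
        then have "- (poly P (d i) / poly (R i) (d i)) = \<bar>poly P (d i)\<bar> / \<bar>poly (R i) (d i)\<bar>"
          using neg[of i] by (simp flip: abs_divide)
        then show "1 / sqrt (- (poly P (d i) / poly (R i) (d i))) = sqrt \<bar>poly (R i) (d i)\<bar> * (1 / sqrt \<bar>poly P (d i)\<bar>)"
          by (simp add: real_sqrt_divide)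
      qed
      also have "\<dots> = ennreal ((\<Prod>i<m. sqrt \<bar>poly (R i) (d i)\<bar>) * (\<Prod>i<m. 1 / sqrt \<bar>poly P (d i)\<bar>))"
        by (subst prod_ennreal) (simp, simp only: prod.distrib)
      also have "(\<Prod>i<m. sqrt \<bar>poly (R i) (d i)\<bar>) = \<bar>vdm m d\<bar>"
        using prodR by (metis real_sqrt_abs real_sqrt_prod)
      finally show ?thesis
        using True Q pd by (simp add: interlace_kernel_def d_def[symmetric] ennreal_mult prod_nonneg)
    next
      case False
      then obtain i where i: "i < m" "\<not> poly P (d i) / poly (R i) (d i) < 0" by (auto simp: mult_neg_iff_divide_neg)
      then have "w P = 0" unfolding w_def by (intro prod_zero) (auto simp: neg_sqrt_density_def)
      moreover have "interlace_kernel m P Q = 0"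
        using i pd[OF i(1)] by (auto simp: interlace_kernel_def d_def[symmetric] mult_neg_iff_divide_neg)
      ultimately show ?thesis by simp
    qed
  qed
  have "(\<integral>\<^sup>+v. \<integral>\<^sup>+t. G ([:- t, 1:] * Q - (\<Sum>i<m. Polynomial.smult ((v i)\<^sup>2) (R i))) \<partial>lborel \<partial>leb {..<m}) =
     (\<integral>\<^sup>+v. \<integral>\<^sup>+t. G (F t (\<lambda>i\<in>{..<m}. - ((v i)\<^sup>2))) \<partial>lborel \<partial>leb {..<m})"
  proof (rule nn_integral_cong)
    fix v :: "nat \<Rightarrow> real"
    have "(\<integral>\<^sup>+t. G (F t (\<lambda>i\<in>{..<m}. - ((v i)\<^sup>2))) \<partial>lborel) = (\<integral>\<^sup>+t. G (F (- t) (\<lambda>i\<in>{..<m}. - ((v i)\<^sup>2))) \<partial>lborel)"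
      using nn_integral_lborel_affine[of "\<lambda>t. G (F t (\<lambda>i\<in>{..<m}. - ((v i)\<^sup>2)))" "- 1" 0]
      by (simp add: measurable_compose[OF Fm G])
    moreover have "F (- t) (\<lambda>i\<in>{..<m}. - ((v i)\<^sup>2)) = [:- t, 1:] * Q - (\<Sum>i<m. Polynomial.smult ((v i)\<^sup>2) (R i))" for t
      by (simp add: F_def sum_negf)
    ultimately show "(\<integral>\<^sup>+t. G ([:- t, 1:] * Q - (\<Sum>i<m. Polynomial.smult ((v i)\<^sup>2) (R i))) \<partial>lborel) =
      (\<integral>\<^sup>+t. G (F t (\<lambda>i\<in>{..<m}. - ((v i)\<^sup>2))) \<partial>lborel)" by simp
  qed
  also have "\<dots> = (\<integral>\<^sup>+u. (\<Prod>i<m. neg_sqrt_density (u i)) * (\<integral>\<^sup>+t. G (F t u) \<partial>lborel) \<partial>leb {..<m})"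
    by (rule nn_integral_leb_coordinatewise[where h = "\<lambda>_ y. - (y\<^sup>2)" and r = "\<lambda>_. neg_sqrt_density"])
       (auto intro!: nn_integral_neg_square lborel.borel_measurable_nn_integral measurable_compose[OF Fm G] simp: split_beta')
  also have "\<dots> = (\<integral>\<^sup>+u. \<integral>\<^sup>+t. w (F t u) * G (F t u) \<partial>lborel \<partial>leb {..<m})"
    unfolding wF by (intro nn_integral_cong nn_integral_cmult[symmetric] measurable_compose[OF Fm G]) auto
  also have "\<dots> = (\<integral>\<^sup>+t. \<integral>\<^sup>+u. w (F t u) * G (F t u) \<partial>leb {..<m} \<partial>lborel)"
    by (rule leb_swap_lborel) (auto intro!: borel_measurable_times measurable_compose[OF Fm] simp: split_beta')
  finally have 1: "(\<integral>\<^sup>+v. \<integral>\<^sup>+t. G ([:- t, 1:] * Q - (\<Sum>i<m. Polynomial.smult ((v i)\<^sup>2) (R i))) \<partial>lborel \<partial>leb {..<m}) = \<dots>" .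
  define X where "X = (\<integral>\<^sup>+v. \<integral>\<^sup>+t. G ([:- t, 1:] * Q - (\<Sum>i<m. Polynomial.smult ((v i)\<^sup>2) (R i))) \<partial>lborel \<partial>leb {..<m})"
  define Y where "Y = (\<integral>\<^sup>+c. G (monic_poly (Suc m) c) * interlace_kernel m (monic_poly (Suc m) c) Q \<partial>leb {..<Suc m})"
  have "ennreal \<bar>vdm m d\<bar> * X = (\<integral>\<^sup>+t. ennreal \<bar>vdm m d\<bar> * (\<integral>\<^sup>+u. w (F t u) * G (F t u) \<partial>leb {..<m}) \<partial>lborel)"
    unfolding X_def 1
    by (rule nn_integral_cmult[symmetric])
      (auto intro!: borel_measurable_nn_integral_leb borel_measurable_times measurable_compose[OF Fm] simp: split_beta')
  also have "\<dots> = (\<integral>\<^sup>+t. \<integral>\<^sup>+c. w ([:t, 1:] * Q + (\<Sum>i<m. monom (c i) i)) * G ([:t, 1:] * Q + (\<Sum>i<m. monom (c i) i)) \<partial>leb {..<m} \<partial>lborel)"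
    unfolding F_def R_def
    by (intro nn_integral_cong nn_integral_lagrange[OF d(1), where G = "\<lambda>P. w P * G P"]) measurable
  also have "\<dots> = (\<integral>\<^sup>+c. w (pCons 0 Q + (\<Sum>i<Suc m. Polynomial.smult (c i) (if i < m then monom 1 i else Q))) *
      G (pCons 0 Q + (\<Sum>i<Suc m. Polynomial.smult (c i) (if i < m then monom 1 i else Q))) \<partial>leb {..<Suc m})"
  proof (subst nn_integral_leb_Suc(2))
    have "(\<Sum>i<Suc m. Polynomial.smult ((c(m := t)) i) (if i < m then monom 1 i else Q)) = (\<Sum>i<m. monom (c i) i) + Polynomial.smult t Q" for c and t :: real
      by (auto intro!: sum.cong simp: smult_monom)
    then have *: "pCons 0 Q + (\<Sum>i<Suc m. Polynomial.smult ((c(m := t)) i) (if i < m then monom 1 i else Q)) = [:t, 1:] * Q + (\<Sum>i<m. monom (c i) i)" for c and t :: real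
      by simp
    show "(\<integral>\<^sup>+t. \<integral>\<^sup>+c. w ([:t, 1:] * Q + (\<Sum>i<m. monom (c i) i)) * G ([:t, 1:] * Q + (\<Sum>i<m. monom (c i) i)) \<partial>leb {..<m} \<partial>lborel) =
      (\<integral>\<^sup>+t. \<integral>\<^sup>+c. w (pCons 0 Q + (\<Sum>i<Suc m. Polynomial.smult ((c(m := t)) i) (if i < m then monom 1 i else Q))) *
      G (pCons 0 Q + (\<Sum>i<Suc m. Polynomial.smult ((c(m := t)) i) (if i < m then monom 1 i else Q))) \<partial>leb {..<m} \<partial>lborel)"
      unfolding * ..
  qed measurable
  also have "\<dots> = (\<integral>\<^sup>+c. w (monic_poly (Suc m) c) * G (monic_poly (Suc m) c) \<partial>leb {..<Suc m})"
  proof -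
    \<comment> \<open>A graded monic basis up to degree m + 1: (x + t) Q is \<open>E (Suc m)\<close>
      plus \<open>t\<close> times \<open>E m\<close>.\<close>
    define E where "E = (\<lambda>i. if i < m then monom 1 i else if i = m then Q else pCons 0 Q)"
    have E: "degree (E i) = i \<and> lead_coeff (E i) = 1" if "i \<le> Suc m" for i
      using that Qm by (auto simp: E_def degree_monom_eq le_Suc_eq)
    have "E (Suc m) = pCons 0 Q" by (simp add: E_def)
    moreover have "(\<Sum>i<Suc m. Polynomial.smult (c i) (E i)) = (\<Sum>i<Suc m. Polynomial.smult (c i) (if i < m then monom 1 i else Q))" for c
      by (simp add: E_def)
    moreover have "(\<integral>\<^sup>+c. w (E (Suc m) + (\<Sum>i<Suc m. Polynomial.smult (c i) (E i))) * G (E (Suc m) + (\<Sum>i<Suc m. Polynomial.smult (c i) (E i))) \<partial>leb {..<Suc m}) =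
       (\<integral>\<^sup>+c. w (monic_poly (Suc m) c) * G (monic_poly (Suc m) c) \<partial>leb {..<Suc m})"
      by (rule nn_integral_monic_basis[where G = "\<lambda>P. w P * G P", OF E]) measurable
    ultimately show ?thesis by simp
  qed
  also have "\<dots> = ennreal \<bar>vdm m d\<bar> * Y"
    unfolding wk Y_def
    by (subst nn_integral_cmult[symmetric]) (measurable, simp only: mult_ac)
  finally have "ennreal \<bar>vdm m d\<bar> * X = ennreal \<bar>vdm m d\<bar> * Y" .
  then have "ennreal (1 / \<bar>vdm m d\<bar>) * (ennreal \<bar>vdm m d\<bar> * X) = ennreal (1 / \<bar>vdm m d\<bar>) * (ennreal \<bar>vdm m d\<bar> * Y)" by simp
  then have "X = Y" using v0 by (simp add: mult.assoc[symmetric] ennreal_mult[symmetric])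
  then show ?thesis unfolding X_def Y_def R_def .
qed

text \<open>The unnormalised Dirichlet density with all parameters 1/2 on m + 1 positive weights of
  sum 1, the last weight being eliminated.\<close>

definition dirichlet_density :: "nat \<Rightarrow> (nat \<Rightarrow> real) \<Rightarrow> ennreal" where
  "dirichlet_density m p = (if (\<forall>i\<in>{..<m}. p i > 0) \<and> (\<Sum>i<m. p i) < 1
     then ennreal ((\<Prod>i<m. 1 / sqrt (p i)) * (1 / sqrt (1 - (\<Sum>i<m. p i)))) else 0)"

text \<open>|Res P Q| is the double product of root differences, so it may be taken over the roots
  of either polynomial; \<open>interlace_iff\<close> does the same for the support.\<close>

lemma interlace_kernel_transpose:
  assumes P: "P \<in> real_simple (Suc m)" and Q: "Q \<in> monic_polys m"
  defines "l \<equiv> ordered_roots (Suc m) P"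
  shows "interlace_kernel m P Q = (if \<forall>i\<in>{..<Suc m}. poly Q (l i) * poly (pderiv P) (l i) > 0
    then ennreal (\<Prod>i<Suc m. 1 / sqrt \<bar>poly Q (l i)\<bar>) else 0)"
proof -
  have l: "root_poly {..<Suc m} l = P" using ordered_roots[OF P] by (simp add: l_def)
  have rl: "poly P x = 0 \<longleftrightarrow> x \<in> l ` {..<Suc m}" for x
    using poly_root_poly_eq_0[of "{..<Suc m}" l x] unfolding l by simp
  have iff: "Q \<in> real_simple m \<and> (\<forall>x. poly Q x = 0 \<longrightarrow> poly P x * poly (pderiv Q) x < 0) \<longleftrightarrow>
     (\<forall>i\<in>{..<Suc m}. poly Q (l i) * poly (pderiv P) (l i) > 0)"
    unfolding interlace_iff[OF real_simple_monic[OF P] Q] using P rl by auto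
  show ?thesis
  proof (cases "Q \<in> real_simple m")
    case True
    define d where "d = ordered_roots m Q"
    have d: "root_poly {..<m} d = Q" using ordered_roots[OF True] by (simp add: d_def)
    have rd: "poly Q x = 0 \<longleftrightarrow> x \<in> d ` {..<m}" for x
      using poly_root_poly_eq_0[of "{..<m}" d x] unfolding d by simp
    have "(\<Prod>i<m. sqrt \<bar>poly P (d i)\<bar>) = sqrt (\<Prod>i<m. \<Prod>j<Suc m. \<bar>d i - l j\<bar>)"
      unfolding l[symmetric] by (simp add: poly_root_poly abs_prod real_sqrt_prod del: prod.lessThan_Suc)
    also have "(\<Prod>i<m. \<Prod>j<Suc m. \<bar>d i - l j\<bar>) = (\<Prod>j<Suc m. \<Prod>i<m. \<bar>l j - d i\<bar>)"
      by (subst prod.swap) (simp only: abs_minus_commute)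
    also have "sqrt \<dots> = (\<Prod>j<Suc m. sqrt \<bar>poly Q (l j)\<bar>)"
      unfolding d[symmetric] by (simp add: poly_root_poly abs_prod real_sqrt_prod del: prod.lessThan_Suc)
    finally have "(\<Prod>i<m. 1 / sqrt \<bar>poly P (d i)\<bar>) = (\<Prod>i<Suc m. 1 / sqrt \<bar>poly Q (l i)\<bar>)"
      by (simp only: prod_dividef prod.neutral_const)
    then show ?thesis
      using iff True rd unfolding interlace_kernel_def d_def[symmetric] by auto
  next
    case False
    then show ?thesis using iff by (auto simp: interlace_kernel_def)
  qed
qed

lemma monic_poly_in_monic_polys: "monic_poly n c \<in> monic_polys n"
proof -
  have "coeff (monic_poly n c) i = (if i < n then c i else if i = n then 1 else 0)" for i
    by (simp add: monic_poly_def coeff_sum)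
  then show ?thesis
    by (auto simp: monic_polys_def intro!: antisym degree_le le_degree)
qed

text \<open>With weights p_i = Q(l_i) / P'(l_i) the polynomial \<open>Q\<close> is the sum of p_i P
  / (x - l_i). It is monic when the weights add up to 1, and interlacing means that they are
  positive. The factors |P'(l_i)|^(1/2) multiply to the Vandermonde product of \<open>l\<close>,
  which is also the Jacobian, so nothing depends on \<open>P\<close>.\<close>

lemma nn_integral_interlace_kernel:
  assumes P: "P \<in> real_simple (Suc m)"
  shows "(\<integral>\<^sup>+q. interlace_kernel m P (monic_poly m q) \<partial>leb {..<m}) = (\<integral>\<^sup>+p. dirichlet_density m p \<partial>leb {..<m})"
proof -
  define l where "l = ordered_roots (Suc m) P"
  have l: "inj_on l {..<Suc m}" "root_poly {..<Suc m} l = P"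
    using ordered_roots[OF P] by (auto simp: l_def strict_mono_on_inj_on_nat)
  have lm: "inj_on l {..<m}" using l(1) by (auto intro: inj_on_subset)
  define D where "D = (\<lambda>i. poly (root_poly ({..<Suc m} - {i}) l) (l i))"
  define R where "R = (\<lambda>i. root_poly ({..<m} - {i}) l)"
  define E where "E = root_poly {..<m} l"
  define g where "g = (\<lambda>Q. if \<forall>i\<in>{..<Suc m}. poly Q (l i) * D i > 0
    then ennreal (\<Prod>i<Suc m. 1 / sqrt \<bar>poly Q (l i)\<bar>) else 0)"
  have [measurable]: "g \<in> borel_measurable polyM" unfolding g_def by measurable
  have D: "poly (pderiv P) (l i) = D i" if "i < Suc m" for i
    using pderiv_root_poly[of "{..<Suc m}" i l] that l(2) by (simp add: D_def)
  have D0: "D i \<noteq> 0" if "i < Suc m" for i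
    unfolding D_def using that by (intro poly_root_poly_remove_ne l) auto
  have prodD: "(\<Prod>i<Suc m. \<bar>D i\<bar>) = (vdm (Suc m) l)\<^sup>2" unfolding D_def by (rule abs_vdm_square)
  have v0: "\<bar>vdm (Suc m) l\<bar> > 0" using vdm_nonzero[OF l(1)] by simp
  have ne: "l i - l m \<noteq> 0" if "i < m" for i using l(1) that by (auto simp: inj_on_def)
  have Di: "D i = (l i - l m) * poly (R i) (l i)" if "i < m" for i
  proof -
    have "{..<Suc m} - {i} = insert m ({..<m} - {i})" using that by auto
    then show ?thesis by (simp add: D_def R_def poly_root_poly)
  qed
  have Dm: "D m = poly E (l m)"
  proof -
    have "{..<Suc m} - {m} = {..<m}" by auto
    then show ?thesis by (simp add: D_def E_def)
  qed
  have RE: "poly (R i) (l m) * (l m - l i) = poly E (l m)" if "i < m" for i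
    unfolding E_def R_def using that by (subst root_poly_remove[of "{..<m}" i]) (auto simp: algebra_simps)
  \<comment> \<open>The combination with last weight 1 minus the others, using P / (x - l_m) = E and
    P / (x - l_i) = E + (l_i - l_m) R_i.\<close>
  define Qp where "Qp = (\<lambda>p. E + (\<Sum>i<m. Polynomial.smult (p i * (l i - l m)) (R i)))"
  have Qi: "poly (Qp p) (l i) = p i * D i" if "i < m" for p i
  proof -
    have "poly E (l i) = 0" unfolding E_def using that by (subst poly_root_poly_eq_0) auto
    then show ?thesis unfolding Qp_def R_def Di[OF that] poly_add
      using poly_lagrange_sum[OF that, of "\<lambda>i. p i * (l i - l m)" l] by simp
  qed
  have Qm: "poly (Qp p) (l m) = (1 - (\<Sum>i<m. p i)) * D m" for p
  proof -
    have "(\<Sum>i<m. p i * (l i - l m) * poly (R i) (l m)) = (\<Sum>i<m. - p i * poly E (l m))"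
      by (intro sum.cong refl) (simp add: RE[symmetric] algebra_simps)
    also have "\<dots> = - (\<Sum>i<m. p i) * poly E (l m)" by (simp add: sum_distrib_right sum_negf)
    finally show ?thesis by (simp add: Qp_def poly_sum Dm algebra_simps)
  qed
  have gQ: "ennreal \<bar>vdm (Suc m) l\<bar> * g (Qp p) = dirichlet_density m p" for p
  proof -
    have pos: "x * y * y > 0 \<longleftrightarrow> x > 0" if "y \<noteq> 0" for x y :: real
      using that by (metis mult.assoc mult_pos_pos not_real_square_gt_zero zero_less_mult_pos2)
    have "(\<forall>i\<in>{..<Suc m}. poly (Qp p) (l i) * D i > 0) \<longleftrightarrow> (\<forall>i\<in>{..<m}. p i > 0) \<and> (\<Sum>i<m. p i) < 1"
      using D0 by (auto simp: lessThan_Suc Qi Qm pos)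
    moreover have "\<bar>vdm (Suc m) l\<bar> * (\<Prod>i<Suc m. 1 / sqrt \<bar>poly (Qp p) (l i)\<bar>) = (\<Prod>i<m. 1 / sqrt (p i)) * (1 / sqrt (1 - (\<Sum>i<m. p i)))"
      if "(\<forall>i\<in>{..<m}. p i > 0) \<and> (\<Sum>i<m. p i) < 1"
    proof -
      have "(\<Prod>i<Suc m. 1 / sqrt \<bar>poly (Qp p) (l i)\<bar>) = (\<Prod>i<m. 1 / sqrt (p i) * (1 / sqrt \<bar>D i\<bar>)) * (1 / sqrt (1 - (\<Sum>i<m. p i)) * (1 / sqrt \<bar>D m\<bar>))"
        using that by (auto simp: Qi Qm abs_mult real_sqrt_mult abs_of_pos intro!: prod.cong)
      also have "\<dots> = ((\<Prod>i<m. 1 / sqrt (p i)) * (1 / sqrt (1 - (\<Sum>i<m. p i)))) * (\<Prod>i<Suc m. 1 / sqrt \<bar>D i\<bar>)"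
        by (simp only: prod.distrib prod.lessThan_Suc mult_ac)
      also have "(\<Prod>i<Suc m. 1 / sqrt \<bar>D i\<bar>) = 1 / sqrt (\<Prod>i<Suc m. \<bar>D i\<bar>)"
        by (simp only: prod_dividef prod.neutral_const real_sqrt_prod)
      also have "\<dots> = 1 / \<bar>vdm (Suc m) l\<bar>" by (simp only: prodD real_sqrt_abs)
      finally show ?thesis using v0 by simp
    qed
    ultimately show ?thesis
      unfolding g_def dirichlet_density_def
      by (auto simp: ennreal_mult'[symmetric] simp del: prod.lessThan_Suc)
  qed
  have "(\<integral>\<^sup>+q. interlace_kernel m P (monic_poly m q) \<partial>leb {..<m}) = (\<integral>\<^sup>+q. g (monic_poly m q) \<partial>leb {..<m})"
    unfolding interlace_kernel_transpose[OF P monic_poly_in_monic_polys] l_def[symmetric] g_def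
    by (intro nn_integral_cong if_cong refl) (simp add: D)
  also have "\<dots> = (\<integral>\<^sup>+q. g (E + (\<Sum>i<m. monom (q i) i)) \<partial>leb {..<m})"
  proof -
    have *: "degree ((if i < m then monom 1 i else E) :: real poly) = i \<and> lead_coeff ((if i < m then monom 1 i else E) :: real poly) = 1"
      if "i \<le> m" for i
      using that by (auto simp: degree_monom_eq E_def)
    from nn_integral_monic_basis[of m "\<lambda>i. if i < m then monom 1 i else E" g, OF *]
    show ?thesis by (simp add: smult_monom)
  qed
  also have "\<dots> = ennreal \<bar>vdm m l\<bar> * (\<integral>\<^sup>+u. g (E + (\<Sum>i<m. Polynomial.smult (u i) (R i))) \<partial>leb {..<m})"
    unfolding R_def by (rule nn_integral_lagrange[symmetric, OF lm]) measurable
  also have "(\<integral>\<^sup>+u. g (E + (\<Sum>i<m. Polynomial.smult (u i) (R i))) \<partial>leb {..<m}) =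
     ennreal \<bar>\<Prod>i<m. l i - l m\<bar> * (\<integral>\<^sup>+p. g (Qp p) \<partial>leb {..<m})"
  proof -
    have *: "(\<lambda>u. g (E + (\<Sum>i<m. Polynomial.smult (u i) (R i)))) \<in> borel_measurable (leb {..<m})"
      by measurable
    show ?thesis
      using nn_integral_leb_affine[of "{..<m}" "\<lambda>i. l i - l m" _ "\<lambda>_. 0", OF _ _ *] ne
      by (simp add: Qp_def mult.commute)
  qed
  \<comment> \<open>The Lagrange Jacobian times the rescaling is the Vandermonde product of all m +
    1 roots.\<close>
  also have "ennreal \<bar>vdm m l\<bar> * (ennreal \<bar>\<Prod>i<m. l i - l m\<bar> * (\<integral>\<^sup>+p. g (Qp p) \<partial>leb {..<m})) =
     ennreal \<bar>vdm (Suc m) l\<bar> * (\<integral>\<^sup>+p. g (Qp p) \<partial>leb {..<m})"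
    by (simp add: vdm_Suc abs_mult abs_prod abs_minus_commute ennreal_mult prod_nonneg mult.assoc)
  also have "\<dots> = (\<integral>\<^sup>+p. dirichlet_density m p \<partial>leb {..<m})"
    unfolding gQ[symmetric] by (rule nn_integral_cmult[symmetric]) (simp add: Qp_def)
  finally show ?thesis .
qed

lemma interlace_kernel_eq_0:
  assumes "P \<in> monic_polys (Suc m)" "P \<notin> real_simple (Suc m)" "Q \<in> monic_polys m"
  shows "interlace_kernel m P Q = 0"
proof -
  have "poly Q x = 0 \<longleftrightarrow> x \<in> ordered_roots m Q ` {..<m}" if "Q \<in> real_simple m" for x
    using poly_root_poly_eq_0[of "{..<m}" "ordered_roots m Q" x] unfolding ordered_roots(2)[OF that] by simp
  then show ?thesis
    using interlace_iff[OF assms(1,3)] assms(2) by (auto simp: interlace_kernel_def)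
qed

subsection \<open>Characteristic polynomials of symmetric matrices\<close>

text \<open>Eigenvectors of a symmetric matrix for distinct eigenvalues are orthogonal, so m
  distinct roots of the characteristic polynomial already give an orthonormal basis. Row
  \<open>i\<close> of \<open>R\<close> is the i-th unit eigenvector.\<close>

lemma symmetric_eigenbasis:
  fixes B :: "real mat"
  assumes B: "B \<in> carrier_mat m m" and sym: "\<And>i j. i < m \<Longrightarrow> j < m \<Longrightarrow> B $$ (i, j) = B $$ (j, i)"
    and simple: "char_poly B \<in> real_simple m"
  defines "d \<equiv> ordered_roots m (char_poly B)"
  obtains R where "\<And>i j. i < m \<Longrightarrow> j < m \<Longrightarrow> (\<Sum>k<m. R i k * R j k) = (if i = j then 1 else 0)"
    and "\<And>i j. i < m \<Longrightarrow> j < m \<Longrightarrow> (\<Sum>k<m. R k i * R k j) = (if i = j then 1 else 0)"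
    and "\<And>i j. i < m \<Longrightarrow> j < m \<Longrightarrow> (\<Sum>k<m. B $$ (j, k) * R i k) = d i * R i j"
proof -
  have d: "inj_on d {..<m}" "root_poly {..<m} d = char_poly B"
    using ordered_roots[OF simple] by (auto simp: d_def strict_mono_on_inj_on_nat)
  have "\<exists>v. eigenvector B v (d i)" if "i < m" for i
  proof -
    have "poly (char_poly B) (d i) = 0" using poly_root_poly_eq_0[of "{..<m}" d "d i"] d(2) that by auto
    then show ?thesis using eigenvalue_root_char_poly[OF B] by (simp add: eigenvalue_def)
  qed
  then obtain e where e: "\<And>i. i < m \<Longrightarrow> eigenvector B (e i) (d i)" by metis
  define E where "E = (\<lambda>i k. e i $ k)"
  have ec: "e i \<in> carrier_vec m" if "i < m" for i using e[OF that] B by (auto simp: eigenvector_def)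
  have eig: "(\<Sum>k<m. B $$ (j, k) * E i k) = d i * E i j" if "i < m" "j < m" for i j
  proof -
    have "(B *\<^sub>v e i) $ j = (d i \<cdot>\<^sub>v e i) $ j" using e[OF that(1)] by (simp add: eigenvector_def)
    then show ?thesis using that B ec[OF that(1)]
      by (simp add: scalar_prod_def E_def atLeast0LessThan)
  qed
  have pos: "(\<Sum>k<m. E i k * E i k) > 0" if "i < m" for i
  proof -
    have "\<exists>k<m. E i k \<noteq> 0"
    proof (rule ccontr)
      assume "\<not> (\<exists>k<m. E i k \<noteq> 0)"
      then have "e i = 0\<^sub>v m" using ec[OF that] by (intro eq_vecI) (auto simp: E_def)
      then show False using e[OF that] B by (auto simp: eigenvector_def)
    qed
    then obtain k where k: "k < m" "E i k \<noteq> 0" by blast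
    show ?thesis
      by (rule sum_pos2[of _ k]) (use k in \<open>auto simp: zero_less_mult_iff linorder_neq_iff\<close>)
  qed
  have orth: "(\<Sum>k<m. E i k * E j k) = 0" if "i < m" "j < m" "i \<noteq> j" for i j
  proof -
    have "d i * (\<Sum>k<m. E i k * E j k) = (\<Sum>k<m. (\<Sum>l<m. B $$ (k, l) * E i l) * E j k)"
      unfolding sum_distrib_left by (intro sum.cong refl) (use eig that in simp)
    also have "\<dots> = (\<Sum>k<m. \<Sum>l<m. B $$ (l, k) * E i l * E j k)"
      unfolding sum_distrib_right by (intro sum.cong refl) (use sym in auto)
    also have "\<dots> = (\<Sum>l<m. (\<Sum>k<m. B $$ (l, k) * E j k) * E i l)"
      by (subst sum.swap) (simp add: sum_distrib_right sum_distrib_left mult_ac)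
    also have "\<dots> = d j * (\<Sum>k<m. E i k * E j k)"
      unfolding sum_distrib_left by (intro sum.cong refl) (use eig that in simp)
    finally have "(d i - d j) * (\<Sum>k<m. E i k * E j k) = 0" by (simp add: algebra_simps)
    moreover have "d i \<noteq> d j" using d(1) that by (auto simp: inj_on_def)
    ultimately show ?thesis by simp
  qed
  define r where "r = (\<lambda>i. sqrt (\<Sum>k<m. E i k * E i k))"
  define R where "R = (\<lambda>i k. E i k / r i)"
  have r: "r i > 0" "r i * r i = (\<Sum>k<m. E i k * E i k)" if "i < m" for i
    using pos[OF that] by (auto simp: r_def)
  have rows: "(\<Sum>k<m. R i k * R j k) = (if i = j then 1 else 0)" if "i < m" "j < m" for i j
  proof -
    have "(\<Sum>k<m. R i k * R j k) = (\<Sum>k<m. E i k * E j k) / (r i * r j)"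
      by (simp add: R_def sum_divide_distrib)
    then show ?thesis using that orth[of i j] r[of i] by auto
  qed
  define M where "M = mat m m (\<lambda>(i, j). R i j)"
  have M: "M \<in> carrier_mat m m" by (simp add: M_def)
  have "M * transpose_mat M = 1\<^sub>m m"
    by (rule eq_matI) (auto simp: M_def scalar_prod_def atLeast0LessThan rows)
  then have "transpose_mat M * M = 1\<^sub>m m"
    by (intro mat_mult_left_right_inverse[OF M]) (use M in auto)
  moreover have "(transpose_mat M * M) $$ (i, j) = (\<Sum>k<m. R k i * R k j)" if "i < m" "j < m" for i j
    using that by (simp add: M_def scalar_prod_def atLeast0LessThan)
  ultimately have cols: "(\<Sum>k<m. R k i * R k j) = (if i = j then 1 else 0)" if "i < m" "j < m" for i j
    using that by (metis index_one_mat(1))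
  have "(\<Sum>k<m. B $$ (j, k) * R i k) = d i * R i j" if "i < m" "j < m" for i j
    using eig[OF that] by (simp add: R_def sum_divide_distrib[symmetric])
  with rows cols that show thesis by blast
qed

section \<open>Bordered symmetric matrices\<close>

definition bordered_mat :: "nat \<Rightarrow> real mat \<Rightarrow> (nat \<Rightarrow> real) \<Rightarrow> real \<Rightarrow> real mat" where
  "bordered_mat m B v a = four_block_mat B (mat m 1 (\<lambda>(i, _). v i)) (mat 1 m (\<lambda>(_, j). v j)) (mat 1 1 (\<lambda>_. a))"

text \<open>The Schur complement: away from the eigenvalues of \<open>B\<close> the determinant is
  det (x - B) times x - a - v^T (x - B)^(-1) v, and in the eigenbasis the quadratic form is a sum of
  squares over x - d_i. Both sides are polynomials, so agreement off a finite set suffices.\<close>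

lemma char_poly_bordered:
  fixes B :: "real mat"
  assumes B: "B \<in> carrier_mat m m" and d: "char_poly B = root_poly {..<m} d"
    and cols: "\<And>i j. i < m \<Longrightarrow> j < m \<Longrightarrow> (\<Sum>k<m. R k i * R k j) = (if i = j then 1 else 0)"
    and eig: "\<And>i j. i < m \<Longrightarrow> j < m \<Longrightarrow> (\<Sum>k<m. B $$ (j, k) * R i k) = d i * R i j"
  shows "char_poly (bordered_mat m B v a) = [:- a, 1:] * char_poly B -
     (\<Sum>i<m. Polynomial.smult ((\<Sum>j<m. R i j * v j)\<^sup>2) (root_poly ({..<m} - {i}) d))" (is "?P = ?Q")
proof -
  have A: "bordered_mat m B v a \<in> carrier_mat (m + 1) (m + 1)"
    unfolding bordered_mat_def using B by (intro four_block_carrier_mat) auto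
  have eval: "poly ?P x = poly ?Q x" if x: "x \<notin> d ` {..<m}" for x
  proof -
    have xd: "x - d i \<noteq> 0" if "i < m" for i using x that by auto
    define X where "X = - char_matrix B x"
    define c where "c = (\<lambda>i. \<Sum>j<m. R i j * v j)"
    \<comment> \<open>\<open>y\<close> is (x - B)^(-1) v, written in the eigenbasis.\<close>
    define y where "y = (\<lambda>k. \<Sum>i<m. c i / (x - d i) * R i k)"
    have X: "X \<in> carrier_mat m m" using B by (simp add: X_def char_matrix_def)
    have Xij: "X $$ (i, j) = (if i = j then x else 0) - B $$ (i, j)" if "i < m" "j < m" for i j
      using B that by (simp add: X_def char_matrix_def)
    define M where "M = four_block_mat X (mat m 1 (\<lambda>(i, _). - v i)) (mat 1 m (\<lambda>(_, j). - v j)) (mat 1 1 (\<lambda>_. x - a))"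
    \<comment> \<open>A unipotent column operation that clears the upper right block and leaves the
      Schur complement \<open>z\<close> in the corner.\<close>
    define Y where "Y = four_block_mat (1\<^sub>m m) (mat m 1 (\<lambda>(i, _). y i)) (0\<^sub>m 1 m) (1\<^sub>m 1 :: real mat)"
    have M: "- char_matrix (bordered_mat m B v a) x = M"
      by (rule eq_matI) (use B X in \<open>auto simp: M_def bordered_mat_def char_matrix_def X_def four_block_mat_def Let_def\<close>)
    have Xy: "(\<Sum>k<m. X $$ (j, k) * y k) = v j" if j: "j < m" for j
    proof -
      have "(\<Sum>k<m. X $$ (j, k) * y k) = (\<Sum>k<m. (if j = k then x * y k else 0)) - (\<Sum>k<m. B $$ (j, k) * y k)"
        unfolding sum_subtractf[symmetric] using j by (intro sum.cong) (auto simp: Xij algebra_simps)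
      also have "(\<Sum>k<m. (if j = k then x * y k else 0)) = (\<Sum>i<m. c i / (x - d i) * (x * R i j))"
        using j by (simp add: y_def sum_distrib_left mult_ac)
      also have "(\<Sum>k<m. B $$ (j, k) * y k) = (\<Sum>i<m. c i / (x - d i) * (\<Sum>k<m. B $$ (j, k) * R i k))"
        unfolding y_def sum_distrib_left by (subst sum.swap) (simp add: mult_ac)
      also have "\<dots> = (\<Sum>i<m. c i / (x - d i) * (d i * R i j))"
        using eig j by simp
      also have "(\<Sum>i<m. c i / (x - d i) * (x * R i j)) - (\<Sum>i<m. c i / (x - d i) * (d i * R i j)) = (\<Sum>i<m. c i * R i j)"
        unfolding sum_subtractf[symmetric]
      proof (intro sum.cong refl)
        fix i assume "i \<in> {..<m}"
        have "c i / (x - d i) * (x * R i j) - c i / (x - d i) * (d i * R i j) = c i / (x - d i) * ((x - d i) * R i j)"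
          by (simp only: left_diff_distrib right_diff_distrib)
        then show "c i / (x - d i) * (x * R i j) - c i / (x - d i) * (d i * R i j) = c i * R i j"
          using xd[of i] \<open>i \<in> {..<m}\<close> by simp
      qed
      also have "\<dots> = (\<Sum>k<m. (\<Sum>i<m. R i j * R i k) * v k)"
        unfolding c_def sum_distrib_right by (subst sum.swap) (simp add: mult_ac)
      also have "\<dots> = v j" using j cols by (simp add: if_distrib[of "\<lambda>c. c * _"] cong: if_cong)
      finally show ?thesis .
    qed
    define z where "z = x - a - (\<Sum>k<m. v k * y k)"
    have MY: "M * Y = four_block_mat X (0\<^sub>m m 1) (mat 1 m (\<lambda>(_, j). - v j)) (mat 1 1 (\<lambda>_. z))"
    proof -
      have 1: "X * 1\<^sub>m m + mat m 1 (\<lambda>(i, _). - v i) * 0\<^sub>m 1 m = X" using X by auto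
      have 2: "X * mat m 1 (\<lambda>(i, _). y i) + mat m 1 (\<lambda>(i, _). - v i) * 1\<^sub>m 1 = 0\<^sub>m m 1"
        by (rule eq_matI) (use X Xy in \<open>auto simp: scalar_prod_def atLeast0LessThan\<close>)
      have 3: "mat 1 m (\<lambda>(_, j). - v j) * 1\<^sub>m m + mat 1 1 (\<lambda>_. x - a) * 0\<^sub>m 1 m = mat 1 m (\<lambda>(_, j). - v j)"
        by (rule eq_matI) auto
      have 4: "mat 1 m (\<lambda>(_, j). - v j) * mat m 1 (\<lambda>(i, _). y i) + mat 1 1 (\<lambda>_. x - a) * 1\<^sub>m 1 = mat 1 1 (\<lambda>_. z)"
        by (rule eq_matI) (auto simp: scalar_prod_def atLeast0LessThan z_def sum_negf)
      have "M * Y = four_block_mat (X * 1\<^sub>m m + mat m 1 (\<lambda>(i, _). - v i) * 0\<^sub>m 1 m)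
          (X * mat m 1 (\<lambda>(i, _). y i) + mat m 1 (\<lambda>(i, _). - v i) * 1\<^sub>m 1)
          (mat 1 m (\<lambda>(_, j). - v j) * 1\<^sub>m m + mat 1 1 (\<lambda>_. x - a) * 0\<^sub>m 1 m)
          (mat 1 m (\<lambda>(_, j). - v j) * mat m 1 (\<lambda>(i, _). y i) + mat 1 1 (\<lambda>_. x - a) * 1\<^sub>m 1)"
        unfolding M_def Y_def by (rule mult_four_block_mat) (use X in auto)
      then show ?thesis unfolding 1 2 3 4 .
    qed
    have "det Y = 1" unfolding Y_def by (subst det_four_block_mat_lower_left_zero[of _ m _ 1]) auto
    then have "det M = det (M * Y)"
      by (subst det_mult[of _ "m + 1"]) (use X in \<open>auto simp: M_def Y_def\<close>)
    also have "\<dots> = det X * z"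
      unfolding MY by (subst det_four_block_mat_upper_right_zero[of _ m _ 1]) (use X in \<open>auto simp: det_single\<close>)
    finally have "poly ?P x = det X * z"
      using char_poly_matrix[OF A, of x] M by simp
    also have "det X = poly (char_poly B) x" using char_poly_matrix[OF B, of x] by (simp add: X_def)
    also have "(\<Sum>k<m. v k * y k) = (\<Sum>i<m. c i / (x - d i) * (\<Sum>k<m. R i k * v k))"
      unfolding y_def sum_distrib_left by (subst sum.swap) (simp add: mult_ac)
    then have "z = x - a - (\<Sum>i<m. (c i)\<^sup>2 / (x - d i))"
      by (simp add: z_def c_def power2_eq_square)
    also have "poly (char_poly B) x * (x - a - (\<Sum>i<m. (c i)\<^sup>2 / (x - d i))) =
      (x - a) * poly (char_poly B) x - (\<Sum>i<m. (c i)\<^sup>2 * poly (root_poly ({..<m} - {i}) d) x)"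
    proof -
      have "poly (char_poly B) x * (\<Sum>i<m. (c i)\<^sup>2 / (x - d i)) = (\<Sum>i<m. (c i)\<^sup>2 * poly (root_poly ({..<m} - {i}) d) x)"
        unfolding sum_distrib_left
      proof (intro sum.cong refl)
        fix i assume i: "i \<in> {..<m}"
        have "poly (char_poly B) x = (x - d i) * poly (root_poly ({..<m} - {i}) d) x"
          unfolding d using i by (subst root_poly_remove[of _ i]) (auto simp: algebra_simps)
        then show "poly (char_poly B) x * ((c i)\<^sup>2 / (x - d i)) = (c i)\<^sup>2 * poly (root_poly ({..<m} - {i}) d) x"
          using xd i by auto
      qed
      then show ?thesis by (simp add: algebra_simps)
    qed
    finally show ?thesis by (simp add: poly_sum c_def algebra_simps)
  qed
  have "?P - ?Q = 0"
  proof (rule ccontr)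
    assume "?P - ?Q \<noteq> 0"
    then have "finite {x. poly (?P - ?Q) x = 0}" by (rule poly_roots_finite)
    moreover have "- d ` {..<m} \<subseteq> {x. poly (?P - ?Q) x = 0}" using eval by auto
    ultimately have "finite (- d ` {..<m})" by (rule finite_subset[rotated])
    then have "finite (UNIV :: real set)" by (metis Compl_partition finite_Un finite_imageI finite_lessThan)
    then show False using infinite_UNIV_char_0 by blast
  qed
  then show ?thesis by simp
qed

text \<open>Only the first \<open>k\<close> entries of column \<open>m\<close> are filled, as an
  intermediate state of an induction that adds one coordinate at a time; k = m + 1 includes the
  diagonal entry.\<close>

definition border_entries :: "nat \<Rightarrow> nat \<Rightarrow> (nat \<times> nat \<Rightarrow> real) \<Rightarrow> (nat \<Rightarrow> real) \<Rightarrow> nat \<times> nat \<Rightarrow> real" where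
  "border_entries m k a v = (\<lambda>(i, j). if j = m \<and> i < k then v i else a (i, j))"

lemma finite_upper_indices [simp]: "finite (upper_indices n)"
  by (rule finite_subset[of _ "{..<n} \<times> {..<n}"]) (auto simp: upper_indices_def)

text \<open>Measurability of the gluing map is proved together with the integral identity, since
  each step of the identity relies on it.\<close>

lemma nn_integral_border_entries:
  assumes "f \<in> borel_measurable (leb (upper_indices m \<union> (\<lambda>i. (i, m)) ` {..<k}))"
  shows "(\<integral>\<^sup>+x. f x \<partial>leb (upper_indices m \<union> (\<lambda>i. (i, m)) ` {..<k})) =
     (\<integral>\<^sup>+a. \<integral>\<^sup>+v. f (border_entries m k a v) \<partial>leb {..<k} \<partial>leb (upper_indices m)) \<and>
     (\<lambda>(a, v). border_entries m k a v) \<in> measurable (leb (upper_indices m) \<Otimes>\<^sub>M leb {..<k}) (leb (upper_indices m \<union> (\<lambda>i. (i, m)) ` {..<k}))"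
  using assms
proof (induction k arbitrary: f)
  case 0
  have "border_entries m 0 a v = a" for a v by (auto simp: border_entries_def)
  then show ?case by (simp add: PiM_empty nn_integral_count_space_finite)
next
  case (Suc k)
  let ?I = "upper_indices m \<union> (\<lambda>i. (i, m)) ` {..<k}"
  have I: "upper_indices m \<union> (\<lambda>i. (i, m)) ` {..<Suc k} = insert (k, m) ?I" by (auto simp: lessThan_Suc)
  have fin: "finite ?I" by simp
  have notin: "(k, m) \<notin> ?I" by (auto simp: upper_indices_def)
  have b: "(border_entries m k a v)((k, m) := y) = border_entries m (Suc k) a (v(k := y))" for a v y
    by (auto simp: border_entries_def fun_eq_iff less_Suc_eq)
  note [measurable] = Suc.prems[unfolded I]
  have m0: "(\<lambda>(a, v). border_entries m k a v) \<in> measurable (leb (upper_indices m) \<Otimes>\<^sub>M leb {..<k}) (leb ?I)"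
    using Suc.IH[of "\<lambda>_. 0"] by simp
  have m1: "(\<lambda>(a, v). border_entries m (Suc k) a v) \<in> measurable (leb (upper_indices m) \<Otimes>\<^sub>M leb {..<Suc k}) (leb (insert (k, m) ?I))"
  proof -
    have r: "(\<lambda>(a, v). (a, restrict v {..<k})) \<in> measurable (leb (upper_indices m) \<Otimes>\<^sub>M leb {..<Suc k}) (leb (upper_indices m) \<Otimes>\<^sub>M leb {..<k})"
      unfolding split_beta' by (intro measurable_Pair measurable_fst measurable_lebI measurable_compose[OF measurable_snd measurable_leb_coordinate])
    have "(\<lambda>z. (border_entries m k (fst z) (restrict (snd z) {..<k}))((k, m) := snd z k)) \<in> measurable (leb (upper_indices m) \<Otimes>\<^sub>M leb {..<Suc k}) (leb (insert (k, m) ?I))"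
      using measurable_compose[OF r m0]
      by (intro measurable_leb_fun_upd measurable_compose[OF measurable_snd measurable_leb_coordinate]) (simp add: split_beta')
    moreover have "(border_entries m k a (restrict v {..<k}))((k, m) := v k) = border_entries m (Suc k) a v" for a v
      by (auto simp: border_entries_def fun_eq_iff less_Suc_eq)
    ultimately show ?thesis by (simp add: split_beta')
  qed
  have "(\<integral>\<^sup>+x. f x \<partial>leb (insert (k, m) ?I)) = (\<integral>\<^sup>+x. \<integral>\<^sup>+y. f (x((k, m) := y)) \<partial>lborel \<partial>leb ?I)"
    by (rule nn_integral_leb_insert(1)[OF fin notin]) measurable
  also have "\<dots> = (\<integral>\<^sup>+a. \<integral>\<^sup>+v. \<integral>\<^sup>+y. f (border_entries m (Suc k) a (v(k := y))) \<partial>lborel \<partial>leb {..<k} \<partial>leb (upper_indices m))"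
    by (subst Suc.IH[THEN conjunct1]) (measurable, simp only: b)
  also have "\<dots> = (\<integral>\<^sup>+a. \<integral>\<^sup>+v. f (border_entries m (Suc k) a v) \<partial>leb {..<Suc k} \<partial>leb (upper_indices m))"
  proof (rule nn_integral_cong)
    fix a assume a: "a \<in> space (leb (upper_indices m))"
    have "(\<lambda>v. f (border_entries m (Suc k) a v)) \<in> borel_measurable (leb {..<Suc k})"
      using measurable_compose[OF measurable_compose[OF measurable_Pair1'[OF a] m1] Suc.prems[unfolded I]] by simp
    then show "(\<integral>\<^sup>+v. \<integral>\<^sup>+y. f (border_entries m (Suc k) a (v(k := y))) \<partial>lborel \<partial>leb {..<k}) =
        (\<integral>\<^sup>+v. f (border_entries m (Suc k) a v) \<partial>leb {..<Suc k})"
      by (rule nn_integral_leb_Suc(1)[symmetric])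
  qed
  finally show ?case using m1 unfolding I by blast
qed

lemma upper_indices_Suc: "upper_indices (Suc m) = upper_indices m \<union> (\<lambda>i. (i, m)) ` {..<Suc m}"
  by (auto simp: upper_indices_def less_Suc_eq image_iff)

lemma sym_mat_of_border_entries:
  "sym_mat_of (Suc m) (border_entries m (Suc m) a (v(m := t))) = bordered_mat m (sym_mat_of m a) v t"
  by (rule eq_matI) (auto simp: sym_mat_of_def bordered_mat_def border_entries_def four_block_mat_def Let_def min_def max_def less_Suc_eq)

lemma sym_mat_of_carrier [simp]: "sym_mat_of n a \<in> carrier_mat n n"
  by (simp add: sym_mat_of_def)

section \<open>The law of the characteristic polynomial\<close>

lemma measurable_char_poly_sym_mat_of:
  "(\<lambda>a. char_poly (sym_mat_of n a)) \<in> measurable (leb (upper_indices n)) polyM"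
proof -
  have *: "char_poly (sym_mat_of n a) = (\<Sum>p | p permutes {0..<n}. of_int (sign p) *
     (\<Prod>i = 0..<n. (if i = p i then [:0, 1:] else 0) + [:- a (min i (p i), max i (p i)):]))" for a
  proof -
    have "char_poly_matrix (sym_mat_of n a) $$ (i, j) = (if i = j then [:0, 1:] else 0) + [:- a (min i j, max i j):]"
      if "i < n" "j < n" for i j using that by (simp add: char_poly_matrix_def sym_mat_of_def)
    then show ?thesis
      unfolding char_poly_def det_def
      by (auto simp: char_poly_matrix_def sym_mat_of_def intro!: sum.cong prod.cong arg_cong2[where f = "(*)"] dest: permutes_in_image[of _ "{0..<n}"])
  qed
  have m: "(\<lambda>a. - a (min i j, max i j)) \<in> borel_measurable (leb (upper_indices n))" for i j
    using measurable_leb_coordinate[of "(min i j, max i j)"] by simp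
  show ?thesis
    unfolding * by (intro measurable_poly_sum measurable_poly_mult measurable_poly_prod measurable_poly_add measurable_polyM_const measurable_pCons m)
qed

text \<open>Testing the law with the indicator of the complement gives 0, in \<open>ennreal\<close>
  even for infinite \<open>C\<close>. This makes a simple spectrum available to the next induction
  step.\<close>

lemma AE_real_simple_of_distribution:
  assumes C: "\<And>G. G \<in> borel_measurable polyM \<Longrightarrow>
     (\<integral>\<^sup>+a. G (char_poly (sym_mat_of n a)) \<partial>leb (upper_indices n)) =
     C * (\<integral>\<^sup>+c. G (monic_poly n c) * indicator (real_simple n) (monic_poly n c) \<partial>leb {..<n})"
  shows "AE a in leb (upper_indices n). char_poly (sym_mat_of n a) \<in> real_simple n"
proof -
  have c: "- real_simple n \<in> sets polyM" using measurable_real_simple[of n] by (metis Compl_eq_Diff_UNIV sets.compl_sets space_polyM)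
  have ind: "indicator (- real_simple n) p * indicator (real_simple n) p = (0 :: ennreal)" for p
    by (auto split: split_indicator)
  have "(\<integral>\<^sup>+a. indicator (- real_simple n) (char_poly (sym_mat_of n a)) \<partial>leb (upper_indices n)) = 0"
    using C[of "indicator (- real_simple n)"] c unfolding ind by simp
  then have "AE a in leb (upper_indices n). indicator (- real_simple n) (char_poly (sym_mat_of n a)) = (0 :: ennreal)"
    by (subst (asm) nn_integral_0_iff_AE)
      (rule measurable_compose[OF measurable_char_poly_sym_mat_of borel_measurable_indicator[OF c]])
  then show ?thesis by eventually_elim (auto split: split_indicator_asm)
qed

text \<open>\<open>C\<close> is only claimed to exist in \<open>ennreal\<close>; each step
  multiplies it by the Dirichlet integral \<open>K\<close>. That it is finite and nonzero follows at
  the end from total mass 1.\<close>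

lemma char_poly_distribution:
  "\<exists>C :: ennreal. \<forall>G\<in>borel_measurable polyM.
     (\<integral>\<^sup>+a. G (char_poly (sym_mat_of n a)) \<partial>leb (upper_indices n)) =
     C * (\<integral>\<^sup>+c. G (monic_poly n c) * indicator (real_simple n) (monic_poly n c) \<partial>leb {..<n})"
proof (induction n)
  case 0
  have u: "upper_indices 0 = {}" by (auto simp: upper_indices_def)
  have "monic_poly 0 c \<in> real_simple 0" for c
    by (auto simp: monic_poly_def real_simple_def root_poly_def strict_mono_on_def monom_0)
  moreover have "char_poly (sym_mat_of 0 a) = monic_poly 0 (\<lambda>_. undefined)" for a
  proof -
    have "degree (char_poly (sym_mat_of 0 a)) = 0 \<and> coeff (char_poly (sym_mat_of 0 a)) 0 = 1"
      using degree_monic_char_poly[OF sym_mat_of_carrier[of 0 a]] .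
    then show ?thesis by (auto simp: monic_poly_def monom_0 elim!: degree_eq_zeroE)
  qed
  ultimately show ?case
    by (intro exI[of _ 1] ballI) (simp add: u PiM_empty nn_integral_count_space_finite)
next
  case (Suc m)
  then obtain C where C: "\<And>G. G \<in> borel_measurable polyM \<Longrightarrow>
     (\<integral>\<^sup>+a. G (char_poly (sym_mat_of m a)) \<partial>leb (upper_indices m)) =
     C * (\<integral>\<^sup>+c. G (monic_poly m c) * indicator (real_simple m) (monic_poly m c) \<partial>leb {..<m})" by blast
  note [measurable] = measurable_char_poly_sym_mat_of
  have AE: "AE a in leb (upper_indices m). char_poly (sym_mat_of m a) \<in> real_simple m"
    by (rule AE_real_simple_of_distribution[OF C])
  define K where "K = (\<integral>\<^sup>+p. dirichlet_density m p \<partial>leb {..<m})"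
  show ?case
  proof (intro exI[of _ "C * K"] ballI)
    fix G :: "real poly \<Rightarrow> ennreal" assume G [measurable]: "G \<in> borel_measurable polyM"
    define H where "H = (\<lambda>Q. \<integral>\<^sup>+c. G (monic_poly (Suc m) c) * interlace_kernel m (monic_poly (Suc m) c) Q \<partial>leb {..<Suc m})"
    have H [measurable]: "H \<in> borel_measurable polyM" unfolding H_def by measurable
    let ?f = "\<lambda>x. G (char_poly (sym_mat_of (Suc m) x))"
    have f: "?f \<in> borel_measurable (leb (upper_indices m \<union> (\<lambda>i. (i, m)) ` {..<Suc m}))"
      using measurable_compose[OF measurable_char_poly_sym_mat_of[of "Suc m"] G] unfolding upper_indices_Suc .
    have "(\<integral>\<^sup>+x. ?f x \<partial>leb (upper_indices (Suc m))) =
       (\<integral>\<^sup>+a. \<integral>\<^sup>+v. ?f (border_entries m (Suc m) a v) \<partial>leb {..<Suc m} \<partial>leb (upper_indices m))"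
      unfolding upper_indices_Suc using nn_integral_border_entries[OF f] by blast
    also have "\<dots> = (\<integral>\<^sup>+a. H (char_poly (sym_mat_of m a)) \<partial>leb (upper_indices m))"
      using AE AE_space
    proof (intro nn_integral_cong_AE, eventually_elim)
      fix a assume simple: "char_poly (sym_mat_of m a) \<in> real_simple m" and a: "a \<in> space (leb (upper_indices m))"
      define B where "B = sym_mat_of m a"
      define d where "d = ordered_roots m (char_poly B)"
      have B: "B \<in> carrier_mat m m" and sym: "\<And>i j. i < m \<Longrightarrow> j < m \<Longrightarrow> B $$ (i, j) = B $$ (j, i)"
        by (auto simp: B_def sym_mat_of_def min.commute max.commute)
      have d: "char_poly B = root_poly {..<m} d" using ordered_roots(2)[OF simple] by (simp add: B_def d_def)
      obtain R where R: "\<And>i j. i < m \<Longrightarrow> j < m \<Longrightarrow> (\<Sum>k<m. R i k * R j k) = (if i = j then 1 else 0)"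
        "\<And>i j. i < m \<Longrightarrow> j < m \<Longrightarrow> (\<Sum>k<m. R k i * R k j) = (if i = j then 1 else 0)"
        "\<And>i j. i < m \<Longrightarrow> j < m \<Longrightarrow> (\<Sum>k<m. B $$ (j, k) * R i k) = d i * R i j"
        using symmetric_eigenbasis[OF B sym simple[folded B_def]] unfolding d_def by blast
      have m1: "(\<lambda>v. ?f (border_entries m (Suc m) a v)) \<in> borel_measurable (leb {..<Suc m})"
        using measurable_compose[OF measurable_compose[OF measurable_Pair1'[OF a] nn_integral_border_entries[OF f, THEN conjunct2]] f] by simp
      define \<Phi> where "\<Phi> = (\<lambda>u. \<integral>\<^sup>+t. G ([:- t, 1:] * char_poly B - (\<Sum>i<m. Polynomial.smult ((u i)\<^sup>2) (root_poly ({..<m} - {i}) d))) \<partial>lborel)"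
      have "(\<integral>\<^sup>+v. ?f (border_entries m (Suc m) a v) \<partial>leb {..<Suc m}) =
        (\<integral>\<^sup>+v. \<integral>\<^sup>+t. G (char_poly (bordered_mat m B v t)) \<partial>lborel \<partial>leb {..<m})"
        by (subst nn_integral_leb_Suc(1)[OF m1]) (simp add: sym_mat_of_border_entries B_def)
      \<comment> \<open>The border enters only through its coordinates in the eigenbasis, and
        Lebesgue measure does not see the rotation.\<close>
      also have "\<dots> = (\<integral>\<^sup>+v. \<Phi> (\<lambda>i\<in>{..<m}. \<Sum>j<m. R i j * v j) \<partial>leb {..<m})"
        by (simp add: char_poly_bordered[OF B d R(2,3)] \<Phi>_def)
      also have "\<dots> = (\<integral>\<^sup>+v. \<Phi> v \<partial>leb {..<m})"
        by (rule nn_integral_leb_orthogonal[OF R(1,2)]) (unfold \<Phi>_def, measurable)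
      also have "\<dots> = H (char_poly B)"
        unfolding \<Phi>_def H_def d_def by (rule nn_integral_bordered[OF simple[folded B_def] G])
      finally show "(\<integral>\<^sup>+v. ?f (border_entries m (Suc m) a v) \<partial>leb {..<Suc m}) = H (char_poly (sym_mat_of m a))"
        unfolding B_def .
    qed
    also have "\<dots> = C * (\<integral>\<^sup>+q. H (monic_poly m q) * indicator (real_simple m) (monic_poly m q) \<partial>leb {..<m})"
      by (rule C) measurable
    \<comment> \<open>The kernel already vanishes unless its second argument has distinct real
      roots.\<close>
    also have "(\<integral>\<^sup>+q. H (monic_poly m q) * indicator (real_simple m) (monic_poly m q) \<partial>leb {..<m}) =
       (\<integral>\<^sup>+q. H (monic_poly m q) \<partial>leb {..<m})"
      by (intro nn_integral_cong) (auto simp: H_def interlace_kernel_def split: split_indicator)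
    also have "\<dots> = (\<integral>\<^sup>+c. \<integral>\<^sup>+q. G (monic_poly (Suc m) c) * interlace_kernel m (monic_poly (Suc m) c) (monic_poly m q) \<partial>leb {..<m} \<partial>leb {..<Suc m})"
      unfolding H_def by (rule leb_swap) (auto, measurable)
    also have "\<dots> = (\<integral>\<^sup>+c. G (monic_poly (Suc m) c) * indicator (real_simple (Suc m)) (monic_poly (Suc m) c) * K \<partial>leb {..<Suc m})"
    proof (rule nn_integral_cong)
      fix c :: "nat \<Rightarrow> real"
      have "(\<integral>\<^sup>+q. interlace_kernel m (monic_poly (Suc m) c) (monic_poly m q) \<partial>leb {..<m}) = indicator (real_simple (Suc m)) (monic_poly (Suc m) c) * K"
      proof (cases "monic_poly (Suc m) c \<in> real_simple (Suc m)")
        case True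
        then show ?thesis using nn_integral_interlace_kernel[OF True] by (simp add: K_def)
      next
        case False
        then show ?thesis using interlace_kernel_eq_0[OF monic_poly_in_monic_polys False monic_poly_in_monic_polys] by simp
      qed
      then show "(\<integral>\<^sup>+q. G (monic_poly (Suc m) c) * interlace_kernel m (monic_poly (Suc m) c) (monic_poly m q) \<partial>leb {..<m}) =
        G (monic_poly (Suc m) c) * indicator (real_simple (Suc m)) (monic_poly (Suc m) c) * K"
        by (subst nn_integral_cmult) (measurable, simp add: mult.assoc)
    qed
    also have "\<dots> = (\<integral>\<^sup>+c. G (monic_poly (Suc m) c) * indicator (real_simple (Suc m)) (monic_poly (Suc m) c) \<partial>leb {..<Suc m}) * K"
      by (rule nn_integral_multc) measurable
    finally show "(\<integral>\<^sup>+x. ?f x \<partial>leb (upper_indices (Suc m))) = C * K * (\<integral>\<^sup>+c. G (monic_poly (Suc m) c) * indicator (real_simple (Suc m)) (monic_poly (Suc m) c) \<partial>leb {..<Suc m})"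
      by (simp add: mult_ac)
  qed
qed

subsection \<open>Root coordinates\<close>

lemma monic_polysI:
  assumes "coeff p n = 1" "\<And>i. i > n \<Longrightarrow> coeff p i = 0"
  shows "p \<in> monic_polys n"
proof -
  have "degree p = n" using assms by (intro antisym degree_le le_degree) auto
  then show ?thesis using assms(1) by (simp add: monic_polys_def)
qed

text \<open>A permutation matrix is orthogonal.\<close>

lemma nn_integral_leb_permute:
  fixes p :: "nat \<Rightarrow> nat"
  assumes p: "p permutes {..<n}" and G: "G \<in> borel_measurable (leb {..<n})"
  shows "(\<integral>\<^sup>+x. G (\<lambda>i\<in>{..<n}. x (p i)) \<partial>leb {..<n}) = (\<integral>\<^sup>+x. G x \<partial>leb {..<n})"
proof -
  define R :: "nat \<Rightarrow> nat \<Rightarrow> real" where "R = (\<lambda>i j. if j = p i then 1 else 0)"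
  have pin: "p i < n" if "i < n" for i using permutes_in_image[OF p, of i] that by simp
  have inj: "p i = p j \<longleftrightarrow> i = j" for i j using permutes_inj[OF p] by (auto dest: injD)
  have "(\<integral>\<^sup>+x. G (\<lambda>i\<in>{..<n}. \<Sum>j<n. R i j * x j) \<partial>leb {..<n}) = (\<integral>\<^sup>+x. G x \<partial>leb {..<n})"
  proof (rule nn_integral_leb_orthogonal[OF _ _ G])
    show "(\<Sum>k<n. R i k * R j k) = (if i = j then 1 else 0)" if "i < n" "j < n" for i j
    proof -
      have "(\<Sum>k<n. R i k * R j k) = (\<Sum>k<n. if k = p i then R j (p i) else 0)"
        by (intro sum.cong) (auto simp: R_def)
      then show ?thesis using pin[OF that(1)] by (auto simp: R_def inj)
    qed
    show "(\<Sum>k<n. R k i * R k j) = (if i = j then 1 else 0)" if "i < n" "j < n" for i j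
    proof -
      have i: "i = p (inv_into UNIV p i)" using permutes_inverses(1)[OF p] by simp
      have "inv_into UNIV p i < n" using permutes_in_image[OF permutes_inv[OF p], of i] that by simp
      moreover have "(\<Sum>k<n. R k i * R k j) = (\<Sum>k<n. if k = inv_into UNIV p i then R (inv_into UNIV p i) j else 0)"
        by (intro sum.cong) (use i inj in \<open>auto simp: R_def\<close>)
      ultimately show ?thesis using i by (auto simp: R_def)
    qed
  qed
  moreover have "(\<Sum>j<n. R i j * x j) = x (p i)" if "i < n" for i and x :: "nat \<Rightarrow> real"
    using pin[OF that] by (simp add: R_def if_distrib[of "\<lambda>c. c * _"] cong: if_cong)
  then have "(\<lambda>i\<in>{..<n}. \<Sum>j<n. R i j * x j) = (\<lambda>i\<in>{..<n}. x (p i))" for x :: "nat \<Rightarrow> real"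
    by auto
  ultimately show ?thesis by simp
qed

text \<open>The set is the open ray above the largest root, or the whole line if there is no root;
  the intervals put it into the form that the substitution rule expects.\<close>

lemma positive_ray_exhaustion:
  fixes p :: "real poly"
  assumes "lead_coeff p > 0"
  obtains a b :: "nat \<Rightarrow> real" where "decseq a" "incseq b" "\<And>k. a k \<le> b k"
    and "{x. \<forall>t\<ge>x. poly p t > 0} = (\<Union>k. {a k..b k})"
proof (cases "\<exists>x. poly p x = 0")
  case False
  have "poly p t > 0" for t
  proof (rule ccontr)
    assume "\<not> poly p t > 0"
    then have t: "poly p t < 0" using False by (meson linorder_neqE)
    obtain n where n: "\<forall>x\<ge>n. poly p x \<ge> lead_coeff p" using poly_pinfty_gt_lc[OF assms] by blast
    have "poly p (max n (t + 1)) > 0" using n assms by (meson less_le_trans max.cobounded1)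
    moreover have "t < max n (t + 1)" by (simp add: less_max_iff_disj)
    ultimately show False using poly_IVT_pos[of t "max n (t + 1)" p] t False by auto
  qed
  then have U: "{x. \<forall>t\<ge>x. poly p t > 0} = UNIV" by auto
  have "x \<in> (\<Union>k. {- real k..real k})" for x :: real
    using real_arch_simple[of "\<bar>x\<bar>"] by (auto simp: abs_le_iff) (metis neg_le_iff_le minus_minus)
  then show thesis
    by (intro that[of "\<lambda>k. - real k" "\<lambda>k. real k"]) (auto simp: U decseq_def incseq_def)
next
  case True
  have "p \<noteq> 0" using assms by auto
  define Z where "Z = {x. poly p x = 0}"
  have Z: "finite Z" "Z \<noteq> {}" using True \<open>p \<noteq> 0\<close> poly_roots_finite by (auto simp: Z_def)
  define z where "z = Max Z"
  have z0: "poly p z = 0" using Max_in[OF Z] by (simp add: z_def Z_def)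
  have zmax: "x \<le> z" if "poly p x = 0" for x using Max_ge[OF Z(1)] that by (simp add: z_def Z_def)
  have pos: "poly p t > 0" if t: "t > z" for t
  proof (rule ccontr)
    assume "\<not> poly p t > 0"
    then have t': "poly p t < 0" using zmax[of t] t by (meson linorder_neqE not_le)
    obtain n where n: "\<forall>x\<ge>n. poly p x \<ge> lead_coeff p" using poly_pinfty_gt_lc[OF assms] by blast
    have "poly p (max n (t + 1)) > 0" using n assms by (meson less_le_trans max.cobounded1)
    moreover have "t < max n (t + 1)" by (simp add: less_max_iff_disj)
    ultimately obtain x where "x > t" "poly p x = 0" using poly_IVT_pos[of t "max n (t + 1)" p] t' by auto
    then show False using zmax[of x] t by simp
  qed
  have U: "{x. \<forall>t\<ge>x. poly p t > 0} = {z<..}"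
  proof (intro equalityI subsetI)
    fix x assume "x \<in> {x. \<forall>t\<ge>x. poly p t > 0}"
    then show "x \<in> {z<..}" using z0 by (metis greaterThan_iff less_irrefl linorder_not_le mem_Collect_eq)
  qed (use pos in auto)
  have V: "{z<..} = (\<Union>k. {z + inverse (real (Suc k))..z + real (Suc k)})"
  proof (intro equalityI subsetI)
    fix x assume x: "x \<in> {z<..}"
    obtain k where k: "real k > max (x - z) (inverse (x - z))" using reals_Archimedean2 by blast
    have "inverse (real (Suc k)) < x - z"
      using k x by (metis diff_gt_0_iff_gt greaterThan_iff inverse_inverse_eq less_imp_inverse_less less_max_iff_disj
          max_less_iff_conj of_nat_Suc order_less_trans positive_imp_inverse_positive less_add_one add.commute)
    then show "x \<in> (\<Union>k. {z + inverse (real (Suc k))..z + real (Suc k)})" using k by (intro UN_I[of k]) auto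
  next
    fix x assume "x \<in> (\<Union>k. {z + inverse (real (Suc k))..z + real (Suc k)})"
    then obtain k where "z + inverse (real (Suc k)) \<le> x" by auto
    moreover have "inverse (real (Suc k)) > 0" by simp
    ultimately have "z < x" by linarith
    then show "x \<in> {z<..}" by simp
  qed
  show thesis
  proof (rule that[of "\<lambda>k. z + inverse (real (Suc k))" "\<lambda>k. z + real (Suc k)"])
    show "decseq (\<lambda>k. z + inverse (real (Suc k)))"
      by (auto simp: decseq_def intro!: le_imp_inverse_le)
    show "incseq (\<lambda>k. z + real (Suc k))" by (auto simp: incseq_def)
    show "z + inverse (real (Suc k)) \<le> z + real (Suc k)" for k by (simp add: field_simps)
    show "{x. \<forall>t\<ge>x. poly p t > 0} = (\<Union>k. {z + inverse (real (Suc k))..z + real (Suc k)})"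
      unfolding U by (rule V)
  qed
qed

text \<open>In the product rule every summand is nonnegative at or above the largest root, and the
  one that omits that root is positive.\<close>

lemma pderiv_pos_above_roots:
  assumes "strict_mono_on {..<Suc n} l" "x \<ge> l n"
  shows "poly (pderiv (root_poly {..<Suc n} l)) x > 0"
proof -
  have lt: "l i < l n" if "i < n" for i using assms(1) that by (auto simp: strict_mono_on_def)
  have "poly (pderiv (root_poly {..<Suc n} l)) x = (\<Sum>i<Suc n. \<Prod>j\<in>{..<Suc n} - {i}. x - l j)"
    unfolding root_poly_def pderiv_prod by (simp add: poly_sum poly_prod pderiv_pCons)
  also have "\<dots> > 0"
  proof (rule sum_pos2[of _ n])
    have "l j < x" if "j < n" for j using lt[OF that] assms(2) by simp
    then show "0 < (\<Prod>j\<in>{..<Suc n} - {n}. x - l j)" by (intro prod_pos) (auto simp: less_Suc_eq)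
    have "l j \<le> x" if "j < Suc n" for j using lt[of j] assms(2) that by (cases "j = n") auto
    then show "0 \<le> (\<Prod>j\<in>{..<Suc n} - {i}. x - l j)" for i by (intro prod_nonneg) auto
  qed auto
  finally show ?thesis .
qed

text \<open>Substitution y = h(r) along the branch of the largest root of h - y. That root lies in
  the final ray \<open>U\<close> where h' is positive, and \<open>h\<close> is injective on
  \<open>U\<close>; hence, on the support of \<open>F\<close>, r is the largest root of its own
  level exactly when r lies in \<open>U\<close>.\<close>

lemma nn_integral_level_sets:
  fixes h :: "real poly" and F :: "real \<Rightarrow> ennreal"
  assumes h: "h \<in> monic_polys (Suc n)" and F [measurable]: "F \<in> borel_measurable borel"
    and supp: "\<And>y. F y \<noteq> 0 \<Longrightarrow> h - [:y:] \<in> real_simple (Suc n)"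
  shows "(\<integral>\<^sup>+r. (if ordered_roots (Suc n) (h - [:poly h r:]) n = r then F (poly h r) * ennreal (poly (pderiv h) r) else 0) \<partial>lborel) =
     (\<integral>\<^sup>+y. F y \<partial>lborel)"
proof -
  have lc: "lead_coeff (pderiv h) > 0"
  proof -
    have "coeff h (Suc n) = 1" "degree h = Suc n" using h by (auto simp: monic_polys_def)
    then show ?thesis by (simp add: degree_pderiv coeff_pderiv)
  qed
  define U where "U = {x. \<forall>t\<ge>x. poly (pderiv h) t > 0}"
  obtain a b :: "nat \<Rightarrow> real" where ab: "decseq a" "incseq b" "\<And>k. a k \<le> b k" and "{x. \<forall>t\<ge>x. poly (pderiv h) t > 0} = (\<Union>k. {a k..b k})"
    by (rule positive_ray_exhaustion[OF lc]) (rule that)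
  then have U: "U = (\<Union>k. {a k..b k})" by (simp only: U_def)
  have mono: "poly h x < poly h y" if xy: "x \<in> U" "x < y" for x y
  proof (rule DERIV_pos_imp_increasing[OF xy(2)])
    fix t assume "x \<le> t" "t \<le> y"
    then show "\<exists>z. (poly h has_real_derivative z) (at t) \<and> 0 < z"
      using xy(1) by (intro exI[of _ "poly (pderiv h) t"] conjI poly_DERIV) (auto simp: U_def)
  qed
  have pd: "pderiv (h - [:y:]) = pderiv h" for y by (simp add: pderiv_diff pderiv_pCons)
  have top: "ordered_roots (Suc n) (h - [:y:]) n \<in> U \<and> poly h (ordered_roots (Suc n) (h - [:y:]) n) = y"
    if "h - [:y:] \<in> real_simple (Suc n)" for y
  proof
    let ?l = "ordered_roots (Suc n) (h - [:y:])"
    have l: "strict_mono_on {..<Suc n} ?l" "root_poly {..<Suc n} ?l = h - [:y:]"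
      using ordered_roots[OF that] by auto
    show "?l n \<in> U" unfolding U_def
      using pderiv_pos_above_roots[OF l(1)] unfolding l(2) pd by auto
    have "poly (root_poly {..<Suc n} ?l) (?l n) = 0" by (subst poly_root_poly_eq_0) auto
    then show "poly h (?l n) = y" unfolding l(2) by simp
  qed
  define V where "V = (\<Union>k. {poly h (a k)..poly h (b k)})"
  have "(\<integral>\<^sup>+r. F (poly h r) * ennreal (poly (pderiv h) r) * indicator U r \<partial>lborel) = (\<integral>\<^sup>+y. F y * indicator V y \<partial>lborel)"
    by (rule nn_integral_substitution_Union[OF _ _ F _ _ _ U V_def ab])
      (auto simp: U_def intro!: poly_DERIV continuous_intros less_imp_le borel_measurable_continuous_onI)
  moreover have "F y * indicator V y = F y" for y
  proof (cases "F y = 0")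
    case False
    define r where "r = ordered_roots (Suc n) (h - [:y:]) n"
    have r: "r \<in> U" "poly h r = y" using top[OF supp[OF False]] by (auto simp: r_def)
    then obtain k where k: "r \<in> {a k..b k}" using U by auto
    have "a k \<in> {a k..b k}" "b k \<in> {a k..b k}" using ab(3)[of k] by auto
    then have "a k \<in> U" "b k \<in> U" using U by blast+
    then have "poly h (a k) \<le> poly h r" "poly h r \<le> poly h (b k)"
      using k r mono[of "a k" r] mono[of r "b k"] by (auto simp: le_less)
    then have "y \<in> V" using r by (auto simp: V_def)
    then show ?thesis by simp
  qed simp
  moreover have "F (poly h r) * ennreal (poly (pderiv h) r) * indicator U r =
     (if ordered_roots (Suc n) (h - [:poly h r:]) n = r then F (poly h r) * ennreal (poly (pderiv h) r) else 0)" for r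
  proof (cases "F (poly h r) = 0")
    case False
    define t where "t = ordered_roots (Suc n) (h - [:poly h r:]) n"
    have t: "t \<in> U" "poly h t = poly h r" using top[OF supp[OF False]] by (auto simp: t_def)
    have rs: "h - [:poly h r:] \<in> real_simple (Suc n)" using supp[OF False] .
    have "r \<le> t"
    proof -
      let ?l = "ordered_roots (Suc n) (h - [:poly h r:])"
      have l: "strict_mono_on {..<Suc n} ?l" "root_poly {..<Suc n} ?l = h - [:poly h r:]"
        using ordered_roots[OF rs] by auto
      have "poly (h - [:poly h r:]) r = 0" by simp
      then have "r \<in> ?l ` {..<Suc n}" using poly_root_poly_eq_0[of "{..<Suc n}" ?l r] unfolding l(2) by simp
      then obtain i where i: "i < Suc n" "r = ?l i" by blast
      have "?l i \<le> ?l n"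
      proof (cases "i = n")
        case False
        then show ?thesis using i(1) strict_mono_onD[OF l(1), of i n] by (simp add: less_imp_le)
      qed simp
      with i(2) show ?thesis unfolding t_def by (rule ord_eq_le_trans)
    qed
    then have "r \<in> U \<longleftrightarrow> t = r" using t mono[of r t] by (auto simp: le_less)
    then show ?thesis by (auto simp: t_def indicator_def)
  qed simp
  ultimately show ?thesis by simp
qed

lemma real_simple_linear_factor:
  assumes R: "R \<in> monic_polys n"
  shows "R \<in> real_simple n \<and> (\<forall>i\<in>{..<n}. ordered_roots n R i < r) \<longleftrightarrow>
    [:- r, 1:] * R \<in> real_simple (Suc n) \<and> ordered_roots (Suc n) ([:- r, 1:] * R) n = r"
proof
  assume *: "R \<in> real_simple n \<and> (\<forall>i\<in>{..<n}. ordered_roots n R i < r)"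
  define l where "l = (ordered_roots n R)(n := r)"
  have "strict_mono_on {..<n} (ordered_roots n R)" "root_poly {..<n} (ordered_roots n R) = R"
    using ordered_roots * by auto
  then have l: "strict_mono_on {..<Suc n} l" "root_poly {..<n} l = R"
    using * by (auto simp: strict_mono_on_def l_def less_Suc_eq root_poly_def intro: prod.cong)
  have eq: "[:- r, 1:] * R = root_poly {..<Suc n} l"
    unfolding l(2)[symmetric] by (simp add: root_poly_def l_def mult.commute)
  show "[:- r, 1:] * R \<in> real_simple (Suc n) \<and> ordered_roots (Suc n) ([:- r, 1:] * R) n = r"
    unfolding eq using l(1) ordered_roots_root_poly[OF l(1), of n] by (auto simp: real_simple_def l_def)
next
  assume *: "[:- r, 1:] * R \<in> real_simple (Suc n) \<and> ordered_roots (Suc n) ([:- r, 1:] * R) n = r"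
  define l where "l = ordered_roots (Suc n) ([:- r, 1:] * R)"
  have l: "strict_mono_on {..<Suc n} l" "root_poly {..<Suc n} l = [:- r, 1:] * R" "l n = r"
    using ordered_roots * by (auto simp: l_def)
  have "[:- r, 1:] * root_poly {..<n} l = [:- r, 1:] * R"
    unfolding l(2)[symmetric] by (simp add: root_poly_def l(3) mult.commute)
  then have R: "R = root_poly {..<n} l" by (metis mult_cancel_left pCons_eq_0_iff zero_neq_one)
  have ln: "strict_mono_on {..<n} l" using l(1) by (auto simp: strict_mono_on_def)
  have "ordered_roots n R i < r" if "i < n" for i
    unfolding R using ordered_roots_root_poly[OF ln that] l(1,3) that by (auto simp: strict_mono_on_def)
  then show "R \<in> real_simple n \<and> (\<forall>i\<in>{..<n}. ordered_roots n R i < r)"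
    using R ln by (auto simp: real_simple_def)
qed

text \<open>The open Weyl chamber, with bounded quantifiers so that measurability reduces to
  finitely many strict inequalities.\<close>

definition chamber :: "nat \<Rightarrow> (nat \<Rightarrow> real) \<Rightarrow> bool" where
  "chamber n l \<longleftrightarrow> (\<forall>j\<in>{..<n}. \<forall>i\<in>{..<j}. l i < l j)"

lemma chamber_iff: "chamber n l \<longleftrightarrow> strict_mono_on {..<n} l"
  by (auto simp: chamber_def strict_mono_on_def)

lemma measurable_chamber [measurable]: "Measurable.pred (leb {..<n}) (chamber n)"
proof -
  have [measurable]: "(\<lambda>x. x i) \<in> borel_measurable (leb {..<n})" for i by (rule measurable_leb_coordinate)
  show ?thesis unfolding chamber_def by measurable
qed

lemma chamber_Suc: "chamber (Suc n) (l(n := r)) \<longleftrightarrow> chamber n l \<and> (\<forall>i\<in>{..<n}. l i < r)"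
  by (auto simp: chamber_def less_Suc_eq)

lemma vdm_pos: "chamber n l \<Longrightarrow> vdm n l > 0"
  unfolding vdm_def chamber_def by (intro prod_pos) auto

lemma measurable_vdm [measurable]: "vdm n \<in> borel_measurable (leb {..<n})"
proof -
  have [measurable]: "(\<lambda>x. x i) \<in> borel_measurable (leb {..<n})" for i by (rule measurable_leb_coordinate)
  show ?thesis unfolding vdm_def by measurable
qed

lemma vdm_cong: "(\<And>i. i < n \<Longrightarrow> l i = l' i) \<Longrightarrow> vdm n l = vdm n l'"
  unfolding vdm_def by (intro prod.cong refl) auto

lemma root_poly_cong: "(\<And>i. i \<in> I \<Longrightarrow> l i = l' i) \<Longrightarrow> root_poly I l = root_poly I l'"
  unfolding root_poly_def by (intro prod.cong) auto

text \<open>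
  Induction on the largest root \<open>r\<close>: expanding the cofactor \<open>R\<close> in the basis \<open>(x ^ (i + 1) - r ^ (i + 1)) / (x - r)\<close>
  gives \<open>(x - r) R = h - h r\<close> with \<open>h\<close> independent of \<open>r\<close>, and \<open>h r\<close> becomes the constant coefficient.
\<close>

lemma nn_integral_root_coordinates:
  assumes "G \<in> borel_measurable polyM"
  shows "(\<integral>\<^sup>+c. G (monic_poly n c) * indicator (real_simple n) (monic_poly n c) \<partial>leb {..<n}) =
    (\<integral>\<^sup>+l. (if chamber n l then ennreal (vdm n l) * G (root_poly {..<n} l) else 0) \<partial>leb {..<n})"
  using assms
proof (induction n arbitrary: G)
  case 0
  have "monic_poly 0 c = root_poly {..<0} (\<lambda>_::nat. undefined)" for c by (simp add: monic_poly_def root_poly_def monom_0)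
  moreover have "root_poly {..<0} (\<lambda>_::nat. undefined) \<in> real_simple 0" by (rule real_simpleI_inj) simp
  ultimately show ?case by (simp add: chamber_def PiM_empty nn_integral_count_space_finite)
next
  case (Suc n)
  note G [measurable] = Suc.prems
  have or [measurable]: "(\<lambda>p. ordered_roots n p i) \<in> borel_measurable polyM" if "i \<in> {..<n}" for i
    using measurable_ordered_roots that by simp
  have top: "(\<lambda>p. ordered_roots (Suc n) p n) \<in> borel_measurable polyM" by (rule measurable_ordered_roots) simp
  \<comment> \<open>The contribution of a cofactor \<open>R\<close> whose roots lie below a new
    largest root \<open>r\<close>; the factor R(r) is the growth of the Vandermonde product.\<close>
  define \<Psi> where "\<Psi> = (\<lambda>R r. if R \<in> real_simple n \<and> (\<forall>i\<in>{..<n}. ordered_roots n R i < r)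
     then G ([:- r, 1:] * R) * ennreal (poly R r) else 0)"
  have mPsi: "(\<lambda>z. \<Psi> (f z) (g z)) \<in> borel_measurable N" if f [measurable]: "f \<in> measurable N polyM" and g [measurable]: "g \<in> borel_measurable N"
    for f g and N :: "'b measure"
  proof -
    have [measurable]: "(\<lambda>z. ordered_roots n (f z) i) \<in> borel_measurable N" if "i \<in> {..<n}" for i
      by (rule measurable_compose[OF f or[OF that]])
    have [measurable]: "Measurable.pred N (\<lambda>z. f z \<in> real_simple n)"
      by (rule measurable_compose[OF f measurable_real_simple_pred])
    show ?thesis unfolding \<Psi>_def by measurable
  qed
  define H where "H = (\<lambda>R. \<integral>\<^sup>+r. \<Psi> R r \<partial>lborel)"
  have [measurable]: "H \<in> borel_measurable polyM"
    unfolding H_def by (rule lborel.borel_measurable_nn_integral) (simp add: split_beta' mPsi)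
  define f where "f = (\<lambda>l. if chamber (Suc n) l then ennreal (vdm (Suc n) l) * G (root_poly {..<Suc n} l) else 0)"
  have f: "f \<in> borel_measurable (leb {..<Suc n})" unfolding f_def by measurable
  have fe: "f (l(n := r)) = (if chamber n l then ennreal (vdm n l) * \<Psi> (root_poly {..<n} l) r else 0)" for l r
  proof (cases "chamber n l")
    case True
    then have l: "strict_mono_on {..<n} l" by (simp add: chamber_iff)
    have "root_poly {..<n} l \<in> real_simple n" using l by (auto simp: real_simple_def)
    moreover have "(\<forall>i\<in>{..<n}. ordered_roots n (root_poly {..<n} l) i < r) \<longleftrightarrow> (\<forall>i\<in>{..<n}. l i < r)"
      using ordered_roots_root_poly[OF l] by auto
    moreover have "vdm (Suc n) (l(n := r)) = vdm n l * poly (root_poly {..<n} l) r"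
      unfolding vdm_Suc by (simp add: poly_root_poly cong: vdm_cong)
    moreover have "root_poly {..<Suc n} (l(n := r)) = [:- r, 1:] * root_poly {..<n} l"
    proof -
      have "{..<Suc n} - {n} = {..<n}" by auto
      then show ?thesis
        using root_poly_remove[of "{..<Suc n}" n "l(n := r)"] root_poly_cong[of "{..<n}" "l(n := r)" l] by simp
    qed
    moreover have "poly (root_poly {..<n} l) r \<ge> 0" if "\<forall>i\<in>{..<n}. l i < r"
      unfolding poly_root_poly by (intro prod_nonneg) (use that in \<open>auto intro: less_imp_le\<close>)
    ultimately show ?thesis
      using True vdm_pos[OF True] by (auto simp: f_def chamber_Suc \<Psi>_def ennreal_mult mult_ac)
  next
    case False
    then show ?thesis by (simp add: f_def chamber_Suc)
  qed
  \<comment> \<open>\<open>h\<close> has no constant coefficient. Its coefficients \<open>s\<close>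
    together with the level \<open>y\<close>, up to sign, are the n + 1 coefficients of the
    product.\<close>
  define h where "h = (\<lambda>s. monom 1 (Suc n) + (\<Sum>i<n. monom (s i :: real) (Suc i)))"
  have hm: "h s \<in> monic_polys (Suc n)" for s
  proof -
    have "h s = monic_poly (Suc n) (\<lambda>i. case i of 0 \<Rightarrow> 0 | Suc j \<Rightarrow> s j)"
      by (simp add: h_def monic_poly_def sum.lessThan_Suc_shift del: sum.lessThan_Suc)
    then show ?thesis using monic_poly_in_monic_polys by simp
  qed
  have h_measurable: "(\<lambda>z. h (f z)) \<in> measurable N polyM" if "f \<in> measurable N (leb {..<n})" for f and N :: "'b measure"
    unfolding h_def by (intro poly_measurable_intros measurable_compose[OF that measurable_leb_coordinate])
  define \<Theta> where "\<Theta> = (\<lambda>q. G q * indicator (real_simple (Suc n)) q)"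
  have [measurable]: "\<Theta> \<in> borel_measurable polyM" unfolding \<Theta>_def by measurable
  have "(\<integral>\<^sup>+l. f l \<partial>leb {..<Suc n}) = (\<integral>\<^sup>+l. \<integral>\<^sup>+r. (if chamber n l then ennreal (vdm n l) * \<Psi> (root_poly {..<n} l) r else 0) \<partial>lborel \<partial>leb {..<n})"
    by (subst nn_integral_leb_Suc(1)[OF f]) (simp only: fe)
  also have "\<dots> = (\<integral>\<^sup>+l. (if chamber n l then ennreal (vdm n l) * H (root_poly {..<n} l) else 0) \<partial>leb {..<n})"
    by (intro nn_integral_cong) (auto simp: H_def intro!: nn_integral_cmult mPsi)
  also have "\<dots> = (\<integral>\<^sup>+c. H (monic_poly n c) * indicator (real_simple n) (monic_poly n c) \<partial>leb {..<n})"
    by (rule Suc.IH[symmetric]) measurable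
  also have "\<dots> = (\<integral>\<^sup>+c. H (monic_poly n c) \<partial>leb {..<n})"
    by (intro nn_integral_cong) (auto simp: H_def \<Psi>_def split: split_indicator)
  also have "\<dots> = (\<integral>\<^sup>+r. \<integral>\<^sup>+c. \<Psi> (monic_poly n c) r \<partial>leb {..<n} \<partial>lborel)"
    unfolding H_def by (rule leb_swap_lborel) (auto simp: split_beta' intro!: mPsi)
  also have "\<dots> = (\<integral>\<^sup>+r. \<integral>\<^sup>+s. (if ordered_roots (Suc n) (h s - [:poly (h s) r:]) n = r then \<Theta> (h s - [:poly (h s) r:]) * ennreal (poly (pderiv (h s)) r) else 0) \<partial>leb {..<n} \<partial>lborel)"
  proof (rule nn_integral_cong)
    fix r :: real
    define E where "E = (\<lambda>i. \<Sum>j\<le>i. monom (r ^ (i - j)) j)"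
    have cE: "coeff (E i) j = (if j \<le> i then r ^ (i - j) else 0)" for i j
      by (auto simp: E_def coeff_sum if_distrib cong: if_cong)
    have E: "degree (E i) = i \<and> lead_coeff (E i) = 1" for i
    proof -
      have "degree (E i) = i" by (intro antisym degree_le le_degree) (auto simp: cE)
      then show ?thesis by (simp add: cE)
    qed
    have Ef: "[:- r, 1:] * E i = monom 1 (Suc i) - [:r ^ Suc i:]" for i
    proof (rule poly_eqI)
      fix j
      show "coeff ([:- r, 1:] * E i) j = coeff (monom 1 (Suc i) - [:r ^ Suc i:]) j"
      proof (cases j)
        case 0 then show ?thesis by (simp add: cE)
      next
        case (Suc k)
        have "r ^ (i - k) = r * r ^ (i - Suc k)" if "k < i" using that by (metis Suc_diff_Suc power_Suc)
        then show ?thesis using Suc by (auto simp: cE coeff_pCons not_le less_Suc_eq_le le_less)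
      qed
    qed
    have q: "[:- r, 1:] * (E n + (\<Sum>i<n. Polynomial.smult (s i) (E i))) = h s - [:poly (h s) r:]" for s
    proof -
      have "[:- r, 1:] * (E n + (\<Sum>i<n. Polynomial.smult (s i) (E i))) =
         [:- r, 1:] * E n + (\<Sum>i<n. Polynomial.smult (s i) ([:- r, 1:] * E i))"
        by (simp only: distrib_left sum_distrib_left mult_smult_right)
      also have "\<dots> = monom 1 (Suc n) - [:r ^ Suc n:] + (\<Sum>i<n. monom (s i) (Suc i) - [:s i * r ^ Suc i:])"
        unfolding Ef by (simp add: smult_diff_right smult_monom)
      also have "\<dots> = monom 1 (Suc n) - [:r ^ Suc n:] + ((\<Sum>i<n. monom (s i) (Suc i)) - [:\<Sum>i<n. s i * r ^ Suc i:])"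
      proof -
        have "(\<Sum>i<n. [:s i * r ^ Suc i:]) = [:\<Sum>i<n. s i * r ^ Suc i:]" by (induction n) auto
        then show ?thesis by (simp only: sum_subtractf)
      qed
      also have "\<dots> = h s - [:poly (h s) r:]"
        unfolding h_def by (simp add: poly_sum poly_monom)
      finally show ?thesis .
    qed
    have "(\<integral>\<^sup>+c. \<Psi> (monic_poly n c) r \<partial>leb {..<n}) = (\<integral>\<^sup>+s. \<Psi> (E n + (\<Sum>i<n. Polynomial.smult (s i) (E i))) r \<partial>leb {..<n})"
      by (rule nn_integral_monic_basis[symmetric, where G = "\<lambda>R. \<Psi> R r", OF E]) (auto intro!: mPsi)
    also have "\<dots> = (\<integral>\<^sup>+s. (if ordered_roots (Suc n) (h s - [:poly (h s) r:]) n = r then \<Theta> (h s - [:poly (h s) r:]) * ennreal (poly (pderiv (h s)) r) else 0) \<partial>leb {..<n})"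
    proof (rule nn_integral_cong)
      fix s :: "nat \<Rightarrow> real"
      define R where "R = E n + (\<Sum>i<n. Polynomial.smult (s i) (E i))"
      have cR: "coeff R i = 0" if "i > n" for i using that by (simp add: R_def coeff_sum cE)
      have "coeff R n = 1" by (simp add: R_def coeff_sum cE)
      then have R: "R \<in> monic_polys n"
        using cR by (rule monic_polysI)
      have q': "[:- r, 1:] * R = h s - [:poly (h s) r:]" unfolding R_def by (rule q)
      \<comment> \<open>Differentiating (x - r) R at r gives R(r), so the Vandermonde factor is the
        Jacobian h'(r) of the level-set substitution.\<close>
      have "poly R r = poly (pderiv ([:- r, 1:] * R)) r" unfolding pderiv_mult by (simp add: pderiv_pCons)
      also have "\<dots> = poly (pderiv (h s)) r" unfolding q' by (simp add: pderiv_diff pderiv_pCons)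
      finally have "poly R r = poly (pderiv (h s)) r" .
      then show "\<Psi> (E n + (\<Sum>i<n. Polynomial.smult (s i) (E i))) r =
         (if ordered_roots (Suc n) (h s - [:poly (h s) r:]) n = r then \<Theta> (h s - [:poly (h s) r:]) * ennreal (poly (pderiv (h s)) r) else 0)"
        unfolding R_def[symmetric] \<Psi>_def real_simple_linear_factor[OF R] q' by (auto simp: \<Theta>_def split: split_indicator)
    qed
    finally show "(\<integral>\<^sup>+c. \<Psi> (monic_poly n c) r \<partial>leb {..<n}) = \<dots>" .
  qed
  also have "\<dots> = (\<integral>\<^sup>+s. \<integral>\<^sup>+r. (if ordered_roots (Suc n) (h s - [:poly (h s) r:]) n = r then \<Theta> (h s - [:poly (h s) r:]) * ennreal (poly (pderiv (h s)) r) else 0) \<partial>lborel \<partial>leb {..<n})"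
  proof (rule leb_swap_lborel[symmetric])
    have [measurable]: "(\<lambda>z. h (fst z)) \<in> measurable (leb {..<n} \<Otimes>\<^sub>M lborel) polyM"
      by (rule h_measurable) simp
    have q: "(\<lambda>z. h (fst z) - [:poly (h (fst z)) (snd z):]) \<in> measurable (leb {..<n} \<Otimes>\<^sub>M lborel) polyM" by measurable
    note [measurable] = measurable_compose[OF q top] q
    show "(\<lambda>(s, r). if ordered_roots (Suc n) (h s - [:poly (h s) r:]) n = r then \<Theta> (h s - [:poly (h s) r:]) * ennreal (poly (pderiv (h s)) r) else 0)
       \<in> borel_measurable (leb {..<n} \<Otimes>\<^sub>M lborel)"
      unfolding split_beta' by measurable
  qed simp
  also have "\<dots> = (\<integral>\<^sup>+s. \<integral>\<^sup>+y. \<Theta> (h s - [:y:]) \<partial>lborel \<partial>leb {..<n})"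
    by (rule nn_integral_cong, rule nn_integral_level_sets[OF hm, where F = "\<lambda>y. \<Theta> (h _ - [:y:])"])
      (measurable, auto simp: \<Theta>_def split: split_indicator_asm)
  also have "\<dots> = (\<integral>\<^sup>+s. \<integral>\<^sup>+y. \<Theta> (h s + [:y:]) \<partial>lborel \<partial>leb {..<n})"
  proof (rule nn_integral_cong)
    fix s :: "nat \<Rightarrow> real"
    have "h s + [:y:] = h s - [:0 + - 1 * y:]" for y by simp
    then have "(\<integral>\<^sup>+y. \<Theta> (h s + [:y:]) \<partial>lborel) = (\<integral>\<^sup>+y. \<Theta> (h s - [:0 + - 1 * y:]) \<partial>lborel)" by (simp only:)
    then show "(\<integral>\<^sup>+y. \<Theta> (h s - [:y:]) \<partial>lborel) = (\<integral>\<^sup>+y. \<Theta> (h s + [:y:]) \<partial>lborel)"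
      using nn_integral_lborel_affine[of "\<lambda>y. \<Theta> (h s - [:y:])" "- 1" 0] by simp
  qed
  also have "\<dots> = (\<integral>\<^sup>+c. \<Theta> (monic_poly (Suc n) c) \<partial>leb {..<Suc n})"
  proof -
    \<comment> \<open>The constant coefficient sits in the last coordinate but belongs to index 0;
      \<open>p\<close> is the cyclic shift that moves it and \<open>\<tau>\<close> its
      inverse.\<close>
    define \<tau> where "\<tau> = (\<lambda>i. if i = n then 0 else if i < n then Suc i else i)"
    define p where "p = (\<lambda>i. if i = 0 then n else if i \<le> n then i - 1 else i)"
    have p: "p permutes {..<Suc n}"
    proof (rule bij_imp_permutes)
      show "bij_betw p {..<Suc n} {..<Suc n}"
        by (rule bij_betwI[of _ _ _ \<tau>]) (auto simp: p_def \<tau>_def)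
      show "p x = x" if "x \<notin> {..<Suc n}" for x using that by (auto simp: p_def)
    qed
    have eq: "monic_poly (Suc n) (\<lambda>i\<in>{..<Suc n}. (s(n := y)) (p i)) = h s + [:y:]" for s y
    proof -
      have "(\<Sum>i<Suc n. monom ((\<lambda>i\<in>{..<Suc n}. (s(n := y)) (p i)) i) i) = [:y:] + (\<Sum>i<n. monom (s i) (Suc i))"
        by (subst sum.lessThan_Suc_shift) (auto simp: p_def monom_0 intro!: sum.cong)
      then show ?thesis by (simp add: monic_poly_def h_def)
    qed
    have "(\<integral>\<^sup>+c. \<Theta> (monic_poly (Suc n) c) \<partial>leb {..<Suc n}) = (\<integral>\<^sup>+c. \<Theta> (monic_poly (Suc n) (\<lambda>i\<in>{..<Suc n}. c (p i))) \<partial>leb {..<Suc n})"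
      by (rule nn_integral_leb_permute[OF p, symmetric]) measurable
    also have "\<dots> = (\<integral>\<^sup>+s. \<integral>\<^sup>+y. \<Theta> (h s + [:y:]) \<partial>lborel \<partial>leb {..<n})"
    proof (subst nn_integral_leb_Suc(1))
      show "(\<lambda>c. \<Theta> (monic_poly (Suc n) (\<lambda>i\<in>{..<Suc n}. c (p i)))) \<in> borel_measurable (leb {..<Suc n})"
        by (intro measurable_compose[OF _ measurable_compose[OF measurable_monic_poly]] measurable_lebI measurable_leb_coordinate) measurable
    qed (simp only: eq)
    finally show ?thesis ..
  qed
  finally show ?case unfolding f_def \<Theta>_def ..
qed

subsection \<open>Antisymmetrisation and permutation sums\<close>

lemma vdm_eq_0: "\<not> inj_on l {..<n} \<Longrightarrow> vdm n l = 0"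
proof (induction n)
  case (Suc n)
  then consider "\<not> inj_on l {..<n}" | i where "i < n" "l i = l n"
    by (auto simp: lessThan_Suc inj_on_insert)
  then show ?case
  proof cases
    case (2 i)
    then have "(\<Prod>i<n. l n - l i) = 0" by (intro prod_zero finite_lessThan bexI[of _ i]) auto
    then show ?thesis by (simp add: vdm_Suc)
  qed (use Suc.IH in \<open>simp add: vdm_Suc\<close>)
qed simp

text \<open>As a function of the last node the determinant is a polynomial of degree at most n that
  vanishes at the earlier nodes; its x^n coefficient is the smaller determinant because the
  \<open>\<phi> j\<close> are monic and graded. For coinciding nodes two rows agree.\<close>

lemma det_monic_vandermonde:
  fixes \<phi> :: "nat \<Rightarrow> real poly"
  assumes \<phi>: "\<And>j. degree (\<phi> j) = j \<and> lead_coeff (\<phi> j) = 1"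
  shows "det (mat n n (\<lambda>(i, j). poly (\<phi> j) (l i))) = vdm n l"
proof (induction n)
  case (Suc n)
  define N where "N = (\<lambda>x. mat (Suc n) (Suc n) (\<lambda>(i, j). poly (\<phi> j) (if i < n then l i else x)))"
  have N: "N x \<in> carrier_mat (Suc n) (Suc n)" for x by (simp add: N_def)
  define cf where "cf = cofactor (N 0) n"
  have cf: "cofactor (N x) n j = cf j" if "j < Suc n" for x j
  proof -
    have "mat_delete (N x) n j = mat_delete (N 0) n j"
      by (rule eq_matI) (auto simp: mat_delete_def N_def)
    then show ?thesis by (simp add: cf_def cofactor_def)
  qed
  define q where "q = (\<Sum>j<Suc n. Polynomial.smult (cf j) (\<phi> j))"
  have q: "poly q x = det (N x)" for x
  proof -
    have Nn: "N x $$ (n, j) = poly (\<phi> j) x" if "j < Suc n" for j using that by (simp add: N_def)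
    have "det (N x) = (\<Sum>j<Suc n. N x $$ (n, j) * cofactor (N x) n j)"
      by (rule laplace_expansion_row[OF N]) simp
    also have "\<dots> = poly q x"
      unfolding q_def poly_sum by (intro sum.cong refl) (simp add: cf Nn)
    finally show ?thesis ..
  qed
  have "mat_delete (N 0) n n = mat n n (\<lambda>(i, j). poly (\<phi> j) (l i))"
    by (rule eq_matI) (auto simp: mat_delete_def N_def)
  then have cfn: "cf n = vdm n l" using Suc.IH by (simp add: cf_def cofactor_def)
  have c0: "coeff (\<phi> j) n = 0" if "j < n" for j using \<phi>[of j] that by (intro coeff_eq_0) simp
  have qn: "coeff q n = vdm n l"
  proof -
    have "coeff (\<phi> n) n = 1" using \<phi>[of n] by auto
    then show ?thesis by (simp add: q_def coeff_sum c0 cfn)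
  qed
  have dq: "degree q \<le> n"
    unfolding q_def using \<phi> by (intro degree_sum_le) (auto intro: order.trans[OF degree_smult_le] simp: less_Suc_eq_le)
  have q0: "poly q (l i) = 0" if "i < n" for i
    unfolding q by (rule det_identical_rows[OF N, of i n]) (use that in \<open>auto simp: N_def intro!: eq_vecI\<close>)
  have M: "mat (Suc n) (Suc n) (\<lambda>(i, j). poly (\<phi> j) (l i)) = N (l n)"
    by (rule eq_matI) (auto simp: N_def less_Suc_eq)
  show ?case
  proof (cases "inj_on l {..<n}")
    case True
    have "q = Polynomial.smult (vdm n l) (root_poly {..<n} l)"
      by (rule poly_eqI_degree_lead_coeff[of _ n _ "l ` {..<n}"])
        (use True qn dq q0 in \<open>auto simp: card_image poly_root_poly_eq_0 intro: order.trans[OF degree_smult_le]\<close>)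
    then show ?thesis unfolding M q[symmetric] by (simp add: vdm_Suc poly_root_poly)
  next
    case False
    then obtain i j where ij: "i < n" "j < n" "i \<noteq> j" "l i = l j" by (auto simp: inj_on_def)
    have "det (N (l n)) = 0"
      by (rule det_identical_rows[OF N, of i j]) (use ij in \<open>auto simp: N_def intro!: eq_vecI\<close>)
    then show ?thesis unfolding M using vdm_eq_0[OF False] by (simp add: vdm_Suc)
  qed
qed simp

lemma leibniz_vdm:
  fixes \<phi> :: "nat \<Rightarrow> real poly"
  assumes \<phi>: "\<And>j. degree (\<phi> j) = j \<and> lead_coeff (\<phi> j) = 1"
  shows "(\<Sum>p | p permutes {..<n}. of_int (sign p) * (\<Prod>i<n. poly (\<phi> (p i)) (l i))) = vdm n l"
proof -
  have "det (mat n n (\<lambda>(i, j). poly (\<phi> j) (l i))) =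
     (\<Sum>p | p permutes {..<n}. of_int (sign p) * (\<Prod>i<n. poly (\<phi> (p i)) (l i)))"
    unfolding det_def
    by (auto simp: atLeast0LessThan intro!: sum.cong prod.cong arg_cong2[where f = "(*)"] dest: permutes_in_image)
  then show ?thesis using det_monic_vandermonde[OF \<phi>] by simp
qed

text \<open>Antisymmetry is inherited from the determinant by permuting its rows.\<close>

lemma vdm_permute:
  assumes "p permutes {..<n}"
  shows "vdm n (\<lambda>i. l (p i)) = of_int (sign p) * vdm n l"
proof -
  define \<phi> :: "nat \<Rightarrow> real poly" where "\<phi> = monom 1"
  have \<phi>: "\<And>j. degree (\<phi> j) = j \<and> lead_coeff (\<phi> j) = 1" by (simp add: \<phi>_def degree_monom_eq)
  let ?A = "mat n n (\<lambda>(i, j). poly (\<phi> j) (l i))"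
  have "mat n n (\<lambda>(i, j). ?A $$ (p i, j)) = mat n n (\<lambda>(i, j). poly (\<phi> j) (l (p i)))"
    using permutes_in_image[OF assms] by (intro eq_matI) auto
  then have "vdm n (\<lambda>i. l (p i)) = det (mat n n (\<lambda>(i, j). ?A $$ (p i, j)))"
    using det_monic_vandermonde[OF \<phi>, of n "\<lambda>i. l (p i)"] by simp
  also have "\<dots> = of_int (sign p) * det ?A"
    using assms by (intro det_permute_rows) (auto simp: atLeast0LessThan)
  finally show ?thesis using det_monic_vandermonde[OF \<phi>] by simp
qed

section \<open>Coordinate permutations and antisymmetric integrands\<close>

lemma distr_leb_permute:
  fixes p :: "nat \<Rightarrow> nat"
  assumes "p permutes {..<n}"
  shows "distr (leb {..<n}) (leb {..<n}) (\<lambda>x. \<lambda>i\<in>{..<n}. x (p i)) = leb {..<n}"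
proof (rule measure_eqI)
  have m: "(\<lambda>x. \<lambda>i\<in>{..<n}. x (p i)) \<in> measurable (leb {..<n}) (leb {..<n})"
    by (intro measurable_lebI measurable_leb_coordinate)
  fix A assume "A \<in> sets (distr (leb {..<n}) (leb {..<n}) (\<lambda>x. \<lambda>i\<in>{..<n}. x (p i)))"
  then have A: "A \<in> sets (leb {..<n})" by simp
  have "emeasure (distr (leb {..<n}) (leb {..<n}) (\<lambda>x. \<lambda>i\<in>{..<n}. x (p i))) A =
     (\<integral>\<^sup>+x. indicator A x \<partial>distr (leb {..<n}) (leb {..<n}) (\<lambda>x. \<lambda>i\<in>{..<n}. x (p i)))"
    using A by simp
  also have "\<dots> = (\<integral>\<^sup>+x. indicator A (\<lambda>i\<in>{..<n}. x (p i)) \<partial>leb {..<n})"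
    using A by (intro nn_integral_distr m) auto
  also have "\<dots> = (\<integral>\<^sup>+x. indicator A x \<partial>leb {..<n})"
    using nn_integral_leb_permute[OF assms, of "indicator A"] A by simp
  finally show "emeasure (distr (leb {..<n}) (leb {..<n}) (\<lambda>x. \<lambda>i\<in>{..<n}. x (p i))) A = emeasure (leb {..<n}) A"
    using A by simp
qed simp

lemma integral_leb_permute:
  fixes f :: "(nat \<Rightarrow> real) \<Rightarrow> real"
  assumes p: "p permutes {..<n}" and f: "f \<in> borel_measurable (leb {..<n})"
  shows "(LINT x|leb {..<n}. f (\<lambda>i\<in>{..<n}. x (p i))) = (LINT x|leb {..<n}. f x)"
    and "integrable (leb {..<n}) (\<lambda>x. f (\<lambda>i\<in>{..<n}. x (p i))) \<longleftrightarrow> integrable (leb {..<n}) f"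
proof -
  have m: "(\<lambda>x. \<lambda>i\<in>{..<n}. x (p i)) \<in> measurable (leb {..<n}) (leb {..<n})"
    by (intro measurable_lebI measurable_leb_coordinate)
  show "(LINT x|leb {..<n}. f (\<lambda>i\<in>{..<n}. x (p i))) = (LINT x|leb {..<n}. f x)"
    using integral_distr[OF m f] unfolding distr_leb_permute[OF p] by simp
  show "integrable (leb {..<n}) (\<lambda>x. f (\<lambda>i\<in>{..<n}. x (p i))) \<longleftrightarrow> integrable (leb {..<n}) f"
    using integrable_distr_eq[OF m f] unfolding distr_leb_permute[OF p] by simp
qed

text \<open>Unlike the ordering of all variables, this factor couples only disjoint pairs, so
  integrals against it split into double integrals. For odd n the last variable stays free.\<close>

definition pair_sign :: "nat \<Rightarrow> (nat \<Rightarrow> real) \<Rightarrow> real" where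
  "pair_sign n l = (\<Prod>k<n div 2. sgn (l (2 * k + 1) - l (2 * k)))"

lemma measurable_pair_sign [measurable]: "pair_sign n \<in> borel_measurable (leb {..<n})"
proof -
  have [measurable]: "(\<lambda>x. x i) \<in> borel_measurable (leb {..<n})" for i by (rule measurable_leb_coordinate)
  show ?thesis unfolding pair_sign_def by measurable
qed

text \<open>The sorted values are the ordered roots of the polynomial with roots \<open>l\<close>;
  uniqueness of that list and injectivity of \<open>l\<close> determine the permutation.\<close>

lemma sorting_permutation:
  fixes l :: "nat \<Rightarrow> real"
  assumes inj: "inj_on l {..<n}"
  shows "\<exists>!p. p permutes {..<n} \<and> chamber n (\<lambda>i. l (p i))"
proof -
  define P where "P = root_poly {..<n} l"
  have P: "P \<in> real_simple n" unfolding P_def by (rule real_simpleI_inj) fact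
  define r where "r = ordered_roots n P"
  have r: "strict_mono_on {..<n} r" "root_poly {..<n} r = P" using ordered_roots[OF P] by (auto simp: r_def)
  have img: "r ` {..<n} = l ` {..<n}"
    using poly_root_poly_eq_0[of "{..<n}" r] poly_root_poly_eq_0[of "{..<n}" l] r(2) by (auto simp: P_def set_eq_iff)
  define p where "p = (\<lambda>i. if i < n then inv_into {..<n} l (r i) else i)"
  have lp: "p i < n \<and> l (p i) = r i" if "i < n" for i
    using img that inv_into_into[of "r i" l "{..<n}"] f_inv_into_f[of "r i" l "{..<n}"] by (auto simp: p_def)
  have "inj_on p {..<n}"
  proof (rule inj_onI)
    fix x y assume xy: "x \<in> {..<n}" "y \<in> {..<n}" "p x = p y"
    then have "r x = r y" using lp[of x] lp[of y] by simp
    then show "x = y" using xy inj_onD[OF strict_mono_on_inj_on_nat[OF r(1)]] by blast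
  qed
  moreover have "p ` {..<n} \<subseteq> {..<n}" using lp by auto
  ultimately have "bij_betw p {..<n} {..<n}" by (simp add: bij_betw_def endo_inj_surj)
  then have perm: "p permutes {..<n}" by (rule bij_imp_permutes) (auto simp: p_def)
  have ch: "chamber n (\<lambda>i. l (p i))" using r(1) lp by (simp add: chamber_iff strict_mono_on_def)
  show ?thesis
  proof (rule ex1I[of _ p])
    fix q assume q: "q permutes {..<n} \<and> chamber n (\<lambda>i. l (q i))"
    have "root_poly {..<n} (\<lambda>i. l (q i)) = P"
      unfolding P_def root_poly_def using q prod.permute[of q "{..<n}" "\<lambda>i. [:- l i, 1:]"] by (simp add: o_def)
    then have "l (q i) = r i" if "i < n" for i
      using ordered_roots_root_poly[of n "\<lambda>i. l (q i)" i] q that by (simp add: chamber_iff r_def)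
    then have "q i = p i" if "i < n" for i
      using lp[OF that] that inj q permutes_in_image[of q "{..<n}" i] by (auto simp: inj_on_def)
    moreover have "q i = p i" if "\<not> i < n" for i
      using that q perm by (auto simp: permutes_def)
    ultimately show "q = p" by (metis ext)
  qed (use perm ch in simp)
qed

lemma chamber_restrict [simp]: "chamber n (\<lambda>i\<in>{..<n}. l i) = chamber n l"
  unfolding chamber_def by auto

lemma pair_sign_cong: "(\<And>i. i < n \<Longrightarrow> l i = l' i) \<Longrightarrow> pair_sign n l = pair_sign n l'"
  unfolding pair_sign_def by (intro prod.cong refl) auto

text \<open>The order of the values of \<open>l\<close> is the order of their indices, so the sign
  pattern is constant on each permuted chamber.\<close>

lemma pair_sign_chamber:
  assumes ch: "chamber n l" and q: "q permutes {..<n}"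
  shows "pair_sign n (\<lambda>i. l (q i)) = pair_sign n (\<lambda>i. real (q i))"
  unfolding pair_sign_def
proof (intro prod.cong refl)
  fix k assume "k \<in> {..<n div 2}"
  then have k: "2 * k + 1 < n" "2 * k < n" by auto
  have "q (2 * k + 1) < n" "q (2 * k) < n"
    using k permutes_in_image[OF q] by auto
  then show "sgn (l (q (2 * k + 1)) - l (q (2 * k))) = sgn (real (q (2 * k + 1)) - real (q (2 * k)))"
    using ch by (cases "q (2 * k + 1)" "q (2 * k)" rule: linorder_cases) (auto simp: chamber_def)
qed

text \<open>
  The function \<^term>\<open>pair_sign n\<close> antisymmetrises to a multiple of the sign of the Vandermonde product,
  so it may replace the ordering of the variables under the integral of an antisymmetric function.
\<close>

lemma integral_pair_sign_antisymmetric: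
  "\<exists>c :: real. \<forall>h. integrable (leb {..<n}) h \<longrightarrow>
     (\<forall>p l. p permutes {..<n} \<longrightarrow> h (\<lambda>i\<in>{..<n}. l (p i)) = of_int (sign p) * h l) \<longrightarrow>
     (LINT l|leb {..<n}. pair_sign n l * h l) = c * (LINT l|leb {..<n}. (if chamber n l then h l else 0))"
\<comment> \<open>Each permuted chamber contributes the value of \<open>pair_sign n\<close> there,
  times the sign that \<open>h\<close> picks up on the way to the ordered chamber.\<close>
proof (intro exI[of _ "\<Sum>p | p permutes {..<n}. pair_sign n (\<lambda>i. real (inv_into UNIV p i)) * of_int (sign (inv_into UNIV p))"] allI impI)
  fix h :: "(nat \<Rightarrow> real) \<Rightarrow> real"
  assume int: "integrable (leb {..<n}) h"
    and anti: "\<forall>p l. p permutes {..<n} \<longrightarrow> h (\<lambda>i\<in>{..<n}. l (p i)) = of_int (sign p) * h l"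
  have [measurable]: "h \<in> borel_measurable (leb {..<n})" using int by simp
  have int': "integrable (leb {..<n}) (\<lambda>l. if chamber n l then h l else 0)"
    by (rule Bochner_Integration.integrable_bound[OF int]) auto
  define g where "g = (\<lambda>p l. if chamber n l then pair_sign n (\<lambda>i. real (inv_into UNIV p i)) * of_int (sign (inv_into UNIV p)) * h l else (0 :: real))"
  have g_eq: "g p l = pair_sign n (\<lambda>i. real (inv_into UNIV p i)) * of_int (sign (inv_into UNIV p)) * (if chamber n l then h l else 0)" for p l
    by (simp add: g_def)
  have [measurable]: "g p \<in> borel_measurable (leb {..<n})" for p unfolding g_def by measurable
  have gint: "integrable (leb {..<n}) (g p)" for p
    unfolding g_eq using int' by (intro integrable_mult_right) auto
  have pt: "pair_sign n l * h l = (\<Sum>p | p permutes {..<n}. g p (\<lambda>i\<in>{..<n}. l (p i)))" if l: "l \<in> space (leb {..<n})" for l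
  \<comment> \<open>If two variables coincide, their transposition fixes \<open>l\<close>, so
    antisymmetry forces h l = 0. Otherwise exactly one permutation sorts \<open>l\<close>, and only
    its term survives.\<close>
  proof (cases "inj_on l {..<n}")
    case False
    then obtain i j where ij: "i < n" "j < n" "i \<noteq> j" "l i = l j" by (auto simp: inj_on_def)
    have t: "Transposition.transpose i j permutes {..<n}" using ij by (intro permutes_swap_id) auto
    have "(\<lambda>k\<in>{..<n}. l (Transposition.transpose i j k)) = l"
      using l ij by (auto simp: fun_eq_iff Transposition.transpose_def space_PiM PiE_def extensional_def)
    then have "h l = of_int (sign (Transposition.transpose i j)) * h l" using anti t by metis
    then have "h l = 0" using ij by (simp add: sign_swap_id)
    moreover have "g p (\<lambda>i\<in>{..<n}. l (p i)) = 0" if "p permutes {..<n}" for p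
      using anti that \<open>h l = 0\<close> by (simp add: g_def)
    ultimately show ?thesis by simp
  next
    case True
    from sorting_permutation[OF True] obtain p where p: "p permutes {..<n}" "chamber n (\<lambda>i. l (p i))"
      and uniq: "\<And>q. q permutes {..<n} \<Longrightarrow> chamber n (\<lambda>i. l (q i)) \<Longrightarrow> q = p" by blast
    have "(\<Sum>q | q permutes {..<n}. g q (\<lambda>i\<in>{..<n}. l (q i))) = (\<Sum>q | q permutes {..<n}. if q = p then g p (\<lambda>i\<in>{..<n}. l (p i)) else 0)"
    proof (intro sum.cong refl)
      fix q assume q: "q \<in> {q. q permutes {..<n}}"
      show "g q (\<lambda>i\<in>{..<n}. l (q i)) = (if q = p then g p (\<lambda>i\<in>{..<n}. l (p i)) else 0)"
      proof (cases "q = p")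
        case False
        then have "\<not> chamber n (\<lambda>i. l (q i))" using uniq q by blast
        then show ?thesis using False by (simp add: g_def)
      qed simp
    qed
    also have "\<dots> = g p (\<lambda>i\<in>{..<n}. l (p i))" using p(1) by (simp add: finite_permutations)
    also have "\<dots> = pair_sign n l * h l"
    proof -
      have "pair_sign n (\<lambda>i. real (inv_into UNIV p i)) = pair_sign n (\<lambda>i. (\<lambda>i. l (p i)) (inv_into UNIV p i))"
        by (rule pair_sign_chamber[symmetric, OF p(2) permutes_inv[OF p(1)]])
      also have "\<dots> = pair_sign n l" by (simp add: permutes_inverses[OF p(1)])
      finally have 1: "pair_sign n (\<lambda>i. real (inv_into UNIV p i)) = pair_sign n l" .
      have "permutation p" using p(1) by (auto simp: permutation_permutes)
      then have "of_int (sign (inv_into UNIV p)) * of_int (sign p) = (1 :: real)"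
        by (simp add: sign_inverse flip: of_int_mult)
      then show ?thesis using p anti by (simp add: g_def 1 mult.assoc)
    qed
    finally show ?thesis ..
  qed
  have "(LINT l|leb {..<n}. pair_sign n l * h l) = (LINT l|leb {..<n}. (\<Sum>p | p permutes {..<n}. g p (\<lambda>i\<in>{..<n}. l (p i))))"
    using pt by (intro Bochner_Integration.integral_cong) auto
  also have "\<dots> = (\<Sum>p | p permutes {..<n}. LINT l|leb {..<n}. g p (\<lambda>i\<in>{..<n}. l (p i)))"
    using gint integral_leb_permute(2) by (intro Bochner_Integration.integral_sum) auto
  also have "\<dots> = (\<Sum>p | p permutes {..<n}. LINT l|leb {..<n}. g p l)"
    using integral_leb_permute(1) by (intro sum.cong) auto
  also have "\<dots> = (\<Sum>p | p permutes {..<n}. pair_sign n (\<lambda>i. real (inv_into UNIV p i)) * of_int (sign (inv_into UNIV p)) * (LINT l|leb {..<n}. (if chamber n l then h l else 0)))"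
    unfolding g_eq by simp
  finally show "(LINT l|leb {..<n}. pair_sign n l * h l) = (\<Sum>p | p permutes {..<n}. pair_sign n (\<lambda>i. real (inv_into UNIV p i)) * of_int (sign (inv_into UNIV p))) * (LINT l|leb {..<n}. (if chamber n l then h l else 0))"
    by (simp add: sum_distrib_right)
qed

section \<open>Permutations that preserve the pairs\<close>

definition partner :: "nat \<Rightarrow> nat" where
  "partner i = (if even i then i + 1 else i - 1)"

lemma partner_simps [simp]: "partner (2 * k) = Suc (2 * k)" "partner (Suc (2 * k)) = 2 * k" "partner (partner i) = i" "partner i \<noteq> i"
  by (auto simp: partner_def elim: oddE)

lemma partner_less: "partner i < 2 * M \<longleftrightarrow> i < 2 * M"
  unfolding partner_def by presburger

text \<open>The permutations that survive skew-orthogonality: the two positions of each of the first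
  M pairs receive the two members of one pair. Positions from 2M on are unrestricted.\<close>

definition block_perm :: "nat \<Rightarrow> (nat \<Rightarrow> nat) \<Rightarrow> bool" where
  "block_perm M p \<longleftrightarrow> (\<forall>k<M. p (2 * k + 1) = partner (p (2 * k)))"

lemma block_perm_partner:
  assumes "block_perm M p" "i < 2 * M"
  shows "p (partner i) = partner (p i)"
proof (cases "even i")
  case True
  then obtain k where "i = 2 * k" by (elim evenE)
  then show ?thesis using assms by (auto simp: block_perm_def)
next
  case False
  then obtain k where i: "i = 2 * k + 1" by (elim oddE)
  then have "p i = partner (p (2 * k))" using assms by (auto simp: block_perm_def)
  then show ?thesis using i by simp
qed

text \<open>A number outside the pair of \<open>b\<close> lies on the same side of both
  members.\<close>

lemma sgn_partner:
  assumes "a \<noteq> b" "a \<noteq> partner b"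
  shows "sgn (real (partner b) - real a) = sgn (real b - real a)"
proof -
  have "a < partner b \<longleftrightarrow> a < b" using assms by (auto simp: partner_def split: if_splits)
  then show ?thesis using assms by (simp add: sgn_real_def)
qed

lemma real_sgn_prod: "sgn (\<Prod>i\<in>I. f i :: real) = (\<Prod>i\<in>I. sgn (f i))"
  by (induction I rule: infinite_finite_induct) (simp_all add: sgn_mult)

text \<open>When a pair is appended, its two differences to each earlier value have equal sign and
  cancel; only the orientation within the pair remains.\<close>

lemma sgn_vdm_block_perm:
  assumes "inj_on p {..<2 * M}" "block_perm M p"
  shows "sgn (vdm (2 * M) (\<lambda>i. real (p i))) = (\<Prod>k<M. if even (p (2 * k)) then 1 else - 1)"
  using assms
proof (induction M)
  case (Suc M)
  have inj: "inj_on p {..<2 * M}" and bl: "block_perm M p"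
    using Suc.prems by (auto simp: block_perm_def intro: inj_on_subset)
  define b where "b = p (2 * M)"
  have b: "p (Suc (2 * M)) = partner b" using Suc.prems(2) by (auto simp: block_perm_def b_def)
  have ne: "p i \<noteq> b" "p i \<noteq> partner b" if "i < 2 * M" for i
  proof -
    have "p i \<noteq> p (2 * M)" "p i \<noteq> p (Suc (2 * M))"
      using inj_onD[OF Suc.prems(1), of i "2 * M"] inj_onD[OF Suc.prems(1), of i "Suc (2 * M)"] that by auto
    then show "p i \<noteq> b" "p i \<noteq> partner b" unfolding b by (simp_all add: b_def)
  qed
  have "(\<Prod>i<2 * M. sgn (real b - real (p i))) * (\<Prod>i<2 * M. sgn (real (partner b) - real (p i))) = 1"
    unfolding prod.distrib[symmetric]
  proof (intro prod.neutral ballI)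
    fix i assume "i \<in> {..<2 * M}"
    then have "sgn (real (partner b) - real (p i)) = sgn (real b - real (p i))" "real b - real (p i) \<noteq> 0"
      using ne[of i] sgn_partner[of "p i" b] by auto
    then show "sgn (real b - real (p i)) * sgn (real (partner b) - real (p i)) = 1"
      by (simp add: sgn_if)
  qed
  moreover have "sgn (real (partner b) - real b) = (if even b then 1 else - 1)"
    by (auto simp: partner_def elim!: oddE)
  moreover have "vdm (2 * Suc M) (\<lambda>i. real (p i)) = vdm (2 * M) (\<lambda>i. real (p i)) * (\<Prod>i<2 * M. real b - real (p i)) *
     ((\<Prod>i<2 * M. real (partner b) - real (p i)) * (real (partner b) - real b))"
    by (simp add: vdm_Suc b b_def[symmetric])
  ultimately show ?case
    using Suc.IH[OF inj bl] by (simp add: sgn_mult real_sgn_prod b_def[symmetric] mult.assoc)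
qed simp

text \<open>The sign of a permutation is the sign of the Vandermonde product of its values. A fixed
  last index contributes only positive differences.\<close>

lemma sign_block_perm:
  assumes p: "p permutes {..<n}" and "block_perm M p" and n: "n = 2 * M \<or> (n = Suc (2 * M) \<and> p (2 * M) = 2 * M)"
  shows "of_int (sign p) = (\<Prod>k<M. if even (p (2 * k)) then 1 else - 1 :: real)"
proof -
  have inj: "inj_on p {..<2 * M}" using permutes_inj_on[OF p] .
  have pos: "vdm n real > 0" by (rule vdm_pos) (auto simp: chamber_def)
  have "sgn (vdm n (\<lambda>i. real (p i))) = sgn (vdm (2 * M) (\<lambda>i. real (p i)))"
    using n
  proof
    assume n: "n = Suc (2 * M) \<and> p (2 * M) = 2 * M"
    have "p i < 2 * M" if "i < 2 * M" for i
    proof -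
      have "p i < n" using permutes_in_image[OF p, of i] that n by simp
      moreover have "p i \<noteq> 2 * M" using injD[OF permutes_inj[OF p], of i "2 * M"] n that by auto
      ultimately show ?thesis using n by simp
    qed
    then have "real (p i) < real (2 * M)" if "i < 2 * M" for i using that by (simp only: of_nat_less_iff)
    then have "(\<Prod>i<2 * M. real (2 * M) - real (p i)) > 0"
      by (intro prod_pos) (simp only: lessThan_iff diff_gt_0_iff_gt)
    then show ?thesis using n by (simp add: vdm_Suc sgn_mult)
  qed simp
  then have "sgn (of_int (sign p) * vdm n real) = (\<Prod>k<M. if even (p (2 * k)) then 1 else - 1 :: real)"
    using vdm_permute[OF p, of real] sgn_vdm_block_perm[OF inj assms(2)] by simp
  moreover have "sgn (of_int (sign p)) = (of_int (sign p) :: real)" by (simp add: sign_def)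
  ultimately show ?thesis using pos by (simp add: sgn_mult)
qed

text \<open>Separates the combinatorics from the integrals: \<open>s\<close> stands for the skew
  products of the orthogonal polynomials and \<open>\<mu>\<close> for their moments.\<close>

locale skew_pairing =
  fixes s :: "nat \<Rightarrow> nat \<Rightarrow> real" and \<sigma> \<mu> :: "nat \<Rightarrow> real"
  assumes s_even: "\<And>k. s (2 * k) (2 * k + 1) = \<sigma> k" and s_odd: "\<And>k. s (2 * k + 1) (2 * k) = - \<sigma> k"
    and s_0: "\<And>i j. j \<noteq> partner i \<Longrightarrow> s i j = 0"
    and \<sigma>_pos: "\<And>k. \<sigma> k > 0" and \<mu>_pos: "\<And>i. even i \<Longrightarrow> \<mu> i > 0" and \<mu>_0: "\<And>i. odd i \<Longrightarrow> \<mu> i = 0"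
begin

definition weight :: "nat \<Rightarrow> (nat \<Rightarrow> nat) \<Rightarrow> real" where
  "weight M p = (\<Prod>k<M. s (p (2 * k)) (p (2 * k + 1)))"

lemma s_partner: "s i (partner i) = (if even i then 1 else - 1) * \<sigma> (i div 2)"
proof (cases "even i")
  case True
  then obtain k where "i = 2 * k" by (elim evenE)
  then show ?thesis using s_even[of k] by simp
next
  case False
  then obtain k where "i = 2 * k + 1" by (elim oddE)
  then show ?thesis using s_odd[of k] by simp
qed

lemma weight_block_perm:
  assumes "block_perm M p"
  shows "weight M p = (\<Prod>k<M. if even (p (2 * k)) then 1 else - 1) * (\<Prod>k<M. \<sigma> (p (2 * k) div 2))"
proof -
  have "weight M p = (\<Prod>k<M. (if even (p (2 * k)) then 1 else - 1) * \<sigma> (p (2 * k) div 2))"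
    unfolding weight_def using assms by (intro prod.cong refl) (auto simp: block_perm_def s_partner)
  then show ?thesis by (simp only: prod.distrib)
qed

lemma weight_eq_0: "\<not> block_perm M p \<Longrightarrow> weight M p = 0"
  unfolding weight_def block_perm_def by (auto intro!: s_0)

lemma sign_square: "(\<Prod>k<M. if even (q k) then 1 else - 1 :: real) * (\<Prod>k<M. if even (q k) then 1 else - 1) = 1"
  unfolding prod.distrib[symmetric] by (intro prod.neutral) auto

text \<open>Orientation signs enter once through the sign of \<open>p\<close> and once through the
  skew products, and cancel. Every surviving term is therefore positive.\<close>

lemma signed_weight:
  assumes "p permutes {..<n}" "block_perm M p" "n = 2 * M \<or> (n = Suc (2 * M) \<and> p (2 * M) = 2 * M)"
  shows "of_int (sign p) * weight M p = (\<Prod>k<M. \<sigma> (p (2 * k) div 2))"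
  unfolding weight_block_perm[OF assms(2)] sign_block_perm[OF assms] mult.assoc[symmetric] sign_square by simp

text \<open>Among the values 0, ..., 2M only 2M lacks its partner, so a pair-preserving permutation
  must place it at the free position 2M. \<open>K\<close> is positive because the identity
  contributes; it is the same for all \<open>f\<close>, which later carries the dependence on
  x.\<close>

lemma permutation_sum_even:
  fixes f :: "nat \<Rightarrow> real"
  shows "\<exists>K>0. \<forall>f. (\<Sum>p | p permutes {..<Suc (2 * M)}. of_int (sign p) * (weight M p * f (p (2 * M)))) = K * f (2 * M)"
proof -
  let ?n = "Suc (2 * M)"
  define S where "S = {p. p permutes {..<?n} \<and> block_perm M p}"
  have fixes_top: "p (2 * M) = 2 * M" if "p \<in> S" for p
  proof (rule ccontr)
    have p: "p permutes {..<?n}" "block_perm M p" using that by (auto simp: S_def)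
    assume ne: "p (2 * M) \<noteq> 2 * M"
    obtain j where j: "j < ?n" "p j = 2 * M"
      using permutes_image[OF p(1)] by (metis imageE lessI lessThan_iff)
    then have "j < 2 * M" using ne by (cases "j = 2 * M") auto
    then have "p (partner j) = Suc (2 * M)" using block_perm_partner[OF p(2), of j] j by simp
    moreover have "partner j < ?n" using \<open>j < 2 * M\<close> partner_less[of j M] by simp
    ultimately show False using permutes_in_image[OF p(1), of "partner j"] by simp
  qed
  have fin: "finite S" by (rule finite_subset[OF _ finite_permutations[of "{..<?n}"]]) (auto simp: S_def)
  have sw: "of_int (sign p) * weight M p = (\<Prod>k<M. \<sigma> (p (2 * k) div 2))" if "p \<in> S" for p
    using that fixes_top[OF that] by (intro signed_weight[of p ?n]) (auto simp: S_def)
  define K where "K = (\<Sum>p\<in>S. \<Prod>k<M. \<sigma> (p (2 * k) div 2))"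
  have "id \<in> S" by (auto simp: S_def permutes_id block_perm_def)
  then have "K > 0" unfolding K_def
    by (intro sum_pos2[OF fin, of id]) (auto intro!: prod_pos prod_nonneg \<sigma>_pos less_imp_le)
  moreover have "(\<Sum>p | p permutes {..<?n}. of_int (sign p) * (weight M p * f (p (2 * M)))) = K * f (2 * M)" for f
  proof -
    have "(\<Sum>p | p permutes {..<?n}. of_int (sign p) * (weight M p * f (p (2 * M)))) = (\<Sum>p\<in>S. of_int (sign p) * (weight M p * f (p (2 * M))))"
      by (rule sum.mono_neutral_right) (auto simp: finite_permutations S_def weight_eq_0)
    also have "\<dots> = (\<Sum>p\<in>S. (\<Prod>k<M. \<sigma> (p (2 * k) div 2)) * f (2 * M))"
      by (intro sum.cong refl) (simp add: sw fixes_top mult.assoc[symmetric])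
    finally show ?thesis by (simp add: K_def sum_distrib_right)
  qed
  ultimately show ?thesis by blast
qed

text \<open>Position 2M carries a moment, which vanishes for odd indices; so it takes an even value
  2k, and the last position is left with 2k+1. The other pairs contribute the product of all
  \<sigma>_l except \<sigma>_k, and the number of such permutations is the same for every k.\<close>

lemma permutation_sum_odd:
  "\<exists>N>0. \<forall>f. (\<Sum>p | p permutes {..<Suc (Suc (2 * M))}. of_int (sign p) * (weight M p * \<mu> (p (2 * M)) * f (p (Suc (2 * M))))) =
     N * (\<Sum>k<Suc M. \<mu> (2 * k) / \<sigma> k * f (Suc (2 * k)))"
proof -
  let ?n = "Suc (Suc (2 * M))"
  define S where "S = (\<lambda>k. {p. p permutes {..<?n} \<and> block_perm (Suc M) p \<and> p (2 * M) = 2 * k})"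
  have finS: "finite (S k)" for k by (rule finite_subset[OF _ finite_permutations[of "{..<?n}"]]) (auto simp: S_def)
  have idS: "id \<in> S M" by (auto simp: S_def permutes_id block_perm_def)
  have last: "p (Suc (2 * M)) = Suc (2 * k)" if "p \<in> S k" for p k
    using that by (auto simp: S_def block_perm_def dest!: spec[of _ M])
  \<comment> \<open>If the first M pairs of positions fill whole pairs of values, the last two
    positions receive a pair as well.\<close>
  have block: "block_perm (Suc M) p" if p: "p permutes {..<?n}" "block_perm M p" for p
  proof -
    define i where "i = partner (p (2 * M))"
    have "p (2 * M) < 2 * Suc M" using permutes_in_image[OF p(1), of "2 * M"] by simp
    then have "i < ?n" using partner_less[of "p (2 * M)" "Suc M"] by (simp add: i_def)
    then obtain j where j: "j < ?n" "p j = i"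
      using permutes_image[OF p(1)] by (metis imageE lessThan_iff)
    have "j \<noteq> 2 * M" using j by (metis i_def partner_simps(4))
    moreover have "\<not> j < 2 * M"
    proof
      assume "j < 2 * M"
      then have "p (partner j) = p (2 * M)" using block_perm_partner[OF p(2), of j] j by (simp add: i_def)
      then have "partner j = 2 * M" using injD[OF permutes_inj[OF p(1)]] by blast
      then show False using partner_less[of j M] \<open>j < 2 * M\<close> by simp
    qed
    ultimately have "j = Suc (2 * M)" using j by simp
    then show ?thesis using p(2) j by (auto simp: block_perm_def less_Suc_eq i_def)
  qed
  define W where "W = (\<Prod>l<Suc M. \<sigma> l)"
  have W: "W > 0" unfolding W_def by (intro prod_pos) (auto intro: \<sigma>_pos)
  \<comment> \<open>\<open>signed_weight\<close> is applied with all M + 1 pairs; the factor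
    belonging to the last pair is \<sigma>_k and is divided out.\<close>
  have sw: "of_int (sign p) * weight M p = W / \<sigma> k" if "p \<in> S k" for p k
  proof -
    have p: "p permutes {..<?n}" "block_perm (Suc M) p" "p (2 * M) = 2 * k" using that by (auto simp: S_def)
    have "of_int (sign p) * weight (Suc M) p = (\<Prod>l<Suc M. \<sigma> (p (2 * l) div 2))"
      by (rule signed_weight[OF p(1,2)]) simp
    also have "\<dots> = W"
      unfolding W_def
    proof (rule prod.reindex_bij_betw)
      have inj: "inj_on (\<lambda>l. p (2 * l) div 2) {..<Suc M}"
      proof (rule inj_onI)
        fix a b assume ab: "a \<in> {..<Suc M}" "b \<in> {..<Suc M}" "p (2 * a) div 2 = p (2 * b) div 2"
        then have "p (2 * a) = p (2 * b) \<or> p (2 * a) = partner (p (2 * b))"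
          by (cases "even (p (2 * a))"; cases "even (p (2 * b))") (auto simp: partner_def elim!: evenE oddE)
        moreover have "partner (p (2 * b)) = p (Suc (2 * b))" using p(2) ab by (auto simp: block_perm_def)
        ultimately have "2 * a = 2 * b \<or> 2 * a = Suc (2 * b)" using injD[OF permutes_inj[OF p(1)]] by metis
        then show "a = b" by presburger
      qed
      moreover have "p (2 * l) div 2 < Suc M" if "l < Suc M" for l
        using permutes_in_image[OF p(1), of "2 * l"] that by auto
      ultimately show "bij_betw (\<lambda>l. p (2 * l) div 2) {..<Suc M} {..<Suc M}"
        unfolding bij_betw_def using endo_inj_surj[OF _ _ inj] by (simp add: image_subset_iff)
    qed
    finally have "of_int (sign p) * (weight M p * \<sigma> k) = W"
      using p last[OF that] s_even[of k] by (simp add: weight_def)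
    then show ?thesis using \<sigma>_pos[of k] by (simp add: field_simps)
  qed
  define N where "N = real (card (S M))"
  have cardS: "real (card (S k)) = N" if "k < Suc M" for k
  proof -
    \<comment> \<open>Exchanges the pairs k and M of values; composition with this involution maps
      \<open>S k\<close> bijectively to \<open>S M\<close>.\<close>
    define \<rho> where "\<rho> = (\<lambda>i. if i div 2 = k then 2 * M + i mod 2 else if i div 2 = M then 2 * k + i mod 2 else i)"
    have rr: "\<rho> (\<rho> i) = i" for i
      by (auto simp: \<rho>_def)
    have rp: "\<rho> (partner i) = partner (\<rho> i)" for i
      by (cases "even i") (auto simp: \<rho>_def partner_def elim!: evenE oddE)
    have r: "\<rho> permutes {..<?n}"
    proof (rule bij_imp_permutes)
      show "bij_betw \<rho> {..<?n} {..<?n}"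
        by (rule bij_betwI[of _ _ _ \<rho>]) (use that rr in \<open>auto simp: \<rho>_def\<close>)
      show "\<rho> x = x" if "x \<notin> {..<?n}" for x using that \<open>k < Suc M\<close> by (auto simp: \<rho>_def)
    qed
    have rk: "\<rho> (2 * k) = 2 * M" "\<rho> (2 * M) = 2 * k" by (auto simp: \<rho>_def)
    have map: "\<rho> \<circ> p \<in> S b" if "p \<in> S a" "\<rho> (2 * a) = 2 * b" for p a b
      using that permutes_compose[OF _ r] by (auto simp: S_def block_perm_def rp)
    have "bij_betw (\<lambda>p. \<rho> \<circ> p) (S k) (S M)"
      by (rule bij_betwI[of _ _ _ "\<lambda>p. \<rho> \<circ> p"]) (use map rk rr in \<open>auto simp: fun_eq_iff\<close>)
    then show ?thesis by (simp add: N_def bij_betw_same_card)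
  qed
  have N: "N > 0" using idS finS by (auto simp: N_def card_gt_0_iff)
  have "(\<Sum>p | p permutes {..<?n}. of_int (sign p) * (weight M p * \<mu> (p (2 * M)) * f (p (Suc (2 * M))))) =
     N * W * (\<Sum>k<Suc M. \<mu> (2 * k) / \<sigma> k * f (Suc (2 * k)))" for f
  proof -
    let ?t = "\<lambda>p. of_int (sign p) * (weight M p * \<mu> (p (2 * M)) * f (p (Suc (2 * M))))"
    have "(\<Sum>p | p permutes {..<?n}. ?t p) = (\<Sum>p\<in>(\<Union>k\<in>{..<Suc M}. S k). ?t p)"
    proof (rule sum.mono_neutral_right)
      show "\<forall>p\<in>{p. p permutes {..<?n}} - (\<Union>k\<in>{..<Suc M}. S k). ?t p = 0"
      proof
        fix p assume p: "p \<in> {p. p permutes {..<?n}} - (\<Union>k\<in>{..<Suc M}. S k)"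
        show "?t p = 0"
        proof (rule ccontr)
          assume "?t p \<noteq> 0"
          then have "weight M p \<noteq> 0" "\<mu> (p (2 * M)) \<noteq> 0" by auto
          then have "block_perm M p" "even (p (2 * M))" using weight_eq_0 \<mu>_0 by blast+
          moreover have "p (2 * M) < ?n" using p permutes_in_image[of p "{..<?n}" "2 * M"] by simp
          ultimately have "p \<in> S (p (2 * M) div 2)" "p (2 * M) div 2 < Suc M" using p block by (auto simp: S_def)
          then show False using p by blast
        qed
      qed
    qed (auto simp: finite_permutations S_def)
    also have "\<dots> = (\<Sum>k<Suc M. \<Sum>p\<in>S k. ?t p)"
      using finS by (intro sum.UNION_disjoint) (auto simp: S_def)
    also have "\<dots> = (\<Sum>k<Suc M. \<Sum>p\<in>S k. W / \<sigma> k * (\<mu> (2 * k) * f (Suc (2 * k))))"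
    proof (intro sum.cong refl)
      fix k p assume p: "p \<in> S k"
      have "p (2 * M) = 2 * k" using p by (simp add: S_def)
      then show "?t p = W / \<sigma> k * (\<mu> (2 * k) * f (Suc (2 * k)))"
        unfolding sw[OF p, symmetric] last[OF p] by (simp add: mult.assoc)
    qed
    also have "\<dots> = (\<Sum>k<Suc M. N * (W / \<sigma> k * (\<mu> (2 * k) * f (Suc (2 * k)))))"
      by (intro sum.cong refl) (simp add: cardS)
    also have "\<dots> = N * W * (\<Sum>k<Suc M. \<mu> (2 * k) / \<sigma> k * f (Suc (2 * k)))"
      unfolding sum_distrib_left by (intro sum.cong refl) simp
    finally show ?thesis .
  qed
  then show ?thesis using N W by (intro exI[of _ "N * W"]) auto
qed

end

subsection \<open>The expected characteristic polynomial\<close>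

lemma borel_measurable_fun_upd_leb:
  assumes "f \<in> borel_measurable (leb {..<Suc n})"
  shows "(\<lambda>(x, y). f (x(n := y))) \<in> borel_measurable (leb {..<n} \<Otimes>\<^sub>M lborel)"
  using measurable_compose[OF measurable_leb_fun_upd_lessThan[of fst "leb {..<n} \<Otimes>\<^sub>M lborel" n snd] assms]
  by (simp add: split_beta')

lemma integral_leb_Suc_product:
  fixes f F :: "(nat \<Rightarrow> real) \<Rightarrow> real" and g :: "real \<Rightarrow> real"
  assumes f [measurable]: "f \<in> borel_measurable (leb {..<Suc n})" and feq: "\<And>x y. f (x(n := y)) = F x * g y"
    and F: "integrable (leb {..<n}) F" and g: "integrable lborel g"
  shows "integrable (leb {..<Suc n}) f" "(LINT x|leb {..<Suc n}. f x) = (LINT x|leb {..<n}. F x) * (LINT y|lborel. g y)"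
proof -
  have [measurable]: "F \<in> borel_measurable (leb {..<n})" "g \<in> borel_measurable borel" using F g by auto
  show int: "integrable (leb {..<Suc n}) f"
  proof (rule integrableI_bounded[OF f])
    have "(\<integral>\<^sup>+x. ennreal (norm (f x)) \<partial>leb {..<Suc n}) = (\<integral>\<^sup>+x. \<integral>\<^sup>+y. ennreal \<bar>F x\<bar> * ennreal \<bar>g y\<bar> \<partial>lborel \<partial>leb {..<n})"
      by (subst nn_integral_leb_Suc(1)) (measurable, simp add: feq abs_mult ennreal_mult)
    also have "\<dots> = (\<integral>\<^sup>+x. ennreal \<bar>F x\<bar> \<partial>leb {..<n}) * (\<integral>\<^sup>+y. ennreal \<bar>g y\<bar> \<partial>lborel)"
      by (simp add: nn_integral_cmult nn_integral_multc)
    also have "\<dots> < \<infinity>"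
      using F g by (simp add: integrable_iff_bounded ennreal_mult_less_top)
    finally show "(\<integral>\<^sup>+x. ennreal (norm (f x)) \<partial>leb {..<Suc n}) < \<infinity>" .
  qed
  have "(LINT x|leb {..<Suc n}. f x) = (LINT x|leb {..<n}. LINT y|lborel. f (x(n := y)))"
    using leb.product_integral_insert[of "{..<n}" n f] int by (simp add: lessThan_Suc)
  also have "\<dots> = (LINT x|leb {..<n}. F x) * (LINT y|lborel. g y)" by (simp add: feq)
  finally show "(LINT x|leb {..<Suc n}. f x) = (LINT x|leb {..<n}. F x) * (LINT y|lborel. g y)" .
qed

text \<open>The last two variables stay coupled by \<open>g\<close>, which will be the sign of their
  difference times weighted polynomials.\<close>

lemma integral_leb_Suc_Suc_product:
  fixes f F :: "(nat \<Rightarrow> real) \<Rightarrow> real" and g :: "real \<Rightarrow> real \<Rightarrow> real"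
  assumes f [measurable]: "f \<in> borel_measurable (leb {..<Suc (Suc n)})"
    and feq: "\<And>x y z. f (x(n := y, Suc n := z)) = F x * g y z"
    and F: "integrable (leb {..<n}) F" and g: "integrable (lborel \<Otimes>\<^sub>M lborel) (\<lambda>(y, z). g y z)"
  shows "integrable (leb {..<Suc (Suc n)}) f"
    "(LINT x|leb {..<Suc (Suc n)}. f x) = (LINT x|leb {..<n}. F x) * (LINT (y, z)|(lborel \<Otimes>\<^sub>M lborel). g y z)"
proof -
  have [measurable]: "F \<in> borel_measurable (leb {..<n})" using F by auto
  have gm [measurable]: "(\<lambda>(y, z). g y z) \<in> borel_measurable (lborel \<Otimes>\<^sub>M lborel)" using g by (rule borel_measurable_integrable)
  note fm [measurable] = borel_measurable_fun_upd_leb[OF f]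
  have gz [measurable]: "(\<lambda>z. g y z) \<in> borel_measurable lborel" for y
    using measurable_compose[OF measurable_Pair1'[of y lborel lborel] gm] by simp
  have gn: "(\<integral>\<^sup>+y. \<integral>\<^sup>+z. ennreal \<bar>g y z\<bar> \<partial>lborel \<partial>lborel) < \<infinity>"
  proof -
    have "(\<lambda>(y, z). ennreal \<bar>g y z\<bar>) \<in> borel_measurable (lborel \<Otimes>\<^sub>M lborel)"
      using gm by (simp add: split_beta')
    from lborel.nn_integral_fst[OF this] show ?thesis
      using g by (simp add: integrable_iff_bounded split_beta')
  qed
  have gin [measurable]: "(\<lambda>y. \<integral>\<^sup>+z. ennreal \<bar>g y z\<bar> \<partial>lborel) \<in> borel_measurable lborel"
    by (rule lborel.borel_measurable_nn_integral) (use gm in \<open>simp add: split_beta'\<close>)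
  show int: "integrable (leb {..<Suc (Suc n)}) f"
  proof (rule integrableI_bounded[OF f])
    have m1: "(\<lambda>x. \<integral>\<^sup>+z. ennreal \<bar>f (x(Suc n := z))\<bar> \<partial>lborel) \<in> borel_measurable (leb {..<Suc n})"
      by (rule lborel.borel_measurable_nn_integral) (use fm in \<open>simp add: split_beta'\<close>)
    have "(\<integral>\<^sup>+x. ennreal (norm (f x)) \<partial>leb {..<Suc (Suc n)}) = (\<integral>\<^sup>+x. \<integral>\<^sup>+z. ennreal \<bar>f (x(Suc n := z))\<bar> \<partial>lborel \<partial>leb {..<Suc n})"
      by (subst nn_integral_leb_Suc(1)) (use f in simp_all)
    also have "\<dots> = (\<integral>\<^sup>+x. \<integral>\<^sup>+y. \<integral>\<^sup>+z. ennreal \<bar>F x\<bar> * ennreal \<bar>g y z\<bar> \<partial>lborel \<partial>lborel \<partial>leb {..<n})"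
      by (subst nn_integral_leb_Suc(1)[OF m1]) (simp add: feq abs_mult ennreal_mult)
    also have "\<dots> = (\<integral>\<^sup>+x. ennreal \<bar>F x\<bar> * (\<integral>\<^sup>+y. \<integral>\<^sup>+z. ennreal \<bar>g y z\<bar> \<partial>lborel \<partial>lborel) \<partial>leb {..<n})"
      using gin by (simp add: nn_integral_cmult)
    also have "\<dots> = (\<integral>\<^sup>+x. ennreal \<bar>F x\<bar> \<partial>leb {..<n}) * (\<integral>\<^sup>+y. \<integral>\<^sup>+z. ennreal \<bar>g y z\<bar> \<partial>lborel \<partial>lborel)"
      by (rule nn_integral_multc) measurable
    also have "\<dots> < \<infinity>"
      using F gn by (simp add: integrable_iff_bounded ennreal_mult_less_top)
    finally show "(\<integral>\<^sup>+x. ennreal (norm (f x)) \<partial>leb {..<Suc (Suc n)}) < \<infinity>" .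
  qed
  define h where "h = (\<lambda>x. LINT z|lborel. f (x(Suc n := z)))"
  have h: "h \<in> borel_measurable (leb {..<Suc n})"
    unfolding h_def by (rule lborel.borel_measurable_lebesgue_integral) (use fm in simp)
  have heq: "h (x(n := y)) = F x * (LINT z|lborel. g y z)" for x y
    by (simp add: h_def feq)
  have G: "integrable lborel (\<lambda>y. LINT z|lborel. g y z)"
    using lborel_pair.integrable_fst'[OF g] by simp
  have "(LINT x|leb {..<Suc (Suc n)}. f x) = (LINT x|leb {..<Suc n}. h x)"
    using leb.product_integral_insert[of "{..<Suc n}" "Suc n" f] int by (simp add: lessThan_Suc h_def)
  also have "\<dots> = (LINT x|leb {..<n}. F x) * (LINT y|lborel. LINT z|lborel. g y z)"
    by (rule integral_leb_Suc_product(2)[OF h heq F G])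
  also have "(LINT y|lborel. LINT z|lborel. g y z) = (LINT (y, z)|(lborel \<Otimes>\<^sub>M lborel). g y z)"
    by (rule lborel_pair.integral_fst[OF g])
  finally show "(LINT x|leb {..<Suc (Suc n)}. f x) = (LINT x|leb {..<n}. F x) * (LINT (y, z)|(lborel \<Otimes>\<^sub>M lborel). g y z)" .
qed

lemma integrable_pair_product:
  fixes f g :: "real \<Rightarrow> real"
  assumes f: "integrable lborel f" and g: "integrable lborel g"
  shows "integrable (lborel \<Otimes>\<^sub>M lborel) (\<lambda>(x, y). f x * g y)"
proof (rule integrableI_bounded)
  have [measurable]: "f \<in> borel_measurable borel" "g \<in> borel_measurable borel" using f g by auto
  show "(\<lambda>(x, y). f x * g y) \<in> borel_measurable (lborel \<Otimes>\<^sub>M lborel)" by measurable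
  have "(\<integral>\<^sup>+z. ennreal (norm (case z of (x, y) \<Rightarrow> f x * g y)) \<partial>(lborel \<Otimes>\<^sub>M lborel)) = (\<integral>\<^sup>+x. \<integral>\<^sup>+y. ennreal \<bar>f x\<bar> * ennreal \<bar>g y\<bar> \<partial>lborel \<partial>lborel)"
    by (subst lborel.nn_integral_fst[symmetric]) (measurable, simp add: abs_mult ennreal_mult)
  also have "\<dots> = (\<integral>\<^sup>+x. ennreal \<bar>f x\<bar> \<partial>lborel) * (\<integral>\<^sup>+y. ennreal \<bar>g y\<bar> \<partial>lborel)"
    by (simp add: nn_integral_cmult nn_integral_multc)
  also have "\<dots> < \<infinity>"
    using f g by (simp add: integrable_iff_bounded ennreal_mult_less_top)
  finally show "(\<integral>\<^sup>+z. ennreal (norm (case z of (x, y) \<Rightarrow> f x * g y)) \<partial>(lborel \<Otimes>\<^sub>M lborel)) < \<infinity>" .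
qed

section \<open>Skew products as integrals against the weight\<close>

locale moment_weight =
  fixes w :: "real \<Rightarrow> real"
  assumes w_measurable [measurable]: "w \<in> borel_measurable borel" and w_nonneg: "\<And>x. w x \<ge> 0"
    and moments: "\<And>k::nat. integrable lborel (\<lambda>x. x ^ k * w x)"
begin

lemma integrable_poly_weight: "integrable lborel (\<lambda>x. poly p x * w x)"
proof -
  have "(\<lambda>x. poly p x * w x) = (\<lambda>x. \<Sum>i\<le>degree p. coeff p i * (x ^ i * w x))"
    by (simp add: poly_altdef sum_distrib_right mult.assoc)
  then show ?thesis using moments by simp
qed

lemma skew_integrable:
  "integrable (lborel \<Otimes>\<^sub>M lborel) (\<lambda>(x, y). sgn (y - x) * (poly p x * w x * (poly q y * w y)))"
proof (rule Bochner_Integration.integrable_bound[OF integrable_pair_product[OF integrable_poly_weight[of p] integrable_poly_weight[of q]]])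
  show "AE z in lborel \<Otimes>\<^sub>M lborel. norm (case z of (x, y) \<Rightarrow> sgn (y - x) * (poly p x * w x * (poly q y * w y))) \<le> norm (case z of (x, y) \<Rightarrow> poly p x * w x * (poly q y * w y))"
    by (auto simp: abs_mult sgn_real_def)
qed measurable

text \<open>The sign is 0 on the diagonal, so the two half-plane integrands combine
  pointwise.\<close>

lemma skew_form_sgn: "skew_form w p q = (LINT (x, y)|(lborel \<Otimes>\<^sub>M lborel). sgn (y - x) * (poly p x * w x * (poly q y * w y)))"
proof -
  let ?f = "\<lambda>z. case z of (x, y) \<Rightarrow> poly p x * w x * (poly q y * w y)"
  have int: "integrable (lborel \<Otimes>\<^sub>M lborel) ?f"
    using integrable_pair_product[OF integrable_poly_weight[of p] integrable_poly_weight[of q]] .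
  have "{z \<in> space (lborel \<Otimes>\<^sub>M lborel). fst z < (snd z :: real)} \<in> sets (lborel \<Otimes>\<^sub>M lborel)"
    "{z \<in> space (lborel \<Otimes>\<^sub>M lborel). fst z > (snd z :: real)} \<in> sets (lborel \<Otimes>\<^sub>M lborel)" by measurable
  then have m: "{(x :: real, y :: real). x < y} \<in> sets (lborel \<Otimes>\<^sub>M lborel)" "{(x :: real, y :: real). x > y} \<in> sets (lborel \<Otimes>\<^sub>M lborel)"
    by (simp_all add: space_pair_measure split_beta')
  have i1: "integrable (lborel \<Otimes>\<^sub>M lborel) (\<lambda>z. indicat_real {(x, y). x < y} z *\<^sub>R ?f z)"
    "integrable (lborel \<Otimes>\<^sub>M lborel) (\<lambda>z. indicat_real {(x, y). x > y} z *\<^sub>R ?f z)"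
    using int m by (intro integrable_mult_indicator; simp)+
  have "skew_form w p q = (LINT z|(lborel \<Otimes>\<^sub>M lborel). indicat_real {(x, y). x < y} z *\<^sub>R ?f z) - (LINT z|(lborel \<Otimes>\<^sub>M lborel). indicat_real {(x, y). x > y} z *\<^sub>R ?f z)"
    unfolding skew_form_def set_lebesgue_integral_def
    by (intro arg_cong2[where f = "(-)"] Bochner_Integration.integral_cong) (auto simp: mult_ac)
  also have "\<dots> = (LINT z|(lborel \<Otimes>\<^sub>M lborel). indicat_real {(x, y). x < y} z *\<^sub>R ?f z - indicat_real {(x, y). x > y} z *\<^sub>R ?f z)"
    using i1 by (rule Bochner_Integration.integral_diff[symmetric])
  also have "\<dots> = (LINT (x, y)|(lborel \<Otimes>\<^sub>M lborel). sgn (y - x) * (poly p x * w x * (poly q y * w y)))"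
    by (intro Bochner_Integration.integral_cong) (auto simp: indicator_def sgn_real_def)
  finally show ?thesis .
qed

definition poly_weight :: "nat \<Rightarrow> (nat \<Rightarrow> real poly) \<Rightarrow> (nat \<Rightarrow> real) \<Rightarrow> real" where
  "poly_weight n f l = (\<Prod>i<n. poly (f i) (l i) * w (l i))"

lemma measurable_poly_weight [measurable]: "poly_weight n f \<in> borel_measurable (leb {..<n})"
proof -
  have [measurable]: "(\<lambda>x. x i) \<in> borel_measurable (leb {..<n})" for i by (rule measurable_leb_coordinate)
  show ?thesis unfolding poly_weight_def by measurable
qed

lemma integrable_poly_weight_leb: "integrable (leb {..<n}) (poly_weight n f)"
  unfolding poly_weight_def
  by (rule leb.product_integrable_prod) (auto intro: integrable_poly_weight)

text \<open>Sign and product both factor over the pairs of variables: peeling off two variables at a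
  time yields one skew product each, and for odd n the unpaired last variable yields a moment.
  Integrability is carried along because Fubini needs it.\<close>

lemma pair_sign_poly_weight:
  "integrable (leb {..<n}) (\<lambda>l. pair_sign n l * poly_weight n f l) \<and>
   (LINT l|leb {..<n}. pair_sign n l * poly_weight n f l) =
     (\<Prod>k<n div 2. skew_form w (f (2 * k)) (f (2 * k + 1))) * (if odd n then LINT x|lborel. poly (f (n - 1)) x * w x else 1)"
proof -
  have even: "integrable (leb {..<2 * M}) (\<lambda>l. pair_sign (2 * M) l * poly_weight (2 * M) f l) \<and>
   (LINT l|leb {..<2 * M}. pair_sign (2 * M) l * poly_weight (2 * M) f l) = (\<Prod>k<M. skew_form w (f (2 * k)) (f (2 * k + 1)))" for M
  proof (induction M)
    case 0
    have "(\<lambda>l. pair_sign 0 l * poly_weight 0 f l) = (\<lambda>_. 1)" by (simp add: pair_sign_def poly_weight_def)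
    then show ?case by (simp add: PiM_empty lebesgue_integral_count_space_finite integrable_count_space)
  next
    case (Suc M)
    let ?g = "\<lambda>y z. sgn (z - y) * (poly (f (2 * M)) y * w y * (poly (f (Suc (2 * M))) z * w z))"
    let ?F = "\<lambda>l. pair_sign (2 * M) l * poly_weight (2 * M) f l"
    have eq: "pair_sign (Suc (Suc (2 * M))) (x(2 * M := y, Suc (2 * M) := z)) * poly_weight (Suc (Suc (2 * M))) f (x(2 * M := y, Suc (2 * M) := z)) = ?F x * ?g y z" for x y z
    proof -
      have "pair_sign (2 * M) (x(2 * M := y, Suc (2 * M) := z)) = pair_sign (2 * M) x" by (rule pair_sign_cong) simp
      then have "pair_sign (Suc (Suc (2 * M))) (x(2 * M := y, Suc (2 * M) := z)) = pair_sign (2 * M) x * sgn (z - y)"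
        by (simp add: pair_sign_def)
      moreover have "poly_weight (2 * M) f (x(2 * M := y, Suc (2 * M) := z)) = poly_weight (2 * M) f x"
        unfolding poly_weight_def by (intro prod.cong) auto
      then have "poly_weight (Suc (Suc (2 * M))) f (x(2 * M := y, Suc (2 * M) := z)) = poly_weight (2 * M) f x * (poly (f (2 * M)) y * w y) * (poly (f (Suc (2 * M))) z * w z)"
        by (simp add: poly_weight_def)
      ultimately show ?thesis by (simp add: mult_ac)
    qed
    have "(\<lambda>l. pair_sign (Suc (Suc (2 * M))) l * poly_weight (Suc (Suc (2 * M))) f l) \<in> borel_measurable (leb {..<Suc (Suc (2 * M))})"
      by measurable
    from integral_leb_Suc_Suc_product[OF this eq conjunct1[OF Suc.IH] skew_integrable]
    show ?case using Suc.IH by (simp add: skew_form_sgn[symmetric])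
  qed
  show ?thesis
  proof (cases "even n")
    case True
    then obtain M where "n = 2 * M" by (elim evenE)
    then show ?thesis using even[of M] by simp
  next
    case False
    then obtain M where n: "n = Suc (2 * M)" by (elim oddE) simp
    let ?F = "\<lambda>l. pair_sign (2 * M) l * poly_weight (2 * M) f l"
    have eq: "pair_sign (Suc (2 * M)) (x(2 * M := y)) * poly_weight (Suc (2 * M)) f (x(2 * M := y)) = ?F x * (poly (f (2 * M)) y * w y)" for x y
    proof -
      have "pair_sign (2 * M) (x(2 * M := y)) = pair_sign (2 * M) x" by (rule pair_sign_cong) simp
      then have "pair_sign (Suc (2 * M)) (x(2 * M := y)) = pair_sign (2 * M) x"
        by (simp add: pair_sign_def)
      moreover have "poly_weight (2 * M) f (x(2 * M := y)) = poly_weight (2 * M) f x"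
        unfolding poly_weight_def by (intro prod.cong) auto
      then have "poly_weight (Suc (2 * M)) f (x(2 * M := y)) = poly_weight (2 * M) f x * (poly (f (2 * M)) y * w y)"
        by (simp add: poly_weight_def)
      ultimately show ?thesis by (simp add: mult_ac)
    qed
    have "(\<lambda>l. pair_sign (Suc (2 * M)) l * poly_weight (Suc (2 * M)) f l) \<in> borel_measurable (leb {..<Suc (2 * M)})"
      by measurable
    from integral_leb_Suc_product[OF this eq conjunct1[OF even] integrable_poly_weight]
    show ?thesis unfolding n using even[of M] by simp
  qed
qed

text \<open>The unnormalised joint density of the ordered eigenvalues.\<close>

definition root_density :: "nat \<Rightarrow> (nat \<Rightarrow> real) \<Rightarrow> real" where
  "root_density n l = (if chamber n l then vdm n l * (\<Prod>i<n. w (l i)) else 0)"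

lemma measurable_prod_weight [measurable]: "(\<lambda>l. \<Prod>i<n. w (l i)) \<in> borel_measurable (leb {..<n})"
proof -
  have [measurable]: "(\<lambda>x. x i) \<in> borel_measurable (leb {..<n})" for i by (rule measurable_leb_coordinate)
  show ?thesis by measurable
qed

lemma measurable_root_density [measurable]: "root_density n \<in> borel_measurable (leb {..<n})"
  unfolding root_density_def by measurable

lemma root_density_nonneg: "root_density n l \<ge> 0"
  unfolding root_density_def using vdm_pos[of n l] by (auto intro!: mult_nonneg_nonneg prod_nonneg w_nonneg)

end

section \<open>The skew-orthogonal system\<close>

locale skew_orthogonal = moment_weight w for w +
  fixes \<phi> :: "nat \<Rightarrow> real poly" and \<sigma> \<gamma> :: "nat \<Rightarrow> real"
  assumes system: "skew_orthogonal_system w \<phi> \<sigma> \<gamma>"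
begin

lemmas system_conjuncts = system[unfolded skew_orthogonal_system_def]
lemmas \<phi> = system_conjuncts[THEN conjunct1, rule_format]
lemmas \<sigma>_positive = system_conjuncts[THEN conjunct2, THEN conjunct1, rule_format]
lemmas skew_even = system_conjuncts[THEN conjunct2, THEN conjunct2, THEN conjunct1, rule_format]
lemmas skew_odd = system_conjuncts[THEN conjunct2, THEN conjunct2, THEN conjunct2, THEN conjunct1, rule_format]
lemmas skew_zero = system_conjuncts[THEN conjunct2, THEN conjunct2, THEN conjunct2, THEN conjunct2, THEN conjunct1, THEN spec, THEN spec, THEN mp]
lemmas moment_even = system_conjuncts[THEN conjunct2, THEN conjunct2, THEN conjunct2, THEN conjunct2, THEN conjunct2, THEN conjunct1, THEN spec, THEN mp]
lemmas moment_odd = system_conjuncts[THEN conjunct2, THEN conjunct2, THEN conjunct2, THEN conjunct2, THEN conjunct2, THEN conjunct2, THEN conjunct1, THEN spec, THEN mp]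
lemmas \<gamma>_quotient = system_conjuncts[THEN conjunct2, THEN conjunct2, THEN conjunct2, THEN conjunct2, THEN conjunct2, THEN conjunct2, THEN conjunct2, THEN spec]

lemma coeff_\<phi>: "coeff (\<phi> i) i = 1"
  using \<phi>[of i] by metis

sublocale skew_pairing "\<lambda>i j. skew_form w (\<phi> i) (\<phi> j)" \<sigma> "\<lambda>i. LINT x|lborel. poly (\<phi> i) x * w x"
proof
  show "skew_form w (\<phi> i) (\<phi> j) = 0" if "j \<noteq> partner i" for i j
    by (rule skew_zero) (use that in auto)
  show "(LINT x|lborel. poly (\<phi> i) x * w x) > 0" if "even i" for i
    using moment_even[OF that] by simp
qed (rule skew_even skew_odd \<sigma>_positive moment_odd, assumption?)+

lemma \<gamma>_even: "even i \<Longrightarrow> (LINT x|lborel. poly (\<phi> i) x * w x) = \<gamma> i" "even i \<Longrightarrow> \<gamma> i > 0"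
  and \<gamma>_odd: "\<gamma> (Suc (2 * k)) = \<sigma> k / \<gamma> (2 * k)"
  using moment_even[of i] \<gamma>_quotient[of k] by simp_all

lemma \<gamma>_pos: "\<gamma> i > 0"
proof (cases "even i")
  case False
  then obtain k where "i = Suc (2 * k)" by (elim oddE) simp
  then show ?thesis using \<gamma>_odd[of k] \<sigma>_pos[of k] \<gamma>_even(2)[of "2 * k"] by simp
qed (rule \<gamma>_even(2))

text \<open>The leading term is absorbed as the summand k = M, whose quotient is 1.\<close>

lemma phi_hat_odd: "phi_hat \<phi> \<gamma> (Suc (2 * M)) = (\<Sum>k<Suc M. Polynomial.smult (\<gamma> (Suc (2 * M)) / \<gamma> (Suc (2 * k))) (\<phi> (Suc (2 * k))))"
proof -
  have "{k. odd k \<and> k < Suc (2 * M)} = (\<lambda>k. Suc (2 * k)) ` {..<M}"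
    by (auto elim!: oddE)
  moreover have "inj_on (\<lambda>k. Suc (2 * k)) {..<M}" by (auto simp: inj_on_def)
  ultimately show ?thesis
    using \<gamma>_pos[of "Suc (2 * M)"] by (simp add: phi_hat_def sum.reindex o_def add.commute)
qed

text \<open>For odd n, \<open>phi_hat \<phi> \<gamma> n\<close> divided by \<gamma>_n is a partial
  sum of the \<phi>_k / \<gamma>_k over odd k, so consecutive ones differ by a single term.\<close>

lemma phi_hat_inverse:
  "\<phi> n = (if even n then phi_hat \<phi> \<gamma> n else if n = 1 then phi_hat \<phi> \<gamma> n
     else phi_hat \<phi> \<gamma> n - Polynomial.smult (\<gamma> n / \<gamma> (n - 2)) (phi_hat \<phi> \<gamma> (n - 2)))"
proof (cases "even n \<or> n = 1")
  case True
  have "{k :: nat. odd k \<and> k < 1} = {}" by (auto intro: odd_pos)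
  then have "phi_hat \<phi> \<gamma> 1 = \<phi> 1" unfolding phi_hat_def by (simp only: sum.empty) simp
  moreover have "even n \<Longrightarrow> phi_hat \<phi> \<gamma> n = \<phi> n" by (simp only: phi_hat_def if_True)
  ultimately show ?thesis using True by (cases "even n") simp_all
next
  case False
  then obtain M where n: "n = Suc (2 * Suc M)"
    by (metis (no_types, lifting) One_nat_def Suc_eq_plus1 mult_0_right not0_implies_Suc oddE)
  have "Polynomial.smult (\<gamma> n / \<gamma> (n - 2)) (phi_hat \<phi> \<gamma> (n - 2)) = (\<Sum>k<Suc M. Polynomial.smult (\<gamma> n / \<gamma> (Suc (2 * k))) (\<phi> (Suc (2 * k))))"
    using \<gamma>_pos[of "Suc (2 * M)"] phi_hat_odd[of M] by (simp add: n smult_sum2 smult_add_right)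
  moreover have "phi_hat \<phi> \<gamma> n = (\<Sum>k<Suc M. Polynomial.smult (\<gamma> n / \<gamma> (Suc (2 * k))) (\<phi> (Suc (2 * k)))) + \<phi> n"
    using \<gamma>_pos[of n] phi_hat_odd[of "Suc M"] by (simp add: n)
  ultimately show ?thesis using False by simp
qed

text \<open>Expanding the Vandermonde determinant shows that the integral is a polynomial
  \<open>P\<close> in x with x^n coefficient \<open>Z\<close>, and the permutation sums identify
  \<open>c\<close> times \<open>P\<close> as a positive multiple of the monic polynomial
  \<open>phi_hat\<close>. Comparing x^n coefficients gives c Z > 0, so \<open>c\<close> can be
  cancelled.\<close>

lemma integral_root_density:
  fixes n :: nat
  defines "Z \<equiv> (LINT l|leb {..<n}. root_density n l)"
  shows "integrable (leb {..<n}) (\<lambda>l. root_density n l * poly (root_poly {..<n} l) x)"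
    and "(LINT l|leb {..<n}. root_density n l * poly (root_poly {..<n} l) x) = Z * poly (phi_hat \<phi> \<gamma> n) x"
    and "integrable (leb {..<n}) (root_density n)"
proof -
  \<comment> \<open>\<open>x\<close> enters as an additional last node, so that one Vandermonde
    product contains both the repulsion of the roots and the characteristic polynomial.\<close>
  define h where "h = (\<lambda>x l. vdm (Suc n) (l(n := x)) * (\<Prod>i<n. w (l i)))"
  have h_vdm: "h x l = vdm n l * poly (root_poly {..<n} l) x * (\<Prod>i<n. w (l i))" for x l
  proof -
    have "vdm n (l(n := x)) = vdm n l" by (rule vdm_cong) simp
    then show ?thesis by (simp add: h_def vdm_Suc poly_root_poly)
  qed
  have h_leibniz: "h x l = (\<Sum>p | p permutes {..<Suc n}. of_int (sign p) * poly_weight n (\<lambda>i. \<phi> (p i)) l * poly (\<phi> (p n)) x)" for x l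
  proof -
    have "h x l = (\<Sum>p | p permutes {..<Suc n}. of_int (sign p) * (\<Prod>i<Suc n. poly (\<phi> (p i)) ((l(n := x)) i))) * (\<Prod>i<n. w (l i))"
      unfolding h_def leibniz_vdm[OF \<phi>] ..
    also have "\<dots> = (\<Sum>p | p permutes {..<Suc n}. of_int (sign p) * poly_weight n (\<lambda>i. \<phi> (p i)) l * poly (\<phi> (p n)) x)"
      unfolding sum_distrib_right
    proof (intro sum.cong refl)
      fix p
      have "(\<Prod>i<n. poly (\<phi> (p i)) ((l(n := x)) i)) = (\<Prod>i<n. poly (\<phi> (p i)) (l i))" by (intro prod.cong) auto
      then show "of_int (sign p) * (\<Prod>i<Suc n. poly (\<phi> (p i)) ((l(n := x)) i)) * (\<Prod>i<n. w (l i)) =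
        of_int (sign p) * poly_weight n (\<lambda>i. \<phi> (p i)) l * poly (\<phi> (p n)) x"
        by (simp add: poly_weight_def prod.distrib)
    qed
    finally show ?thesis .
  qed
  have vdm_leibniz: "vdm n l * (\<Prod>i<n. w (l i)) = (\<Sum>p | p permutes {..<n}. of_int (sign p) * poly_weight n (\<lambda>i. \<phi> (p i)) l)" for l
    unfolding leibniz_vdm[OF \<phi>, symmetric] sum_distrib_right by (simp add: poly_weight_def prod.distrib mult.assoc)
  have hint: "integrable (leb {..<n}) (h x)" for x
    unfolding h_leibniz by (intro Bochner_Integration.integrable_sum integrable_mult_left integrable_mult_right integrable_poly_weight_leb)
  have hm [measurable]: "h x \<in> borel_measurable (leb {..<n})" for x using hint by simp
  have ch: "integrable (leb {..<n}) (\<lambda>l. if chamber n l then f l else 0)" if "integrable (leb {..<n}) f" for f :: "(nat \<Rightarrow> real) \<Rightarrow> real"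
  proof -
    have [measurable]: "f \<in> borel_measurable (leb {..<n})" using that by simp
    show ?thesis by (rule Bochner_Integration.integrable_bound[OF that]) auto
  qed
  have dens: "root_density n l * poly (root_poly {..<n} l) x = (if chamber n l then h x l else 0)" for l x
    by (simp add: root_density_def h_vdm mult_ac)
  show "integrable (leb {..<n}) (\<lambda>l. root_density n l * poly (root_poly {..<n} l) x)"
    unfolding dens by (intro ch hint)
  have vint: "integrable (leb {..<n}) (\<lambda>l. vdm n l * (\<Prod>i<n. w (l i)))"
    unfolding vdm_leibniz by (intro Bochner_Integration.integrable_sum integrable_mult_right integrable_poly_weight_leb)
  show "integrable (leb {..<n}) (root_density n)"
    unfolding root_density_def by (intro ch vint)
  define a where "a = (\<lambda>p. LINT l|leb {..<n}. (if chamber n l then of_int (sign p) * poly_weight n (\<lambda>i. \<phi> (p i)) l else 0))"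
  have aint: "integrable (leb {..<n}) (\<lambda>l. if chamber n l then of_int (sign p) * poly_weight n (\<lambda>i. \<phi> (p i)) l else 0)" for p
    by (intro ch integrable_mult_right integrable_poly_weight_leb)
  define P where "P = (\<Sum>p | p permutes {..<Suc n}. Polynomial.smult (a p) (\<phi> (p n)))"
  have P: "poly P x = (LINT l|leb {..<n}. root_density n l * poly (root_poly {..<n} l) x)" for x
  proof -
    have "(LINT l|leb {..<n}. root_density n l * poly (root_poly {..<n} l) x) =
       (LINT l|leb {..<n}. (\<Sum>p | p permutes {..<Suc n}. (if chamber n l then of_int (sign p) * poly_weight n (\<lambda>i. \<phi> (p i)) l else 0) * poly (\<phi> (p n)) x))"
      unfolding dens by (intro Bochner_Integration.integral_cong refl) (simp add: h_leibniz)
    also have "\<dots> = (\<Sum>p | p permutes {..<Suc n}. LINT l|leb {..<n}. (if chamber n l then of_int (sign p) * poly_weight n (\<lambda>i. \<phi> (p i)) l else 0) * poly (\<phi> (p n)) x)"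
      by (intro Bochner_Integration.integral_sum integrable_mult_left aint)
    also have "\<dots> = poly P x"
      unfolding P_def poly_sum poly_smult a_def by (intro sum.cong refl Bochner_Integration.integral_mult_left aint)
    finally show ?thesis ..
  qed
  have coeff_P: "coeff P n = Z"
  proof -
    \<comment> \<open>Only permutations that fix the top index reach degree n, and these are the
      permutations of the first n indices.\<close>
    have perm: "{p. p permutes {..<Suc n} \<and> p n = n} = {p. p permutes {..<n}}"
      by (auto intro: permutes_subset simp: permutes_superset permutes_def) (metis less_antisym less_SucI)+
    have "coeff P n = (\<Sum>p | p permutes {..<Suc n}. if p n = n then a p else 0)"
      unfolding P_def coeff_sum coeff_smult
    proof (intro sum.cong refl)
      fix p assume "p \<in> {p. p permutes {..<Suc n}}"
      then have "p n \<le> n" using permutes_in_image[of p "{..<Suc n}" n] by auto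
      then show "a p * coeff (\<phi> (p n)) n = (if p n = n then a p else 0)"
        using \<phi>[of "p n"] coeff_\<phi>[of n] by (auto simp: coeff_eq_0)
    qed
    also have "\<dots> = (\<Sum>p | p permutes {..<n}. a p)"
      unfolding perm[symmetric] by (subst sum.inter_filter[symmetric]) (simp_all add: finite_permutations)
    also have "\<dots> = (LINT l|leb {..<n}. (\<Sum>p | p permutes {..<n}. if chamber n l then of_int (sign p) * poly_weight n (\<lambda>i. \<phi> (p i)) l else 0))"
      unfolding a_def by (intro Bochner_Integration.integral_sum[symmetric] aint)
    also have "\<dots> = Z"
      unfolding Z_def root_density_def vdm_leibniz by (intro Bochner_Integration.integral_cong refl) simp
    finally show ?thesis .
  qed
  have anti: "h x (\<lambda>i\<in>{..<n}. l (p i)) = of_int (sign p) * h x l" if p: "p permutes {..<n}" for p x l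
  proof -
    have "vdm n (\<lambda>i\<in>{..<n}. l (p i)) = vdm n (\<lambda>i. l (p i))" by (rule vdm_cong) simp
    moreover have "root_poly {..<n} (\<lambda>i\<in>{..<n}. l (p i)) = root_poly {..<n} l"
      using prod.permute[OF p, of "\<lambda>i. [:- l i, 1:]"] by (simp add: root_poly_def o_def)
    moreover have "(\<Prod>i<n. w ((\<lambda>i\<in>{..<n}. l (p i)) i)) = (\<Prod>i<n. w (l i))"
      using prod.permute[OF p, of "\<lambda>i. w (l i)"] by (simp add: o_def)
    ultimately show ?thesis unfolding h_vdm using vdm_permute[OF p, of l] by simp
  qed
  obtain c where c: "\<And>f. integrable (leb {..<n}) f \<Longrightarrow>
     (\<And>p l. p permutes {..<n} \<Longrightarrow> f (\<lambda>i\<in>{..<n}. l (p i)) = of_int (sign p) * f l) \<Longrightarrow>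
     (LINT l|leb {..<n}. pair_sign n l * f l) = c * (LINT l|leb {..<n}. (if chamber n l then f l else 0))"
    using integral_pair_sign_antisymmetric[of n] by blast
  have cP: "c * poly P x = (\<Sum>p | p permutes {..<Suc n}. of_int (sign p) *
     ((\<Prod>k<n div 2. skew_form w (\<phi> (p (2 * k))) (\<phi> (p (2 * k + 1)))) * (if odd n then LINT y|lborel. poly (\<phi> (p (n - 1))) y * w y else 1) * poly (\<phi> (p n)) x))" for x
  proof -
    have "c * poly P x = (LINT l|leb {..<n}. pair_sign n l * h x l)"
      unfolding P dens using c[OF hint anti] by simp
    also have "\<dots> = (LINT l|leb {..<n}. (\<Sum>p | p permutes {..<Suc n}. of_int (sign p) * poly (\<phi> (p n)) x * (pair_sign n l * poly_weight n (\<lambda>i. \<phi> (p i)) l)))"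
      by (intro Bochner_Integration.integral_cong refl) (simp add: h_leibniz sum_distrib_left mult_ac)
    also have "\<dots> = (\<Sum>p | p permutes {..<Suc n}. LINT l|leb {..<n}. of_int (sign p) * poly (\<phi> (p n)) x * (pair_sign n l * poly_weight n (\<lambda>i. \<phi> (p i)) l))"
      using pair_sign_poly_weight by (intro Bochner_Integration.integral_sum integrable_mult_right) auto
    also have "\<dots> = (\<Sum>p | p permutes {..<Suc n}. of_int (sign p) *
     ((\<Prod>k<n div 2. skew_form w (\<phi> (p (2 * k))) (\<phi> (p (2 * k + 1)))) * (if odd n then LINT y|lborel. poly (\<phi> (p (n - 1))) y * w y else 1) * poly (\<phi> (p n)) x))"
    proof (intro sum.cong refl)
      fix p
      have "(LINT l|leb {..<n}. of_int (sign p) * poly (\<phi> (p n)) x * (pair_sign n l * poly_weight n (\<lambda>i. \<phi> (p i)) l)) =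
        of_int (sign p) * poly (\<phi> (p n)) x * (LINT l|leb {..<n}. pair_sign n l * poly_weight n (\<lambda>i. \<phi> (p i)) l)"
        by (rule Bochner_Integration.integral_mult_right_zero)
      also have "\<dots> = of_int (sign p) * poly (\<phi> (p n)) x * ((\<Prod>k<n div 2. skew_form w (\<phi> (p (2 * k))) (\<phi> (p (2 * k + 1)))) *
          (if odd n then LINT y|lborel. poly (\<phi> (p (n - 1))) y * w y else 1))"
        by (simp only: pair_sign_poly_weight[of n "\<lambda>i. \<phi> (p i)", THEN conjunct2])
      finally show "(LINT l|leb {..<n}. of_int (sign p) * poly (\<phi> (p n)) x * (pair_sign n l * poly_weight n (\<lambda>i. \<phi> (p i)) l)) =
        of_int (sign p) * ((\<Prod>k<n div 2. skew_form w (\<phi> (p (2 * k))) (\<phi> (p (2 * k + 1)))) *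
          (if odd n then LINT y|lborel. poly (\<phi> (p (n - 1))) y * w y else 1) * poly (\<phi> (p n)) x)"
        by (simp only: mult_ac)
    qed
    finally show ?thesis .
  qed
  have "P = Polynomial.smult Z (phi_hat \<phi> \<gamma> n)"
  proof (cases "even n")
    case True
    then obtain M where n: "n = 2 * M" by (elim evenE)
    obtain K where K: "K > 0" "\<And>f. (\<Sum>p | p permutes {..<Suc (2 * M)}. of_int (sign p) * (weight M p * f (p (2 * M)))) = K * f (2 * M)"
      using permutation_sum_even[of M] by blast
    have "poly (Polynomial.smult c P) x = poly (Polynomial.smult K (\<phi> n)) x" for x
      using cP[of x] K(2)[of "\<lambda>i. poly (\<phi> i) x"] by (simp add: n weight_def)
    then have eq: "Polynomial.smult c P = Polynomial.smult K (\<phi> n)" by (simp add: poly_eq_poly_eq_iff[symmetric] fun_eq_iff)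
    have "coeff (Polynomial.smult c P) n = coeff (Polynomial.smult K (\<phi> n)) n" by (simp only: eq)
    then have cz: "c * Z = K" by (simp add: coeff_P coeff_\<phi>)
    then have "c \<noteq> 0" using K(1) by auto
    moreover have "Polynomial.smult c P = Polynomial.smult c (Polynomial.smult Z (\<phi> n))" using eq cz by simp
    ultimately have "P = Polynomial.smult Z (\<phi> n)" by (metis smult_cancel)
    then show ?thesis using True by (simp add: phi_hat_def)
  next
    case False
    then obtain M where n: "n = Suc (2 * M)" by (elim oddE) simp
    define \<mu> where "\<mu> = (\<lambda>i. LINT x|lborel. poly (\<phi> i) x * w x)"
    obtain N where N: "N > 0" "\<And>f. (\<Sum>p | p permutes {..<Suc (Suc (2 * M))}. of_int (sign p) * (weight M p * \<mu> (p (2 * M)) * f (p (Suc (2 * M))))) =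
     N * (\<Sum>k<Suc M. \<mu> (2 * k) / \<sigma> k * f (Suc (2 * k)))"
      using permutation_sum_odd[of M] unfolding \<mu>_def by blast
    \<comment> \<open>This is where \<gamma>_(2k+1) = \<sigma>_k / \<gamma>_(2k) comes in.\<close>
    have \<mu>: "\<mu> (2 * k) / \<sigma> k = 1 / \<gamma> (Suc (2 * k))" for k
      using \<gamma>_even[of "2 * k"] \<gamma>_odd[of k] by (simp add: \<mu>_def)
    have "poly (Polynomial.smult c P) x = poly (Polynomial.smult (N / \<gamma> n) (phi_hat \<phi> \<gamma> n)) x" for x
    proof -
      have "poly (Polynomial.smult c P) x = N * (\<Sum>k<Suc M. 1 / \<gamma> (Suc (2 * k)) * poly (\<phi> (Suc (2 * k))) x)"
        using cP[of x] N(2)[of "\<lambda>i. poly (\<phi> i) x"] unfolding \<mu> by (simp add: n weight_def \<mu>_def)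
      also have "\<dots> = poly (Polynomial.smult (N / \<gamma> n) (phi_hat \<phi> \<gamma> n)) x"
        unfolding n phi_hat_odd poly_smult poly_sum sum_distrib_left
        using \<gamma>_pos[of "Suc (2 * M)"] by (intro sum.cong refl) simp
      finally show ?thesis .
    qed
    then have eq: "Polynomial.smult c P = Polynomial.smult (N / \<gamma> n) (phi_hat \<phi> \<gamma> n)" by (simp add: poly_eq_poly_eq_iff[symmetric] fun_eq_iff)
    have "coeff (\<phi> k) n = 0" if "k < n" for k using \<phi>[of k] that by (simp add: coeff_eq_0)
    then have "coeff (phi_hat \<phi> \<gamma> n) n = 1" using False coeff_\<phi>[of n] by (simp add: phi_hat_def coeff_sum)
    moreover have "coeff (Polynomial.smult c P) n = coeff (Polynomial.smult (N / \<gamma> n) (phi_hat \<phi> \<gamma> n)) n" by (simp only: eq)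
    ultimately have cz: "c * Z = N / \<gamma> n" by (simp add: coeff_P)
    then have "c \<noteq> 0" using N(1) \<gamma>_pos[of n] by auto
    moreover have "Polynomial.smult c P = Polynomial.smult c (Polynomial.smult Z (phi_hat \<phi> \<gamma> n))" using eq cz by simp
    ultimately show ?thesis by (metis smult_cancel)
  qed
  then show "(LINT l|leb {..<n}. root_density n l * poly (root_poly {..<n} l) x) = Z * poly (phi_hat \<phi> \<gamma> n) x"
    using P[of x] by simp
qed

end

section \<open>Transfer to the random matrix\<close>

lemma ordered_eigenvalues_real_simple:
  assumes "char_poly B \<in> real_simple n" "i < n"
  shows "ordered_eigenvalues B ! i = ordered_roots n (char_poly B) i"
proof -
  define l where "l = ordered_roots n (char_poly B)"
  have l: "strict_mono_on {..<n} l" "root_poly {..<n} l = char_poly B"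
    using ordered_roots[OF assms(1)] by (auto simp: l_def)
  have "proots (char_poly B) = (\<Sum>j<n. {#l j#})"
    unfolding l(2)[symmetric] root_poly_def by (subst proots_prod) auto
  also have "\<dots> = mset (map l [0..<n])"
    by (induction n) auto
  finally have m: "proots (char_poly B) = mset (map l [0..<n])" .
  have "sorted (map l [0..<n])"
    unfolding sorted_iff_nth_mono using l(1) by (auto simp: strict_mono_on_def le_less)
  then have "sorted_list_of_multiset (mset (map l [0..<n])) = map l [0..<n]"
    by (metis mset_sorted_list_of_multiset properties_for_sort sorted_sorted_list_of_multiset sort_key_id_if_sorted)
  then show ?thesis using assms(2) by (simp add: ordered_eigenvalues_def m l_def)
qed

lemma measurable_char_poly_sym_mat_lborel [measurable]: "char_poly \<in> measurable (sym_mat_lborel n) polyM"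
  unfolding sym_mat_lborel_def by (rule measurable_embed_measure1) (rule measurable_char_poly_sym_mat_of)

theorem lemma3p6:
  fixes w :: "real \<Rightarrow> real"
    and \<phi> :: "nat \<Rightarrow> real poly"
    and \<sigma> \<gamma> :: "nat \<Rightarrow> real"
    and n :: nat
    and M :: "'a measure"
    and A :: "'a \<Rightarrow> real mat"
  assumes "w \<in> borel_measurable borel"
    and "\<And>x. w x \<ge> 0"
    and "\<And>k::nat. integrable lborel (\<lambda>x. x ^ k * w x)"
    and "(LINT x|lborel. w x) > 0"
    and "skew_orthogonal_system w \<phi> \<sigma> \<gamma>"
    and "n \<ge> 1"
    and "prob_space M"
    and "\<exists>c>0. distributed M (sym_mat_lborel n) A
           (\<lambda>B. ennreal (c * (\<Prod>i<n. w (ordered_eigenvalues B ! i))))"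
  shows "(\<forall>x. integrable M (\<lambda>\<omega>. det (x \<cdot>\<^sub>m 1\<^sub>m n - A \<omega>)) \<and>
              prob_space.expectation M (\<lambda>\<omega>. det (x \<cdot>\<^sub>m 1\<^sub>m n - A \<omega>)) = poly (phi_hat \<phi> \<gamma> n) x) \<and>
         \<phi> n = (if even n then phi_hat \<phi> \<gamma> n
                else if n = 1 then phi_hat \<phi> \<gamma> n
                else phi_hat \<phi> \<gamma> n - Polynomial.smult (\<gamma> n / \<gamma> (n - 2)) (phi_hat \<phi> \<gamma> (n - 2)))"
proof -
  interpret skew_orthogonal w \<phi> \<sigma> \<gamma>
    using assms(1-3,5) by unfold_locales auto
  interpret M: prob_space M by fact
  obtain c where c: "c > 0" and dist: "distributed M (sym_mat_lborel n) A (\<lambda>B. ennreal (c * (\<Prod>i<n. w (ordered_eigenvalues B ! i))))"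
    using assms(8) by blast
  have A [measurable]: "A \<in> measurable M (sym_mat_lborel n)" using distributed_measurable[OF dist] .
  define Y where "Y = (\<lambda>\<omega>. char_poly (A \<omega>))"
  have Y [measurable]: "Y \<in> measurable M polyM" unfolding Y_def by measurable
  obtain C :: ennreal where C: "\<And>G. G \<in> borel_measurable polyM \<Longrightarrow>
     (\<integral>\<^sup>+a. G (char_poly (sym_mat_of n a)) \<partial>leb (upper_indices n)) =
     C * (\<integral>\<^sup>+c. G (monic_poly n c) * indicator (real_simple n) (monic_poly n c) \<partial>leb {..<n})"
    using char_poly_distribution[of n] by blast
  note [measurable] = measurable_char_poly_sym_mat_of
  have AE: "AE a in leb (upper_indices n). char_poly (sym_mat_of n a) \<in> real_simple n"
    by (rule AE_real_simple_of_distribution[OF C])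
  have law: "(\<integral>\<^sup>+\<omega>. G (Y \<omega>) \<partial>M) = C * (\<integral>\<^sup>+l. ennreal (c * root_density n l) * G (root_poly {..<n} l) \<partial>leb {..<n})"
    if G [measurable]: "G \<in> borel_measurable polyM" for G
  proof -
    \<comment> \<open>The matrix density as a function of the characteristic polynomial; the two
      agree wherever the spectrum is simple, hence almost everywhere.\<close>
    define W where "W = (\<lambda>p. ennreal (c * (\<Prod>i<n. w (ordered_roots n p i))))"
    have [measurable]: "(\<lambda>p. ordered_roots n p i) \<in> borel_measurable polyM" if "i \<in> {..<n}" for i
      using that measurable_ordered_roots by simp
    have W [measurable]: "W \<in> borel_measurable polyM" unfolding W_def by measurable
    define f where "f = (\<lambda>B. ennreal (c * (\<Prod>i<n. w (ordered_eigenvalues B ! i))))"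
    have f [measurable]: "f \<in> borel_measurable (sym_mat_lborel n)"
      unfolding f_def using distributed_borel_measurable[OF dist] .
    have "(\<integral>\<^sup>+\<omega>. G (Y \<omega>) \<partial>M) = (\<integral>\<^sup>+B. f B * G (char_poly B) \<partial>sym_mat_lborel n)"
      unfolding Y_def f_def by (rule distributed_nn_integral[OF dist, symmetric]) measurable
    also have "\<dots> = (\<integral>\<^sup>+a. f (sym_mat_of n a) * G (char_poly (sym_mat_of n a)) \<partial>leb (upper_indices n))"
      unfolding sym_mat_lborel_def
      by (rule nn_integral_embed_measure'[OF inj_on_sym_mat_of]) (unfold sym_mat_lborel_def[symmetric], measurable)
    also have "\<dots> = (\<integral>\<^sup>+a. W (char_poly (sym_mat_of n a)) * G (char_poly (sym_mat_of n a)) \<partial>leb (upper_indices n))"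
    proof (rule nn_integral_cong_AE, use AE in eventually_elim)
      fix a assume "char_poly (sym_mat_of n a) \<in> real_simple n"
      then have "f (sym_mat_of n a) = W (char_poly (sym_mat_of n a))"
        using ordered_eigenvalues_real_simple[of "sym_mat_of n a" n] by (simp add: f_def W_def)
      then show "f (sym_mat_of n a) * G (char_poly (sym_mat_of n a)) = W (char_poly (sym_mat_of n a)) * G (char_poly (sym_mat_of n a))"
        by simp
    qed
    also have "\<dots> = C * (\<integral>\<^sup>+c. (W (monic_poly n c) * G (monic_poly n c)) * indicator (real_simple n) (monic_poly n c) \<partial>leb {..<n})"
      by (rule C[of "\<lambda>p. W p * G p"]) measurable
    also have "(\<integral>\<^sup>+c. (W (monic_poly n c) * G (monic_poly n c)) * indicator (real_simple n) (monic_poly n c) \<partial>leb {..<n}) =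
       (\<integral>\<^sup>+l. (if chamber n l then ennreal (vdm n l) * (W (root_poly {..<n} l) * G (root_poly {..<n} l)) else 0) \<partial>leb {..<n})"
      by (rule nn_integral_root_coordinates[of "\<lambda>p. W p * G p"]) measurable
    also have "\<dots> = (\<integral>\<^sup>+l. ennreal (c * root_density n l) * G (root_poly {..<n} l) \<partial>leb {..<n})"
    proof (rule nn_integral_cong)
      fix l :: "nat \<Rightarrow> real"
      show "(if chamber n l then ennreal (vdm n l) * (W (root_poly {..<n} l) * G (root_poly {..<n} l)) else 0) =
        ennreal (c * root_density n l) * G (root_poly {..<n} l)"
      proof (cases "chamber n l")
        case True
        then have "W (root_poly {..<n} l) = ennreal (c * (\<Prod>i<n. w (l i)))"
          using ordered_roots_root_poly[of n l] by (simp add: W_def chamber_iff)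
        moreover have "ennreal (vdm n l) * ennreal (c * (\<Prod>i<n. w (l i))) = ennreal (c * root_density n l)"
          using True vdm_pos[OF True] c by (subst ennreal_mult[symmetric]) (auto simp: root_density_def mult_ac intro!: mult_nonneg_nonneg prod_nonneg w_nonneg)
        ultimately show ?thesis using True by (simp add: mult.assoc[symmetric])
      qed (simp add: root_density_def)
    qed
    finally show ?thesis .
  qed
  define Z where "Z = (LINT l|leb {..<n}. root_density n l)"
  have Z0: "Z \<ge> 0" unfolding Z_def by (intro integral_nonneg_AE) (simp add: root_density_nonneg)
  have "(\<integral>\<^sup>+l. ennreal (c * root_density n l) \<partial>leb {..<n}) = ennreal (c * Z)"
    unfolding Z_def using c integral_root_density(3)[of n]
    by (subst nn_integral_eq_integral) (auto simp: root_density_nonneg)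
  then have one: "C * ennreal (c * Z) = 1"
    using law[of "\<lambda>_. 1"] by (simp add: M.emeasure_space_1)
  \<comment> \<open>An infinite \<open>C\<close> would make the product 0 or infinite, never
    1.\<close>
  have "C \<noteq> \<top>"
  proof
    assume "C = \<top>"
    with one show False by (cases "ennreal (c * Z) = 0") (auto simp: ennreal_top_mult)
  qed
  then obtain r where r: "C = ennreal r" "r \<ge> 0" by (cases C) auto
  have rcZ: "r * c * Z = 1"
  proof -
    have "ennreal (r * (c * Z)) = ennreal 1" using one r c Z0 by (simp add: ennreal_mult)
    then show ?thesis using r c Z0 by (subst (asm) ennreal_inj) (auto simp: mult.assoc)
  qed
  \<comment> \<open>The normalised law of the ordered roots.\<close>
  define \<nu> where "\<nu> = density (leb {..<n}) (\<lambda>l. ennreal (r * c * root_density n l))"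
  have rp [measurable]: "root_poly {..<n} \<in> measurable \<nu> polyM"
  proof -
    have "root_poly {..<n} \<in> measurable (leb {..<n}) polyM"
      by (intro measurable_root_poly measurable_leb_coordinate)
    then show ?thesis by (simp add: \<nu>_def)
  qed
  \<comment> \<open>\<open>law\<close> covers nonnegative functions only; equality of the image
    measures extends it to the signed function p(x), integrability included.\<close>
  have distr: "distr M polyM Y = distr \<nu> polyM (root_poly {..<n})"
  proof (rule measure_eqI)
    fix S assume "S \<in> sets (distr M polyM Y)"
    then have S [measurable]: "S \<in> sets polyM" by simp
    have rp' [measurable]: "root_poly {..<n} \<in> measurable (leb {..<n}) polyM"
      by (intro measurable_root_poly measurable_leb_coordinate)
    have "emeasure (distr M polyM Y) S = (\<integral>\<^sup>+\<omega>. indicator S (Y \<omega>) \<partial>M)"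
      by (subst nn_integral_distr[symmetric, of Y M polyM]) auto
    also have "\<dots> = ennreal r * (\<integral>\<^sup>+l. ennreal (c * root_density n l) * indicator S (root_poly {..<n} l) \<partial>leb {..<n})"
      by (subst law) (auto simp: r)
    also have "\<dots> = (\<integral>\<^sup>+l. ennreal r * (ennreal (c * root_density n l) * indicator S (root_poly {..<n} l)) \<partial>leb {..<n})"
      by (rule nn_integral_cmult[symmetric]) measurable
    also have "\<dots> = (\<integral>\<^sup>+l. ennreal (r * c * root_density n l) * indicator S (root_poly {..<n} l) \<partial>leb {..<n})"
      using r c by (intro nn_integral_cong) (simp add: ennreal_mult root_density_nonneg mult.assoc)
    also have "\<dots> = (\<integral>\<^sup>+l. indicator S (root_poly {..<n} l) \<partial>\<nu>)"
      unfolding \<nu>_def by (subst nn_integral_density) auto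
    also have "\<dots> = emeasure (distr \<nu> polyM (root_poly {..<n})) S"
      by (subst nn_integral_distr[symmetric, of "root_poly {..<n}" \<nu> polyM]) auto
    finally show "emeasure (distr M polyM Y) S = emeasure (distr \<nu> polyM (root_poly {..<n})) S" .
  qed simp
  have main: "integrable M (\<lambda>\<omega>. det (x \<cdot>\<^sub>m 1\<^sub>m n - A \<omega>)) \<and> M.expectation (\<lambda>\<omega>. det (x \<cdot>\<^sub>m 1\<^sub>m n - A \<omega>)) = poly (phi_hat \<phi> \<gamma> n) x" for x
  proof -
    have ev [measurable]: "(\<lambda>p. poly p x) \<in> borel_measurable polyM" by measurable
    have rp' [measurable]: "root_poly {..<n} \<in> measurable (leb {..<n}) polyM"
      by (intro measurable_root_poly measurable_leb_coordinate)
    have det: "det (x \<cdot>\<^sub>m 1\<^sub>m n - A \<omega>) = poly (Y \<omega>) x" if "\<omega> \<in> space M" for \<omega>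
    proof -
      have "A \<omega> \<in> carrier_mat n n" using measurable_space[OF A that] by (simp add: space_sym_mat_lborel)
      moreover from this have "x \<cdot>\<^sub>m 1\<^sub>m n - A \<omega> = - char_matrix (A \<omega>) x"
        by (intro eq_matI) (auto simp: char_matrix_def)
      ultimately show ?thesis unfolding Y_def by (simp add: char_poly_matrix)
    qed
    have "integrable \<nu> (\<lambda>l. poly (root_poly {..<n} l) x)"
      unfolding \<nu>_def using integral_root_density(1)[of n x] r c
      by (subst integrable_density) (auto simp: root_density_nonneg mult.assoc intro!: integrable_mult_right)
    then have "integrable M (\<lambda>\<omega>. poly (Y \<omega>) x)"
      using integrable_distr_eq[OF Y ev] integrable_distr_eq[OF rp ev] unfolding distr by simp
    moreover have "(LINT \<omega>|M. poly (Y \<omega>) x) = poly (phi_hat \<phi> \<gamma> n) x"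
    proof -
      have "(LINT \<omega>|M. poly (Y \<omega>) x) = (LINT l|\<nu>. poly (root_poly {..<n} l) x)"
        using integral_distr[OF Y ev] integral_distr[OF rp ev] unfolding distr by simp
      also have "\<dots> = (LINT l|leb {..<n}. r * c * (root_density n l * poly (root_poly {..<n} l) x))"
        unfolding \<nu>_def using r c by (subst integral_density) (auto simp: root_density_nonneg mult.assoc)
      also have "\<dots> = r * c * (Z * poly (phi_hat \<phi> \<gamma> n) x)"
        using integral_root_density(1,2)[of n x] by (simp add: Z_def)
      finally show ?thesis using rcZ by (simp add: mult.assoc[symmetric])
    qed
    ultimately show ?thesis
      using det by (simp cong: Bochner_Integration.integrable_cong Bochner_Integration.integral_cong)
  qed
  show ?thesis using main phi_hat_inverse[of n] by blast
qed

end
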